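(* There exists a constant $C>0$ such that the following holds for all $S$, $\Omega$ and $\delta$. If $S\in M_{op}^*$ and $\Omega\subset\mathbb{R}^{2d}$ is a compact domain with finite perimeter such that $\|S\|_{M_{op}^*}^2|\partial\Omega|\ge 1$, then for any $\delta>0$ $$\left|\left\{z\in\mathbb{R}^{2d}:\left|\rho_\Omega^S(z)-\chi_\Omega(z)\right|>\delta\right\}\right|\le \frac{C}{\delta^2}\,\|S\|_{M_{op}^*}^2\,|\partial\Omega| .$$
   Context: Fix $d\ge 1$. For $z=(x,\omega)\in\mathbb{R}^{2d}$ let $\pi(z)\psi(t)=e^{2\pi i\omega\cdot t}\psi(t-x)$ on $L^2(\mathbb{R}^d)$. For a bounded operator $A$ on $L^2(\mathbb{R}^d)$ let $\alpha_z(A)=\pi(z)A\pi(z)^*$ and $\check A=PAP$, where $P\psi(x)=\psi(-x)$. For $f\in L^1(\mathbb{R}^{2d})$ and a trace class operator $S$, $f\star S=\int_{\mathbb{R}^{2d}}f(z)\alpha_z(S)\,dz$ (weakly defined; a trace class operator). For trace class operators $S,T$, $S\star T$ is the function $S\star T(z)=\mathrm{tr}(S\,\alpha_z(\check T))$ on $\mathbb{R}^{2d}$. The rank-one operator $\psi\otimes\varphi$ is $\xi\mapsto\langle\xi,\varphi\rangle\psi$. A density operator is a positive trace class operator $S$ with $\mathrm{tr}(S)=1$. Write $\tilde S=S\star\check S$ and, for $\psi\in L^2(\mathbb{R}^d)$, $Q_S(\psi)=\check S\star(\psi\otimes\psi)$. $M_{op}^*$ is the set of density operators $S$ on $L^2(\mathbb{R}^d)$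 with $\|S\|_{M_{op}^*}^2:=\int_{\mathbb{R}^{2d}}\tilde S(z)|z|\,dz<\infty$, where $|z|$ is the Euclidean norm. A compact domain is a compact subset $\Omega\subset\mathbb{R}^{2d}$; $|\Omega|$ denotes Lebesgue measure, $\chi_\Omega$ the characteristic function. $|\partial\Omega|:=\mathrm{Var}(\chi_\Omega)$ is the total variation of $\chi_\Omega$ on $\mathbb{R}^{2d}$, and $\Omega$ has finite perimeter if $\chi_\Omega$ has bounded variation. The operator $\chi_\Omega\star S$ is positive and trace class; $\lambda_1^\Omega\ge\lambda_2^\Omega\ge\cdots$ are its eigenvalues (with multiplicity, in decreasing order) and $\{h_k^\Omega\}_{k\in\mathbb{N}}$ is an orthonormal system of corresponding eigenfunctions, so that $\chi_\Omega\star S=\sum_{k\ge1}\lambda_k^\Omega h_k^\Omega\otimes h_k^\Omega$ (any fixed choice). With $A_\Omega=\lceil|\Omega|\rceil$, $\rho_\Omega^S(z)=\sum_{k=1}^{A_\Omega}Q_S(h_k^\Omega)(z)$. *)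

theory Defs
  imports "HOL-Analysis.Analysis"
begin

section \<open>The complex Hilbert space of square-integrable functions\<close>

text \<open>
  Elements are classes of square-integrable, complex-valued Borel functions modulo equality
  almost everywhere. Since every Lebesgue measurable function agrees almost everywhere with a
  Borel function, this is the usual space of square-integrable functions.
\<close>

definition sq_integrable :: "('a::euclidean_space \<Rightarrow> complex) \<Rightarrow> bool" where
  "sq_integrable f \<longleftrightarrow>
     f \<in> borel_measurable lborel \<and> integrable lborel (\<lambda>t. (cmod (f t))\<^sup>2)"

definition l2rel :: "('a::euclidean_space \<Rightarrow> complex) \<Rightarrow> ('a \<Rightarrow> complex) \<Rightarrow> bool" where
  "l2rel f g \<longleftrightarrow> sq_integrable f \<and> sq_integrable g \<and> (AE t in lborel. f t = g t)"

lemma sq_integrable_zero: "sq_integrable (\<lambda>_. 0)"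
  by (simp add: sq_integrable_def)

lemma sq_integrable_cmult: "sq_integrable f \<Longrightarrow> sq_integrable (\<lambda>t. c * f t)"
  by (auto simp: sq_integrable_def norm_mult power_mult_distrib)

lemma sq_integrable_add:
  assumes "sq_integrable f" "sq_integrable g"
  shows "sq_integrable (\<lambda>t. f t + g t)"
proof -
  have m[measurable]: "f \<in> borel_measurable lborel" "g \<in> borel_measurable lborel"
    using assms by (auto simp: sq_integrable_def)
  have *: "norm ((cmod (f t + g t))\<^sup>2) \<le> norm (2 * (cmod (f t))\<^sup>2 + 2 * (cmod (g t))\<^sup>2)" for t
  proof -
    have "(cmod (f t + g t))\<^sup>2 \<le> (cmod (f t) + cmod (g t))\<^sup>2"
      by (intro power_mono norm_triangle_ineq) auto
    also have "\<dots> \<le> 2 * (cmod (f t))\<^sup>2 + 2 * (cmod (g t))\<^sup>2"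
      using zero_le_power2[of "cmod (f t) - cmod (g t)"]
      by (simp add: power2_eq_square algebra_simps)
    finally show ?thesis by simp
  qed
  have "integrable lborel (\<lambda>t. 2 * (cmod (f t))\<^sup>2 + 2 * (cmod (g t))\<^sup>2)"
    using assms by (auto simp: sq_integrable_def)
  then have "integrable lborel (\<lambda>t. (cmod (f t + g t))\<^sup>2)"
  proof (rule Bochner_Integration.integrable_bound)
    show "(\<lambda>t. (cmod (f t + g t))\<^sup>2) \<in> borel_measurable lborel"
      by measurable
    show "AE t in lborel. norm ((cmod (f t + g t))\<^sup>2)
        \<le> norm (2 * (cmod (f t))\<^sup>2 + 2 * (cmod (g t))\<^sup>2)"
      by (rule AE_I2) (rule *)
  qed
  then show ?thesis
    by (simp add: sq_integrable_def)
qed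

lemma sq_integrable_uminus: "sq_integrable f \<Longrightarrow> sq_integrable (\<lambda>t. - f t)"
  using sq_integrable_cmult[of f "-1"] by simp

lemma sq_integrable_diff:
  "sq_integrable f \<Longrightarrow> sq_integrable g \<Longrightarrow> sq_integrable (\<lambda>t. f t - g t)"
  using sq_integrable_add[OF _ sq_integrable_uminus, of f g] by simp

lemma sq_integrable_mult_cnj:
  assumes "sq_integrable f" "sq_integrable g"
  shows "integrable lborel (\<lambda>t. f t * cnj (g t))"
proof -
  have m[measurable]: "f \<in> borel_measurable lborel" "g \<in> borel_measurable lborel"
    using assms by (auto simp: sq_integrable_def)
  have i: "integrable lborel (\<lambda>t. (cmod (f t))\<^sup>2 + (cmod (g t))\<^sup>2)"
    using assms by (auto simp: sq_integrable_def)
  have *: "norm (f t * cnj (g t)) \<le> norm ((cmod (f t))\<^sup>2 + (cmod (g t))\<^sup>2)" for t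
  proof -
    have "2 * (cmod (f t) * cmod (g t)) \<le> (cmod (f t))\<^sup>2 + (cmod (g t))\<^sup>2"
      using zero_le_power2[of "cmod (f t) - cmod (g t)"]
      by (simp add: power2_eq_square algebra_simps)
    moreover have "0 \<le> cmod (f t) * cmod (g t)" by simp
    ultimately have "cmod (f t) * cmod (g t) \<le> (cmod (f t))\<^sup>2 + (cmod (g t))\<^sup>2"
      by linarith
    then show ?thesis by (simp add: norm_mult)
  qed
  have **: "(\<lambda>t. f t * cnj (g t)) \<in> borel_measurable lborel"
    using m by (intro borel_measurable_times borel_measurable_continuous_on[OF continuous_on_cnj]) 
      (auto intro: continuous_on_id)
  show ?thesis
    by (rule Bochner_Integration.integrable_bound[OF i ** AE_I2]) (rule *)
qed

lemma l2rel_comp: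
  fixes T :: "'a::euclidean_space \<Rightarrow> 'a"
  assumes T: "T \<in> borel_measurable borel" "distr lborel borel T = lborel" and "l2rel f g"
  shows "l2rel (\<lambda>t. f (T t)) (\<lambda>t. g (T t))"
proof -
  have m[measurable]: "f \<in> borel_measurable borel" "g \<in> borel_measurable borel"
    "T \<in> borel_measurable borel"
    using assms by (auto simp: l2rel_def sq_integrable_def)
  have *: "integrable lborel (\<lambda>t. (cmod (h (T t)))\<^sup>2)"
    if [measurable]: "h \<in> borel_measurable borel" and i: "integrable lborel (\<lambda>t. (cmod (h t))\<^sup>2)" for h
  proof -
    have "integrable (distr lborel borel T) (\<lambda>t. (cmod (h t))\<^sup>2)" using i T by simp
    then show ?thesis by (subst (asm) integrable_distr_eq) auto
  qed
  have "AE t in distr lborel borel T. f t = g t"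
    unfolding T(2) using assms(3) by (simp add: l2rel_def)
  then have "AE t in lborel. f (T t) = g (T t)"
    by (subst (asm) AE_distr_iff) auto
  with * assms(3) show ?thesis
    by (auto simp: l2rel_def sq_integrable_def)
qed

lemma distr_lborel_shift: "distr lborel borel (\<lambda>t. t - x) = (lborel :: 'a::euclidean_space measure)"
proof -
  have "(\<lambda>t. t - x) = (+) (- x)" by auto
  then show ?thesis by (simp add: lborel_distr_plus)
qed

lemma distr_lborel_reflect: "distr lborel borel uminus = (lborel :: 'a::euclidean_space measure)"
  using lborel_affine[of "-1" "0::'a"] by (simp add: density_1)

quotient_type (overloaded) 'a l2 = "'a::euclidean_space \<Rightarrow> complex" / partial: l2rel
proof (rule part_equivpI)
  show "\<exists>f. l2rel f f"
    by (rule exI[of _ "\<lambda>_. 0"]) (simp add: l2rel_def sq_integrable_zero)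
  show "symp l2rel"
    by (rule sympI) (auto simp: l2rel_def)
  show "transp l2rel"
    by (rule transpI) (auto simp: l2rel_def)
qed

lift_definition cinner :: "'a::euclidean_space l2 \<Rightarrow> 'a l2 \<Rightarrow> complex" is
  "\<lambda>f g. (LINT t|lborel. f t * cnj (g t))"
  unfolding l2rel_def
  by (intro integral_cong_AE borel_measurable_integrable sq_integrable_mult_cnj) auto

lift_definition cscale :: "complex \<Rightarrow> 'a::euclidean_space l2 \<Rightarrow> 'a l2" is
  "\<lambda>c f t. c * f t"
  by (auto simp: l2rel_def sq_integrable_cmult)

instantiation l2 :: (euclidean_space) real_inner
begin

lift_definition zero_l2 :: "'a l2" is "\<lambda>_. 0"
  by (simp add: l2rel_def sq_integrable_zero)

lift_definition plus_l2 :: "'a l2 \<Rightarrow> 'a l2 \<Rightarrow> 'a l2" is "\<lambda>f g t. f t + g t"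
  by (auto simp: l2rel_def sq_integrable_add)

lift_definition minus_l2 :: "'a l2 \<Rightarrow> 'a l2 \<Rightarrow> 'a l2" is "\<lambda>f g t. f t - g t"
  by (auto simp: l2rel_def sq_integrable_diff)

lift_definition uminus_l2 :: "'a l2 \<Rightarrow> 'a l2" is "\<lambda>f t. - f t"
  by (auto simp: l2rel_def sq_integrable_uminus)

definition scaleR_l2 :: "real \<Rightarrow> 'a l2 \<Rightarrow> 'a l2" where
  "scaleR_l2 r f = cscale (of_real r) f"

definition inner_l2 :: "'a l2 \<Rightarrow> 'a l2 \<Rightarrow> real" where
  "inner_l2 f g = Re (cinner f g)"

definition norm_l2 :: "'a l2 \<Rightarrow> real" where
  "norm_l2 f = sqrt (inner f f)"

definition sgn_l2 :: "'a l2 \<Rightarrow> 'a l2" where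
  "sgn_l2 f = inverse (norm f) *\<^sub>R f"

definition dist_l2 :: "'a l2 \<Rightarrow> 'a l2 \<Rightarrow> real" where
  "dist_l2 f g = norm (f - g)"

definition uniformity_l2 :: "('a l2 \<times> 'a l2) filter" where
  "uniformity_l2 = (INF e\<in>{0<..}. principal {(f, g). dist f g < e})"

definition open_l2 :: "'a l2 set \<Rightarrow> bool" where
  "open_l2 U \<longleftrightarrow> (\<forall>f\<in>U. eventually (\<lambda>(f', g). f' = f \<longrightarrow> g \<in> U) uniformity)"

instance
proof
  fix f g h :: "'a l2" and a b r :: real and U :: "'a l2 set"
  show "f + g + h = f + (g + h)"
    by transfer (auto simp: l2rel_def algebra_simps intro!: sq_integrable_add)
  show "f + g = g + f"
    by transfer (auto simp: l2rel_def algebra_simps intro!: sq_integrable_add)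
  show "0 + f = f"
    by transfer (auto simp: l2rel_def)
  show "- f + f = 0"
    by transfer (auto simp: l2rel_def sq_integrable_zero)
  show "f - g = f + - g"
    by transfer (auto simp: l2rel_def intro!: sq_integrable_diff)
  show "a *\<^sub>R (f + g) = a *\<^sub>R f + a *\<^sub>R g"
    unfolding scaleR_l2_def
    by transfer (auto simp: l2rel_def distrib_left intro!: sq_integrable_add sq_integrable_cmult)
  show "(a + b) *\<^sub>R f = a *\<^sub>R f + b *\<^sub>R f"
    unfolding scaleR_l2_def
    by transfer (auto simp: l2rel_def distrib_right intro!: sq_integrable_add sq_integrable_cmult)
  show "a *\<^sub>R b *\<^sub>R f = (a * b) *\<^sub>R f"
    unfolding scaleR_l2_def
    by transfer (auto simp: l2rel_def mult.assoc intro!: sq_integrable_cmult)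
  show "1 *\<^sub>R f = f"
    unfolding scaleR_l2_def by transfer (auto simp: l2rel_def)
  show "sgn f = inverse (norm f) *\<^sub>R f" by (rule sgn_l2_def)
  show "dist f g = norm (f - g)" by (rule dist_l2_def)
  show "uniformity = (INF e\<in>{0<..}. principal {(f, g :: 'a l2). dist f g < e})"
    by (rule uniformity_l2_def)
  show "open U \<longleftrightarrow> (\<forall>f\<in>U. eventually (\<lambda>(f', g). f' = f \<longrightarrow> g \<in> U) uniformity)"
    by (rule open_l2_def)
  show "norm f = sqrt (inner f f)" by (rule norm_l2_def)
  have "cinner g f = cnj (cinner f g)"
    by transfer (subst Bochner_Integration.integral_cnj[symmetric], simp add: mult.commute)
  then show "inner f g = inner g f"
    by (simp add: inner_l2_def)
  have "cinner (f + g) h = cinner f h + cinner g h"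
    by transfer (simp add: l2rel_def distrib_right sq_integrable_mult_cnj)
  then show "inner (f + g) h = inner f h + inner g h"
    by (simp add: inner_l2_def)
  have "cinner (cscale c f) g = c * cinner f g" for c
    by transfer (simp add: mult.assoc)
  then show "inner (r *\<^sub>R f) g = r * inner f g"
    by (simp add: inner_l2_def scaleR_l2_def)
  have eq: "inner f f = (LINT t|lborel. (cmod (rep_l2 f t))\<^sup>2)"
    and rep: "sq_integrable (rep_l2 f)" and abs: "f = abs_l2 (rep_l2 f)"
  proof -
    have r: "l2rel (rep_l2 f) (rep_l2 f)" 
      by (rule Quotient3_rep_reflp[OF Quotient3_l2])
    then show "sq_integrable (rep_l2 f)" by (simp add: l2rel_def)
    show a: "f = abs_l2 (rep_l2 f)" by (simp add: Quotient3_abs_rep[OF Quotient3_l2])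
    have "cinner f f = (LINT t|lborel. rep_l2 f t * cnj (rep_l2 f t))"
      by (simp add: cinner_def)
    also have "\<dots> = (LINT t|lborel. of_real ((cmod (rep_l2 f t))\<^sup>2))"
      by (simp only: complex_norm_square)
    also have "\<dots> = of_real (LINT t|lborel. (cmod (rep_l2 f t))\<^sup>2)"
      by (rule integral_complex_of_real)
    finally show "inner f f = (LINT t|lborel. (cmod (rep_l2 f t))\<^sup>2)"
      by (simp add: inner_l2_def)
  qed
  show "0 \<le> inner f f" by (simp add: eq)
  show "inner f f = 0 \<longleftrightarrow> f = 0"
  proof
    assume "inner f f = 0"
    then have "AE t in lborel. (cmod (rep_l2 f t))\<^sup>2 = 0"
      using rep unfolding eq sq_integrable_def
      by (subst (asm) integral_nonneg_eq_0_iff_AE) auto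
    then have "l2rel (rep_l2 f) (\<lambda>_. 0)"
      using rep by (auto simp: l2rel_def sq_integrable_zero)
    then show "f = 0"
      unfolding zero_l2_def by (subst abs) (rule Quotient3_rel_abs[OF Quotient3_l2])
  next
    assume "f = 0"
    moreover have "cinner (0 :: 'a l2) 0 = 0" by transfer simp
    ultimately show "inner f f = 0" by (simp add: inner_l2_def)
  qed
qed

end


section \<open>Operators and trace\<close>

type_synonym 'a l2op = "'a l2 \<Rightarrow> 'a l2"

definition bounded_op :: "'a::euclidean_space l2op \<Rightarrow> bool" where
  "bounded_op A \<longleftrightarrow> bounded_linear A \<and> (\<forall>c f. A (cscale c f) = cscale c (A f))"

definition adj :: "'a::euclidean_space l2op \<Rightarrow> 'a l2op" where
  "adj A = (THE B. \<forall>f g. cinner (A f) g = cinner f (B g))"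

definition positive_op :: "'a::euclidean_space l2op \<Rightarrow> bool" where
  "positive_op A \<longleftrightarrow> bounded_op A \<and> (\<forall>f. cinner (A f) f \<in> \<real>\<^sub>\<ge>\<^sub>0)"

text \<open>An orthonormal basis is a maximal (complete) orthonormal set.\<close>

definition is_onb :: "'a::euclidean_space l2 set \<Rightarrow> bool" where
  "is_onb E \<longleftrightarrow>
     (\<forall>e\<in>E. \<forall>e'\<in>E. cinner e e' = (if e = e' then 1 else 0)) \<and>
     (\<forall>f. (\<forall>e\<in>E. cinner f e = 0) \<longrightarrow> f = 0)"

text \<open>
  The operator \<open>B\<close> below is the unique positive square root of \<open>A\<^sup>* A\<close>, that is, the absolute
  value of \<open>A\<close>. Summability of its diagonal does not depend on the orthonormal basis.
\<close>

definition trace_class :: "'a::euclidean_space l2op \<Rightarrow> bool" where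
  "trace_class A \<longleftrightarrow> bounded_op A \<and>
     (\<exists>B. positive_op B \<and> B \<circ> B = adj A \<circ> A \<and>
        (\<exists>E. is_onb E \<and> (\<lambda>e. cinner (B e) e) summable_on E))"

text \<open>For a trace class operator the value does not depend on the orthonormal basis chosen.\<close>

definition op_trace :: "'a::euclidean_space l2op \<Rightarrow> complex" where
  "op_trace A = (\<Sum>\<^sub>\<infinity>e\<in>(SOME E. is_onb E). cinner (A e) e)"

definition density_operator :: "'a::euclidean_space l2op \<Rightarrow> bool" where
  "density_operator S \<longleftrightarrow> positive_op S \<and> trace_class S \<and> op_trace S = 1"

definition rank_one :: "'a::euclidean_space l2 \<Rightarrow> 'a l2 \<Rightarrow> 'a l2op" where
  "rank_one \<psi> \<phi> = (\<lambda>\<xi>. cscale (cinner \<xi> \<phi>) \<psi>)"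


section \<open>Quantum harmonic analysis\<close>

text \<open>Points of phase space are pairs; the norm on the product type is the Euclidean one.\<close>

lift_definition tf_shift :: "'a::euclidean_space \<times> 'a \<Rightarrow> 'a l2op" is
  "\<lambda>(x, \<omega>) \<psi> t. cis (2 * pi * (\<omega> \<bullet> t)) * \<psi> (t - x)"
proof -
  fix z :: "'a \<times> 'a" and f g :: "'a \<Rightarrow> complex"
  assume "l2rel f g"
  obtain x \<omega> where z: "z = (x, \<omega>)" by (cases z)
  have *: "l2rel (\<lambda>t. f (t - x)) (\<lambda>t. g (t - x))"
    by (rule l2rel_comp) (use \<open>l2rel f g\<close> in \<open>auto simp: distr_lborel_shift\<close>)
  have c: "(\<lambda>t. cis (2 * pi * (\<omega> \<bullet> t))) \<in> borel_measurable borel"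
    by (intro borel_measurable_continuous_onI) (auto intro!: continuous_intros)
  show "l2rel ((case z of (x, \<omega>) \<Rightarrow> \<lambda>\<psi> t. cis (2 * pi * (\<omega> \<bullet> t)) * \<psi> (t - x)) f)
         ((case z of (x, \<omega>) \<Rightarrow> \<lambda>\<psi> t. cis (2 * pi * (\<omega> \<bullet> t)) * \<psi> (t - x)) g)"
    using * c by (auto simp: z l2rel_def sq_integrable_def norm_mult)
qed

lift_definition parity :: "'a::euclidean_space l2op" is "\<lambda>\<psi> t. \<psi> (- t)"
  by (rule l2rel_comp[of uminus]) (auto simp: distr_lborel_reflect)

definition op_shift :: "'a::euclidean_space \<times> 'a \<Rightarrow> 'a l2op \<Rightarrow> 'a l2op" where
  "op_shift z A = tf_shift z \<circ> A \<circ> adj (tf_shift z)"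

definition op_check :: "'a::euclidean_space l2op \<Rightarrow> 'a l2op" where
  "op_check A = parity \<circ> A \<circ> parity"

definition fun_op_conv :: "('a::euclidean_space \<times> 'a \<Rightarrow> complex) \<Rightarrow> 'a l2op \<Rightarrow> 'a l2op" where
  "fun_op_conv f S = (THE T. bounded_op T \<and>
     (\<forall>\<xi> \<eta>. cinner (T \<xi>) \<eta> = (LINT z|lborel. f z * cinner (op_shift z S \<xi>) \<eta>)))"

definition op_op_conv :: "'a::euclidean_space l2op \<Rightarrow> 'a l2op \<Rightarrow> 'a \<times> 'a \<Rightarrow> complex" where
  "op_op_conv S T z = op_trace (S \<circ> op_shift z (op_check T))"

definition op_tilde :: "'a::euclidean_space l2op \<Rightarrow> 'a \<times> 'a \<Rightarrow> complex" where
  "op_tilde S = op_op_conv S (op_check S)"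

definition Cohen :: "'a::euclidean_space l2op \<Rightarrow> 'a l2 \<Rightarrow> 'a \<times> 'a \<Rightarrow> complex" where
  "Cohen S \<psi> = op_op_conv (op_check S) (rank_one \<psi> \<psi>)"

text \<open>
  The square of the norm on \<open>M\<^sub>o\<^sub>p\<^sup>*\<close>. For a positive trace class operator the function
  \<open>op_tilde S\<close> is real and nonnegative, so taking the real part and applying \<open>ennreal\<close>
  changes nothing.
\<close>

definition Mop_norm_sq :: "'a::euclidean_space l2op \<Rightarrow> ennreal" where
  "Mop_norm_sq S = (\<integral>\<^sup>+z. ennreal (Re (op_tilde S z) * norm z) \<partial>lborel)"

definition Mop :: "'a::euclidean_space l2op set" where
  "Mop = {S. density_operator S \<and> Mop_norm_sq S < \<infinity>}"


section \<open>Total variation\<close>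

definition divergence :: "('b::euclidean_space \<Rightarrow> 'b) \<Rightarrow> 'b \<Rightarrow> real" where
  "divergence \<phi> z = (\<Sum>b\<in>Basis. frechet_derivative \<phi> (at z) b \<bullet> b)"

text \<open>Continuously differentiable, compactly supported vector fields of norm at most one.\<close>

definition test_fields :: "('b::euclidean_space \<Rightarrow> 'b) set" where
  "test_fields = {\<phi>. (\<forall>z. \<phi> differentiable (at z)) \<and>
     (\<forall>b\<in>Basis. continuous_on UNIV (\<lambda>z. frechet_derivative \<phi> (at z) b)) \<and>
     compact (closure {z. \<phi> z \<noteq> 0}) \<and> (\<forall>z. norm (\<phi> z) \<le> 1)}"

text \<open>
  The zero field is a test field, so the truncation of negative values by \<open>ennreal\<close> does not
  affect the supremum.
\<close>

definition total_variation :: "('b::euclidean_space \<Rightarrow> real) \<Rightarrow> ennreal" where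
  "total_variation f = (SUP \<phi>\<in>test_fields. ennreal (LINT z|lborel. f z * divergence \<phi> z))"

definition bounded_variation :: "('b::euclidean_space \<Rightarrow> real) \<Rightarrow> bool" where
  "bounded_variation f \<longleftrightarrow> integrable lborel f \<and> total_variation f < \<infinity>"

definition perimeter :: "'b::euclidean_space set \<Rightarrow> ennreal" where
  "perimeter \<Omega> = total_variation (indicat_real \<Omega>)"


section \<open>Accumulated Cohen class distributions\<close>

text \<open>
  A spectral decomposition \<open>T = \<Sum>k. \<lambda>\<^sub>k h\<^sub>k \<otimes> h\<^sub>k\<close> with eigenvalues in decreasing order and
  repeated according to multiplicity; indices start at 0, and the series converges strongly.
\<close>

definition spectral_decomposition ::
    "'a::euclidean_space l2op \<Rightarrow> (nat \<Rightarrow> real) \<Rightarrow> (nat \<Rightarrow> 'a l2) \<Rightarrow> bool" where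
  "spectral_decomposition T eig h \<longleftrightarrow>
     (\<forall>j k. cinner (h j) (h k) = (if j = k then 1 else 0)) \<and>
     decseq eig \<and>
     (\<forall>k. T (h k) = eig k *\<^sub>R h k) \<and>
     (\<forall>\<xi>. (\<lambda>k. eig k *\<^sub>R rank_one (h k) (h k) \<xi>) sums T \<xi>)"

text \<open>Because of the index shift, the first \<open>\<lceil>|\<Omega>|\<rceil>\<close> eigenfunctions are \<open>h k\<close> for \<open>k < \<lceil>|\<Omega>|\<rceil>\<close>.\<close>

definition accumulated ::
    "'a::euclidean_space l2op \<Rightarrow> ('a \<times> 'a) set \<Rightarrow> (nat \<Rightarrow> 'a l2) \<Rightarrow> 'a \<times> 'a \<Rightarrow> complex" where
  "accumulated S \<Omega> h z = (\<Sum>k<nat \<lceil>measure lborel \<Omega>\<rceil>. Cohen S (h k) z)"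

end

theory Submission
  imports Defs "HOL-Probability.Characteristic_Functions"
begin

text \<open>
  A Cholesky factorisation writes \<open>S = \<Sum>j. \<phi> j \<otimes> \<phi> j\<close> with \<open>\<Sum>j. \<parallel>\<phi> j\<parallel>\<^sup>2 = 1\<close>, so that
  \<open>Q\<^sub>S(f)(z) = \<Sum>j. |\<langle>f, \<pi>(z)\<phi> j\<rangle>|\<^sup>2\<close>, and Moyal's identity gives \<open>\<integral>Q\<^sub>S(f) = \<parallel>f\<parallel>\<^sup>2\<close> and a total
  integral \<open>1\<close> for the correlation function of \<open>S\<close>. Since the eigenvalues have sum \<open>|\<Omega>|\<close>, the
  defect \<open>D = \<Sum>k. \<lambda> k (1 - \<lambda> k)\<close> is the integral of the correlation function at \<open>w - z\<close> over
  \<open>z \<in> \<Omega>\<close>, \<open>w \<notin> \<Omega>\<close>. For \<open>u = w - z\<close> the set of admissible \<open>z\<close> has measure at most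
  \<open>|u| |\<partial>\<Omega>|\<close>, whence \<open>D \<le> \<parallel>S\<parallel>\<^sup>2 |\<partial>\<Omega>|\<close>. Comparing all eigenvalues with the one following the first
  \<open>A = \<lceil>|\<Omega>|\<rceil>\<close> shows \<open>\<Sum>k<A. 1 - \<lambda> k \<le> 1 + D\<close>, so the \<open>L\<^sup>1\<close> distance of \<open>\<rho>\<close> and \<open>\<chi>\<^sub>\<Omega>\<close> is at most
  \<open>2 + 2 D \<le> 4 \<parallel>S\<parallel>\<^sup>2 |\<partial>\<Omega>|\<close>. Markov's inequality finishes the proof for \<open>\<delta> < 1\<close>; for larger \<open>\<delta>\<close>
  the set is empty because \<open>0 \<le> \<rho> \<le> 1\<close>.
\<close>


section \<open>The Hilbert space of square-integrable functions\<close>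

text \<open>The obstacle is that neither \<open>\<phi>\<close> nor \<open>h\<close> need be an
  orthonormal basis: the first merely factorises \<open>S\<close>, the second is merely an
  orthonormal system. Traces are therefore evaluated on an auxiliary basis, whose existence is part
  of what \<open>trace_class\<close> asserts, and Tonelli's theorem moves the sums through the
  integrals. This is why most identities are stated for nonnegative extended reals, and why
  differences are written as sums until finiteness is known. One matrix element yields both
  eigenvalue identities. The quadratic form of the localization operator is at once an integral over
  \<open>\<Omega>\<close> and a weighted sum over eigenfunctions. Summed over the auxiliary basis it
  gives the trace; evaluated at \<open>tf_shift z (\<phi> j)\<close> it gives the sum of the squared
  eigenvalues. The additive constant in the estimate is the price of rounding the measure of
  \<open>\<Omega>\<close> up to an integer. The hypothesis that squared norm times perimeter is at
  least 1 serves to absorb it.\<close>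

lemma l2rel_rep_l2: "l2rel (rep_l2 f) (rep_l2 f)"
  by (rule Quotient3_rep_reflp[OF Quotient3_l2])

lemma sq_integrable_rep_l2: "sq_integrable (rep_l2 f)"
  using l2rel_rep_l2[of f] by (simp add: l2rel_def)

lemma borel_measurable_rep_l2 [measurable]: "rep_l2 f \<in> borel_measurable borel"
  using sq_integrable_rep_l2[of f] by (simp add: sq_integrable_def)

lemma abs_l2_rep_l2: "abs_l2 (rep_l2 f) = f"
  by (rule Quotient3_abs_rep[OF Quotient3_l2])

lemma abs_l2_eq_iff:
  assumes "sq_integrable f" "sq_integrable g"
  shows "abs_l2 f = abs_l2 g \<longleftrightarrow> (AE t in lborel. f t = g t)"
  using Quotient3_rel[OF Quotient3_l2, of f g] assms by (auto simp: l2rel_def)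

lemma rep_l2_abs_l2:
  assumes "sq_integrable f"
  shows "AE t in lborel. rep_l2 (abs_l2 f) t = f t"
  using abs_l2_eq_iff[OF sq_integrable_rep_l2 assms, of "abs_l2 f"] by (simp add: abs_l2_rep_l2)

section \<open>The sesquilinear inner product and complex scaling\<close>

lemma cinner_rep_l2: "cinner f g = (LINT t|lborel. rep_l2 f t * cnj (rep_l2 g t))"
  by (simp add: cinner_def)

lemma cinner_add_left: "cinner (f + g) h = cinner f h + cinner g h"
  by transfer (simp add: l2rel_def distrib_right sq_integrable_mult_cnj)

lemma cinner_cscale_left: "cinner (cscale c f) g = c * cinner f g"
  by transfer (simp add: mult.assoc)

lemma cinner_commute: "cinner g f = cnj (cinner f g)"
  by transfer (subst Bochner_Integration.integral_cnj[symmetric], simp add: mult.commute)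

lemma cinner_add_right: "cinner f (g + h) = cinner f g + cinner f h"
  by (subst (1 2 3) cinner_commute) (simp add: cinner_add_left)

lemma cinner_cscale_right: "cinner f (cscale c g) = cnj c * cinner f g"
  by (subst (1 2) cinner_commute) (simp add: cinner_cscale_left)

lemma cscale_minus_one: "cscale (-1) f = - f"
  by transfer (auto simp: l2rel_def sq_integrable_uminus)

lemma cscale_one [simp]: "cscale 1 f = f"
  by transfer (auto simp: l2rel_def)

lemma cscale_cscale [simp]: "cscale a (cscale b f) = cscale (a * b) f"
  by transfer (auto simp: l2rel_def mult.assoc intro!: sq_integrable_cmult)

lemma cscale_add: "cscale a (f + g) = cscale a f + cscale a g"
  by transfer (auto simp: l2rel_def distrib_left intro!: sq_integrable_add sq_integrable_cmult)

lemma cscale_add_left: "cscale (a + b) f = cscale a f + cscale b f"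
  by transfer (auto simp: l2rel_def distrib_right intro!: sq_integrable_add sq_integrable_cmult)

lemma scaleR_l2_cscale: "r *\<^sub>R f = cscale (of_real r) f" for f :: "'a::euclidean_space l2"
  by (rule scaleR_l2_def)

lemma cinner_minus_left: "cinner (- f) h = - cinner f h"
  by (simp add: cscale_minus_one[symmetric] cinner_cscale_left)

lemma cinner_minus_right: "cinner h (- f) = - cinner h f"
  by (simp add: cscale_minus_one[symmetric] cinner_cscale_right)

lemma cinner_diff_left: "cinner (f - g) h = cinner f h - cinner g h"
  using cinner_add_left[of f "-g" h] by (simp add: cinner_minus_left)

lemma cinner_diff_right: "cinner h (f - g) = cinner h f - cinner h g"
  using cinner_add_right[of h f "-g"] by (simp add: cinner_minus_right)

lemma cinner_zero_left [simp]: "cinner 0 f = 0"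
  using cinner_diff_left[of 0 0 f] by simp

lemma cinner_zero_right [simp]: "cinner f 0 = 0"
  using cinner_diff_right[of f 0 0] by simp

lemma cscale_zero_left [simp]: "cscale 0 f = 0"
  using scaleR_l2_cscale[of 0 f] by simp

lemma cscale_zero_right [simp]: "cscale c 0 = 0"
  using cscale_add[of c 0 0] by simp

lemma cinner_scaleR_left: "cinner (r *\<^sub>R f) g = of_real r * cinner f g"
  by (simp add: scaleR_l2_cscale cinner_cscale_left)

lemma cinner_sum_left: "cinner (\<Sum>i\<in>A. f i) g = (\<Sum>i\<in>A. cinner (f i) g)"
  by (induction A rule: infinite_finite_induct) (auto simp: cinner_add_left)

lemma cinner_sum_right: "cinner g (\<Sum>i\<in>A. f i) = (\<Sum>i\<in>A. cinner g (f i))"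
  by (induction A rule: infinite_finite_induct) (auto simp: cinner_add_right)

lemma cinner_self: "cinner f f = of_real ((norm f)\<^sup>2)"
proof -
  have "Im (cinner f f) = 0" using cinner_commute[of f f] by (auto simp: complex_eq_iff)
  moreover have "Re (cinner f f) = (norm f)\<^sup>2"
    by (simp add: power2_norm_eq_inner inner_l2_def)
  ultimately show ?thesis by (simp add: complex_eq_iff)
qed

lemma norm_sq_rep_l2: "(norm f)\<^sup>2 = (LINT t|lborel. (cmod (rep_l2 f t))\<^sup>2)"
proof -
  have "of_real ((norm f)\<^sup>2) = (LINT t|lborel. rep_l2 f t * cnj (rep_l2 f t))"
    by (simp only: cinner_self[symmetric] cinner_rep_l2)
  also have "\<dots> = of_real (LINT t|lborel. (cmod (rep_l2 f t))\<^sup>2)"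
    by (simp only: complex_norm_square[symmetric] integral_complex_of_real)
  finally show ?thesis by (simp only: of_real_eq_iff)
qed

lemma norm_sq_rep_l2': "ennreal ((norm f)\<^sup>2) = (\<integral>\<^sup>+t. ennreal ((cmod (rep_l2 f t))\<^sup>2) \<partial>lborel)"
  using sq_integrable_rep_l2[of f]
  by (simp add: norm_sq_rep_l2 sq_integrable_def nn_integral_eq_integral)

lemma norm_cscale: "norm (cscale c f) = cmod c * norm f"
proof -
  have "of_real ((norm (cscale c f))\<^sup>2) = (c * cnj c) * cinner f f"
    by (simp only: cinner_self[symmetric] cinner_cscale_left cinner_cscale_right mult_ac)
  also have "\<dots> = (of_real ((cmod c * norm f)\<^sup>2) :: complex)"
    by (simp only: cinner_self complex_norm_square[symmetric] power_mult_distrib of_real_mult)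
  finally have "of_real ((norm (cscale c f))\<^sup>2) = (of_real ((cmod c * norm f)\<^sup>2) :: complex)" .
  then show ?thesis by (simp only: of_real_eq_iff) (auto simp: power2_eq_iff_nonneg)
qed

lemma cinner_Cauchy_Schwarz: "cmod (cinner f g) \<le> norm f * norm g"
proof (cases "cinner f g = 0")
  case False
  \<comment> \<open>A phase that rotates \<open>cinner f g\<close> onto the positive real axis,
    which reduces the claim to the inequality for the real inner product.\<close>
  define c where "c = cnj (cinner f g) / cmod (cinner f g)"
  have "cmod c = 1" using False by (simp add: c_def norm_divide)
  have "cmod (cinner f g) = Re (cinner (cscale c f) g)"
    using False by (simp add: cinner_cscale_left c_def complex_norm_square[symmetric] mult.commute power2_eq_square
      flip: of_real_mult)
  also have "\<dots> = inner (cscale c f) g" by (simp add: inner_l2_def)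
  also have "\<dots> \<le> norm (cscale c f) * norm g" by (rule norm_cauchy_schwarz)
  finally show ?thesis using \<open>cmod c = 1\<close> by (simp add: norm_cscale)
qed simp

lemma norm_sq_diff_l2:
  "(norm (f - g))\<^sup>2 = (\<integral>t. (cmod (rep_l2 f t - rep_l2 g t))\<^sup>2 \<partial>lborel)"
proof -
  have "f - g = abs_l2 (\<lambda>t. rep_l2 f t - rep_l2 g t)" by (simp add: minus_l2_def)
  then have *: "AE t in lborel. rep_l2 (f - g) t = rep_l2 f t - rep_l2 g t"
    using rep_l2_abs_l2[OF sq_integrable_diff[OF sq_integrable_rep_l2 sq_integrable_rep_l2]] by simp
  show ?thesis unfolding norm_sq_rep_l2 by (rule integral_cong_AE) (use * in auto)
qed

lemma norm_sq_diff_l2':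
  "ennreal ((norm (f - g))\<^sup>2) = (\<integral>\<^sup>+t. ennreal ((cmod (rep_l2 f t - rep_l2 g t))\<^sup>2) \<partial>lborel)"
  using sq_integrable_diff[OF sq_integrable_rep_l2 sq_integrable_rep_l2, of f g]
  by (simp add: norm_sq_diff_l2 sq_integrable_def nn_integral_eq_integral)

text \<open>Riesz--Fischer: a weighted sum of the squared increments has finite integral, so the
  representatives converge almost everywhere; Fatou's lemma then bounds the distance to the limit.\<close>

lemma convergent_fast_l2:
  fixes X :: "nat \<Rightarrow> 'a::euclidean_space l2"
  assumes fast: "\<And>m n. n \<le> m \<Longrightarrow> norm (X m - X n) \<le> (1/4) ^ n"
  shows "convergent X"
proof -
  define f where "f n = rep_l2 (X n)" for n
  have [measurable]: "f n \<in> borel_measurable borel" for n by (simp add: f_def)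
  \<comment> \<open>The weight 4^n is a compromise. Squared increments have integral at most 16^-n,
    so the weighted sum stays finite; and where it is finite at \<open>t\<close>, the increments at
    \<open>t\<close> are O(2^-n), hence summable.\<close>
  have "(\<integral>\<^sup>+t. (\<Sum>n. ennreal (4 ^ n * (cmod (f (Suc n) t - f n t))\<^sup>2)) \<partial>lborel)
      = (\<Sum>n. \<integral>\<^sup>+t. ennreal (4 ^ n * (cmod (f (Suc n) t - f n t))\<^sup>2) \<partial>lborel)"
    by (rule nn_integral_suminf) measurable
  also have "\<dots> = (\<Sum>n. ennreal (4 ^ n * (norm (X (Suc n) - X n))\<^sup>2))"
    by (simp add: ennreal_mult nn_integral_cmult norm_sq_diff_l2' f_def)
  also have "\<dots> \<le> (\<Sum>n. ennreal ((1/4) ^ n))"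
  proof (intro suminf_le ennreal_leI allI)
    fix n
    have "(norm (X (Suc n) - X n))\<^sup>2 \<le> ((1/4) ^ n)\<^sup>2"
      by (intro power_mono fast) auto
    then have "4 ^ n * (norm (X (Suc n) - X n))\<^sup>2 \<le> 4 ^ n * ((1/4) ^ n)\<^sup>2" by simp
    also have "\<dots> = (1/4) ^ n" by (simp add: power2_eq_square power_divide)
    finally show "4 ^ n * (norm (X (Suc n) - X n))\<^sup>2 \<le> (1/4) ^ n" .
  qed auto
  also have "\<dots> < \<infinity>" by (subst suminf_ennreal2) (auto simp: summable_geometric)
  finally have "AE t in lborel. (\<Sum>n. ennreal (4 ^ n * (cmod (f (Suc n) t - f n t))\<^sup>2)) \<noteq> \<infinity>"
    by (intro nn_integral_PInf_AE) auto
  moreover have "convergent (\<lambda>n. f n t)"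
    if t: "(\<Sum>n. ennreal (4 ^ n * (cmod (f (Suc n) t - f n t))\<^sup>2)) \<noteq> \<infinity>" for t
  proof -
    have "summable (\<lambda>n. 4 ^ n * (cmod (f (Suc n) t - f n t))\<^sup>2)"
      using t by (intro summable_suminf_not_top) auto
    then have "Bseq (\<lambda>n. 4 ^ n * (cmod (f (Suc n) t - f n t))\<^sup>2)"
      by (intro convergent_imp_Bseq) (auto simp: convergent_def dest: summable_LIMSEQ_zero)
    then obtain K where K: "K > 0" "\<And>n. 4 ^ n * (cmod (f (Suc n) t - f n t))\<^sup>2 \<le> K"
      by (auto elim!: BseqE)
    have le: "norm (f (Suc n) t - f n t) \<le> sqrt K * (1/2) ^ n" for n
    proof (rule power2_le_imp_le)
      have "(cmod (f (Suc n) t - f n t))\<^sup>2 \<le> K / 4 ^ n"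
        using K(2)[of n] by (simp add: field_simps)
      also have "\<dots> = (sqrt K * (1/2) ^ n)\<^sup>2"
        using K(1) power_mult_distrib[of "2::real" 2 n]
        by (simp add: power2_eq_square power_one_over)
      finally show "(cmod (f (Suc n) t - f n t))\<^sup>2 \<le> (sqrt K * (1/2) ^ n)\<^sup>2" .
    qed (use K in auto)
    have "summable (\<lambda>n. sqrt K * (1/2::real) ^ n)"
      by (intro summable_mult summable_geometric) auto
    then have "summable (\<lambda>n. f (Suc n) t - f n t)"
      by (rule summable_comparison_test'[where N = 0]) (rule le)
    then have "convergent (\<lambda>n. \<Sum>i<n. f (Suc i) t - f i t)"
      by (simp add: summable_iff_convergent)
    then have "convergent (\<lambda>n. f n t - f 0 t)" by (subst (asm) sum_lessThan_telescope)
    then show ?thesis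
      using convergent_add[of "\<lambda>n. f n t - f 0 t" "\<lambda>_. f 0 t"] by (simp add: convergent_const)
  qed
  ultimately have conv: "AE t in lborel. convergent (\<lambda>n. f n t)" by auto
  define g where "g t = lim (\<lambda>n. f n t)" for t
  have [measurable]: "g \<in> borel_measurable borel"
    unfolding g_def by (rule borel_measurable_lim_metric) auto
  have lim: "AE t in lborel. (\<lambda>n. f n t) \<longlonglongrightarrow> g t"
    using conv by eventually_elim (simp add: g_def convergent_LIMSEQ_iff)
  have bound: "(\<integral>\<^sup>+t. ennreal ((cmod (g t - f n t))\<^sup>2) \<partial>lborel) \<le> ennreal (((1/4) ^ n)\<^sup>2)" for n
  proof -
    have "AE t in lborel. ennreal ((cmod (g t - f n t))\<^sup>2) = liminf (\<lambda>m. ennreal ((cmod (f m t - f n t))\<^sup>2))"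
      using lim
    proof eventually_elim
      fix t assume "(\<lambda>n. f n t) \<longlonglongrightarrow> g t"
      then have "(\<lambda>m. ennreal ((cmod (f m t - f n t))\<^sup>2)) \<longlonglongrightarrow> ennreal ((cmod (g t - f n t))\<^sup>2)"
        by (intro tendsto_intros)
      then show "ennreal ((cmod (g t - f n t))\<^sup>2) = liminf (\<lambda>m. ennreal ((cmod (f m t - f n t))\<^sup>2))"
        by (rule lim_imp_Liminf[OF sequentially_bot, symmetric])
    qed
    then have "(\<integral>\<^sup>+t. ennreal ((cmod (g t - f n t))\<^sup>2) \<partial>lborel)
        = (\<integral>\<^sup>+t. liminf (\<lambda>m. ennreal ((cmod (f m t - f n t))\<^sup>2)) \<partial>lborel)"
      by (rule nn_integral_cong_AE)
    also have "\<dots> \<le> liminf (\<lambda>m. \<integral>\<^sup>+t. ennreal ((cmod (f m t - f n t))\<^sup>2) \<partial>lborel)"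
      by (rule nn_integral_liminf) measurable
    also have "\<dots> = liminf (\<lambda>m. ennreal ((norm (X m - X n))\<^sup>2))"
      by (simp add: norm_sq_diff_l2' f_def)
    also have "\<dots> \<le> liminf (\<lambda>m. ennreal (((1/4) ^ n)\<^sup>2))"
      by (intro Liminf_mono eventually_sequentiallyI[of n] ennreal_leI power_mono fast) auto
    finally show ?thesis by (simp add: Liminf_const)
  qed
  have sq: "sq_integrable (\<lambda>t. g t - f n t)" for n
    unfolding sq_integrable_def integrable_iff_bounded using le_less_trans[OF bound[of n]] by auto
  have "sq_integrable g"
    using sq_integrable_add[OF sq[of 0] sq_integrable_rep_l2[of "X 0"]] by (simp add: f_def)
  have "norm (X n - abs_l2 g) \<le> (1/4) ^ n" for n
  proof (rule power2_le_imp_le)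
    have "AE t in lborel. rep_l2 (abs_l2 g) t = g t"
      by (rule rep_l2_abs_l2[OF \<open>sq_integrable g\<close>])
    then have "ennreal ((norm (X n - abs_l2 g))\<^sup>2) = (\<integral>\<^sup>+t. ennreal ((cmod (g t - f n t))\<^sup>2) \<partial>lborel)"
      unfolding norm_sq_diff_l2' 
      by (intro nn_integral_cong_AE) (auto simp: f_def norm_minus_commute)
    with bound[of n] have "ennreal ((norm (X n - abs_l2 g))\<^sup>2) \<le> ennreal (((1/4) ^ n)\<^sup>2)"
      by (simp only:)
    then show "(norm (X n - abs_l2 g))\<^sup>2 \<le> ((1/4) ^ n)\<^sup>2"
      by (subst (asm) ennreal_le_iff) auto
  qed auto
  moreover have "(\<lambda>n. (1/4::real) ^ n) \<longlonglongrightarrow> 0" by (simp add: LIMSEQ_realpow_zero)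
  ultimately have "(\<lambda>n. X n - abs_l2 g) \<longlonglongrightarrow> 0"
    by (metis (no_types, lifting) Lim_null_comparison always_eventually)
  then have "X \<longlonglongrightarrow> abs_l2 g" by (rule LIM_zero_cancel)
  then show ?thesis by (rule convergentI)
qed

instance l2 :: (euclidean_space) complete_space
proof
  fix X :: "nat \<Rightarrow> 'a l2" assume "Cauchy X"
  have "\<exists>N. \<forall>m\<ge>N. \<forall>n\<ge>N. norm (X m - X n) < (1/4) ^ k" for k
    using \<open>Cauchy X\<close> by (intro CauchyD) auto
  then obtain N where N: "\<And>k m n. m \<ge> N k \<Longrightarrow> n \<ge> N k \<Longrightarrow> norm (X m - X n) < (1/4) ^ k"
    by metis
  \<comment> \<open>The summand \<open>k\<close> makes \<open>r\<close> strictly increasing, and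
    summing all thresholds up to \<open>k\<close> keeps each of them below \<open>r\<close>.\<close>
  define r where "r k = k + (\<Sum>i\<le>k. N i)" for k
  have r: "strict_mono r" by (rule strict_monoI_Suc) (simp add: r_def)
  have rN: "N n \<le> r m" if "n \<le> m" for m n
    using member_le_sum[of n "{..m}" N] that by (simp add: r_def)
  have "convergent (X \<circ> r)"
    using N[OF rN rN] by (intro convergent_fast_l2) (auto intro: less_imp_le)
  then obtain l where "(X \<circ> r) \<longlonglongrightarrow> l" by (auto simp: convergent_def)
  then have "X \<longlonglongrightarrow> l" using \<open>Cauchy X\<close> r by (meson Cauchy_converges_subseq)
  then show "convergent X" by (auto simp: convergent_def)
qed


section \<open>Orthonormal bases and bounded forms\<close>

definition orthonormal :: "'a::euclidean_space l2 set \<Rightarrow> bool" where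
  "orthonormal E \<longleftrightarrow> (\<forall>e\<in>E. \<forall>e'\<in>E. cinner e e' = (if e = e' then 1 else 0))"

lemma is_onb_orthonormal: "is_onb E \<Longrightarrow> orthonormal E"
  by (simp add: is_onb_def orthonormal_def)

lemma orthonormal_norm: "orthonormal E \<Longrightarrow> e \<in> E \<Longrightarrow> norm e = 1"
  using cinner_self[of e] norm_ge_zero[of e]
  by (auto simp: orthonormal_def power2_eq_1_iff simp del: norm_ge_zero simp flip: of_real_power)

lemma cinner_sum_orthonormal:
  assumes "orthonormal E" "finite F" "F \<subseteq> E" "e \<in> E"
  shows "cinner (\<Sum>e\<in>F. cscale (c e) e) e = (if e \<in> F then c e else 0)"
proof -
  have "cinner (\<Sum>e\<in>F. cscale (c e) e) e = (\<Sum>e'\<in>F. if e' = e then c e' else 0)"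
    unfolding cinner_sum_left
    by (rule sum.cong) (use assms in \<open>auto simp: cinner_cscale_left orthonormal_def\<close>)
  then show ?thesis using \<open>finite F\<close> by (simp add: sum.delta)
qed

lemma norm_sq_sum_orthonormal:
  assumes "orthonormal E" "finite F" "F \<subseteq> E"
  shows "(norm (\<Sum>e\<in>F. cscale (c e) e))\<^sup>2 = (\<Sum>e\<in>F. (cmod (c e))\<^sup>2)"
proof -
  have "complex_of_real ((norm (\<Sum>e\<in>F. cscale (c e) e))\<^sup>2)
      = (\<Sum>e\<in>F. cnj (c e) * cinner (\<Sum>e\<in>F. cscale (c e) e) e)"
    unfolding cinner_self[symmetric] by (subst cinner_sum_right) (simp add: cinner_cscale_right)
  also have "\<dots> = (\<Sum>e\<in>F. cnj (c e) * c e)"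
  proof (rule sum.cong)
    fix e assume "e \<in> F"
    then show "cnj (c e) * cinner (\<Sum>e\<in>F. cscale (c e) e) e = cnj (c e) * c e"
      using assms by (subst cinner_sum_orthonormal[OF assms]) auto
  qed simp
  also have "\<dots> = complex_of_real (\<Sum>e\<in>F. (cmod (c e))\<^sup>2)"
    by (simp only: of_real_sum complex_norm_square mult.commute)
  finally show ?thesis by (simp only: of_real_eq_iff)
qed

lemma norm_sq_diff_orthonormal:
  assumes "orthonormal E" "finite F" "F \<subseteq> E"
  shows "(norm (f - (\<Sum>e\<in>F. cscale (cinner f e) e)))\<^sup>2 = (norm f)\<^sup>2 - (\<Sum>e\<in>F. (cmod (cinner f e))\<^sup>2)"
proof -
  let ?s = "\<Sum>e\<in>F. cscale (cinner f e) e"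
  have "cinner f ?s = (\<Sum>e\<in>F. of_real ((cmod (cinner f e))\<^sup>2))"
    unfolding cinner_sum_right by (simp only: cinner_cscale_right complex_norm_square mult.commute)
  then have *: "cinner f ?s = of_real (\<Sum>e\<in>F. (cmod (cinner f e))\<^sup>2)" by simp
  then have **: "cinner ?s f = of_real (\<Sum>e\<in>F. (cmod (cinner f e))\<^sup>2)"
    by (subst cinner_commute) simp
  have "complex_of_real ((norm (f - ?s))\<^sup>2) = of_real ((norm f)\<^sup>2 - (\<Sum>e\<in>F. (cmod (cinner f e))\<^sup>2))"
    unfolding cinner_self[symmetric] cinner_diff_left cinner_diff_right
    by (simp add: * ** cinner_self norm_sq_sum_orthonormal[OF assms] del: of_real_power of_real_sum)
  then show ?thesis by (simp only: of_real_eq_iff)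
qed

lemma Bessel_finite:
  assumes "orthonormal E" "finite F" "F \<subseteq> E"
  shows "(\<Sum>e\<in>F. (cmod (cinner f e))\<^sup>2) \<le> (norm f)\<^sup>2"
  using norm_sq_diff_orthonormal[OF assms, of f] zero_le_power2[of "norm (f - (\<Sum>e\<in>F. cscale (cinner f e) e))"]
  by linarith

text \<open>At this point \<open>E\<close> is not known to be countable. Finite sets
  \<open>F n\<close> that miss less than 1/(n+1) of the total squared mass give partial sums that
  are Cauchy, nested or not, and completeness supplies the limit.\<close>

lemma exists_l2_coefficients:
  assumes E: "orthonormal E" and c: "(\<lambda>e. (cmod (c e))\<^sup>2) summable_on E"
  shows "\<exists>x. (\<forall>e\<in>E. cinner x e = c e) \<and> ((\<lambda>e. (cmod (c e))\<^sup>2) has_sum (norm x)\<^sup>2) E"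
proof -
  define s where "s = infsum (\<lambda>e. (cmod (c e))\<^sup>2) E"
  have hs: "((\<lambda>e. (cmod (c e))\<^sup>2) has_sum s) E" using c by (simp add: s_def)
  have le_s: "(\<Sum>e\<in>F. (cmod (c e))\<^sup>2) \<le> s" if "finite F" "F \<subseteq> E" for F
    unfolding s_def using c that by (intro finite_sum_le_infsum) auto
  have "\<exists>F. finite F \<and> F \<subseteq> E \<and> s - inverse (Suc n) < (\<Sum>e\<in>F. (cmod (c e))\<^sup>2)" for n
  proof -
    have "eventually (\<lambda>F. s - inverse (Suc n) < (\<Sum>e\<in>F. (cmod (c e))\<^sup>2)) (finite_subsets_at_top E)"
      using hs unfolding has_sum_def by (rule order_tendstoD) simp
    then show ?thesis by (auto simp: eventually_finite_subsets_at_top)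
  qed
  then obtain F where F: "\<And>n. finite (F n)" "\<And>n. F n \<subseteq> E"
    "\<And>n. s - inverse (Suc n) < (\<Sum>e\<in>F n. (cmod (c e))\<^sup>2)"
    by metis
  define x where "x n = (\<Sum>e\<in>F n. cscale (c e) e)" for n
  have inner_x: "cinner (x n) e = (if e \<in> F n then c e else 0)" if "e \<in> E" for n e
    unfolding x_def using F that by (intro cinner_sum_orthonormal[OF E]) auto
  have norm_x: "(norm (x n))\<^sup>2 = (\<Sum>e\<in>F n. (cmod (c e))\<^sup>2)" for n
    unfolding x_def using F by (intro norm_sq_sum_orthonormal[OF E]) auto
  have xdiff: "(norm (x m - x n))\<^sup>2 \<le> inverse (Suc m) + inverse (Suc n)" for m n
  proof -
    define G where "G = F m \<union> F n"
    define d where "d e = (if e \<in> F m then c e else 0) - (if e \<in> F n then c e else 0)" for e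
    have G: "finite G" "G \<subseteq> E" using F by (auto simp: G_def)
    have ext: "x k = (\<Sum>e\<in>G. cscale (if e \<in> F k then c e else 0) e)" if "F k \<subseteq> G" for k
      unfolding x_def using that G by (intro sum.mono_neutral_cong_left) auto
    have "x m - x n = (\<Sum>e\<in>G. cscale (d e) e)"
      unfolding ext[of m, unfolded G_def, simplified, folded G_def]
        ext[of n, unfolded G_def, simplified, folded G_def] sum_subtractf[symmetric] d_def
      using cscale_add_left[of _ "- _"]  by (intro sum.cong) (auto simp flip: cscale_minus_one)
    then have "(norm (x m - x n))\<^sup>2 = (\<Sum>e\<in>G. (cmod (d e))\<^sup>2)"
      by (simp add: norm_sq_sum_orthonormal[OF E G])
    \<comment> \<open>A coefficient that survives in \<open>x m - x n\<close> belongs to exactly one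
      of the two sets, so it is part of the mass that the other one misses.\<close>
    also have "\<dots> \<le> (\<Sum>e\<in>G. ((cmod (c e))\<^sup>2 - (if e \<in> F m then (cmod (c e))\<^sup>2 else 0))
        + ((cmod (c e))\<^sup>2 - (if e \<in> F n then (cmod (c e))\<^sup>2 else 0)))"
      by (rule sum_mono) (auto simp: d_def)
    also have "\<dots> = (\<Sum>e\<in>G. (cmod (c e))\<^sup>2) - (\<Sum>e\<in>F m. (cmod (c e))\<^sup>2) + ((\<Sum>e\<in>G. (cmod (c e))\<^sup>2) - (\<Sum>e\<in>F n. (cmod (c e))\<^sup>2))"
    proof -
      have "(\<Sum>e\<in>G. (if e \<in> F k then (cmod (c e))\<^sup>2 else 0)) = (\<Sum>e\<in>F k. (cmod (c e))\<^sup>2)" if "F k \<subseteq> G" for k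
        using that G by (intro sum.mono_neutral_cong_right) auto
      from this[of m] this[of n] show ?thesis
        unfolding sum.distrib sum_subtractf by (simp add: G_def)
    qed
    also have "\<dots> \<le> inverse (Suc m) + inverse (Suc n)"
      using le_s[OF G] F(3)[of m] F(3)[of n] by linarith
    finally show ?thesis .
  qed
  have "Cauchy x"
  proof (rule metric_CauchyI)
    fix \<epsilon> :: real assume "\<epsilon> > 0"
    then obtain N where N: "inverse (Suc N) < \<epsilon>\<^sup>2 / 2"
      using reals_Archimedean[of "\<epsilon>\<^sup>2 / 2"] by auto
    have "dist (x m) (x n) < \<epsilon>" if "m \<ge> N" "n \<ge> N" for m n
    proof (rule power2_less_imp_less)
      have "inverse (real (Suc m)) \<le> inverse (real (Suc N))" "inverse (real (Suc n)) \<le> inverse (real (Suc N))"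
        using that by (auto intro!: le_imp_inverse_le)
      then show "(dist (x m) (x n))\<^sup>2 < \<epsilon>\<^sup>2"
        using xdiff[of m n] N unfolding dist_norm by linarith
    qed (use \<open>\<epsilon> > 0\<close> in auto)
    then show "\<exists>M. \<forall>m\<ge>M. \<forall>n\<ge>M. dist (x m) (x n) < \<epsilon>" by blast
  qed
  then obtain l where l: "x \<longlonglongrightarrow> l" by (auto simp: Cauchy_convergent_iff convergent_def)
  have inv0: "(\<lambda>n. inverse (real (Suc n))) \<longlonglongrightarrow> 0" by (rule LIMSEQ_inverse_real_of_nat)
  have "cinner l e = c e" if "e \<in> E" for e
  proof -
    have "(\<lambda>n. cinner (x n) e - cinner l e) \<longlonglongrightarrow> 0"
    proof (rule Lim_null_comparison)
      show "\<forall>\<^sub>F n in sequentially. norm (cinner (x n) e - cinner l e) \<le> norm (x n - l)"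
        using cinner_Cauchy_Schwarz[of "x _ - l" e] orthonormal_norm[OF E that]
        by (auto simp: cinner_diff_left)
      show "(\<lambda>n. norm (x n - l)) \<longlonglongrightarrow> 0"
        using l by (simp add: LIM_zero tendsto_norm_zero)
    qed
    then have 1: "(\<lambda>n. cinner (x n) e) \<longlonglongrightarrow> cinner l e" by (simp add: LIM_zero_iff)
    have "(\<lambda>n. (cmod (cinner (x n) e - c e))\<^sup>2) \<longlonglongrightarrow> 0"
    proof (rule Lim_null_comparison[OF _ inv0])
      have "(cmod (cinner (x n) e - c e))\<^sup>2 \<le> inverse (Suc n)" for n
      proof (cases "e \<in> F n")
        case False
        \<comment> \<open>An index outside \<open>F n\<close> adds its own mass to that of
          \<open>F n\<close> without exceeding the total \<open>s\<close>, so its mass is bounded by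
          what \<open>F n\<close> misses.\<close>
        have "(cmod (c e))\<^sup>2 + (\<Sum>e\<in>F n. (cmod (c e))\<^sup>2) \<le> s"
          using le_s[of "insert e (F n)"] False F(1,2)[of n] that by simp
        then show ?thesis using F(3)[of n] False inner_x[OF that, of n] by simp
      qed (use inner_x[OF that] in auto)
      then show "\<forall>\<^sub>F n in sequentially. norm ((cmod (cinner (x n) e - c e))\<^sup>2) \<le> inverse (real (Suc n))"
        by auto
    qed
    then have "(\<lambda>n. cmod (cinner (x n) e - c e)) \<longlonglongrightarrow> 0"
      using tendsto_real_sqrt by fastforce
    then have "(\<lambda>n. cinner (x n) e) \<longlonglongrightarrow> c e"
      using LIM_zero_cancel tendsto_norm_zero_iff by blast
    with 1 show ?thesis by (rule LIMSEQ_unique)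
  qed
  moreover have "(norm l)\<^sup>2 = s"
  proof (rule LIMSEQ_unique)
    show "(\<lambda>n. (norm (x n))\<^sup>2) \<longlonglongrightarrow> (norm l)\<^sup>2" by (intro tendsto_intros l)
    show "(\<lambda>n. (norm (x n))\<^sup>2) \<longlonglongrightarrow> s"
    proof (rule tendsto_sandwich[where f = "\<lambda>n. s - inverse (Suc n)" and h = "\<lambda>_. s"])
      show "(\<lambda>n. s - inverse (real (Suc n))) \<longlonglongrightarrow> s" using tendsto_diff[OF tendsto_const inv0, of s] by simp
    qed (use F le_s in \<open>auto simp: norm_x less_imp_le\<close>)
  qed
  ultimately show ?thesis using hs by auto
qed

section \<open>Parseval's identity, Fourier expansions and representation of functionals\<close>

lemma Bessel_summable:
  assumes "orthonormal E"
  shows "(\<lambda>e. (cmod (cinner f e))\<^sup>2) summable_on E"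
  by (rule nonneg_bdd_above_summable_on)
     (auto intro!: bdd_aboveI2[where M = "(norm f)\<^sup>2"] Bessel_finite[OF assms])

text \<open>\<open>is_onb\<close> encodes completeness as maximality. The vector rebuilt from the
  coefficients of \<open>f\<close> differs from \<open>f\<close> by something orthogonal to the
  whole basis, hence by zero, and its squared norm is the sum.\<close>

lemma Parseval:
  assumes "is_onb E"
  shows "((\<lambda>e. (cmod (cinner f e))\<^sup>2) has_sum (norm f)\<^sup>2) E"
proof -
  obtain x where x: "\<forall>e\<in>E. cinner x e = cinner f e"
    "((\<lambda>e. (cmod (cinner f e))\<^sup>2) has_sum (norm x)\<^sup>2) E"
    using exists_l2_coefficients[OF is_onb_orthonormal Bessel_summable, OF assms is_onb_orthonormal[OF assms], of f] by auto
  have "\<forall>e\<in>E. cinner (x - f) e = 0" using x(1) by (simp add: cinner_diff_left)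
  then have "x - f = 0" using assms unfolding is_onb_def by blast
  with x show ?thesis by simp
qed

lemma Fourier_expansion:
  assumes "is_onb E"
  shows "((\<lambda>e. cscale (cinner f e) e) has_sum f) E"
proof -
  have "((\<lambda>F. (norm (f - (\<Sum>e\<in>F. cscale (cinner f e) e)))\<^sup>2) \<longlongrightarrow> 0) (finite_subsets_at_top E)"
  proof (rule Lim_transform_eventually)
    show "((\<lambda>F. (norm f)\<^sup>2 - (\<Sum>e\<in>F. (cmod (cinner f e))\<^sup>2)) \<longlongrightarrow> 0) (finite_subsets_at_top E)"
      using tendsto_diff[OF tendsto_const Parseval[OF assms, of f, unfolded has_sum_def], of "(norm f)\<^sup>2"]
      by simp
    show "\<forall>\<^sub>F F in finite_subsets_at_top E. (norm f)\<^sup>2 - (\<Sum>e\<in>F. (cmod (cinner f e))\<^sup>2)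
        = (norm (f - (\<Sum>e\<in>F. cscale (cinner f e) e)))\<^sup>2"
      by (rule eventually_finite_subsets_at_top_weakI)
         (simp add: norm_sq_diff_orthonormal[OF is_onb_orthonormal[OF assms]])
  qed
  then have "((\<lambda>F. norm (f - (\<Sum>e\<in>F. cscale (cinner f e) e))) \<longlongrightarrow> 0) (finite_subsets_at_top E)"
    using tendsto_real_sqrt by fastforce
  then have "((\<lambda>F. f - (\<Sum>e\<in>F. cscale (cinner f e) e)) \<longlongrightarrow> 0) (finite_subsets_at_top E)"
    by (rule tendsto_norm_zero_cancel)
  from tendsto_diff[OF tendsto_const this, of f] show ?thesis
    by (simp add: has_sum_def)
qed

lemma bounded_linear_cinner_left: "bounded_linear (\<lambda>f. cinner f g)"
  by (rule bounded_linear_intro[where K = "norm g"])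
     (auto simp: cinner_add_left cinner_scaleR_left cinner_Cauchy_Schwarz scaleR_conv_of_real)

lemma Parseval_cinner:
  assumes "is_onb E"
  shows "((\<lambda>e. cinner f e * cinner e g) has_sum cinner f g) E"
  using has_sum_bounded_linear[OF bounded_linear_cinner_left[of g] Fourier_expansion[OF assms, of f]]
  by (simp add: cinner_cscale_left o_def)

text \<open>The representing vector must have the coefficients \<open>cnj (\<phi> e)\<close>, so the
  point is that they are square summable.\<close>

lemma Riesz_representation:
  assumes E: "is_onb (E :: 'a::euclidean_space l2 set)"
    and add: "\<And>f g :: 'a l2. \<phi> (f + g) = \<phi> f + \<phi> g" and scale: "\<And>c f. \<phi> (cscale c f) = c * \<phi> f"
    and bound: "\<And>f. cmod (\<phi> f) \<le> M * norm f"
  shows "\<exists>x. \<forall>f. \<phi> f = cinner f x"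
proof -
  have on: "orthonormal E" using E by (rule is_onb_orthonormal)
  have zero: "\<phi> 0 = 0" using scale[of 0 0] by simp
  have sum: "\<phi> (sum f F) = (\<Sum>i\<in>F. \<phi> (f i))" for f :: "_ \<Rightarrow> _" and F :: "'a l2 set"
    by (induction F rule: infinite_finite_induct) (auto simp: add zero)
  have "(\<lambda>e. (cmod (cnj (\<phi> e)))\<^sup>2) summable_on E"
  proof (rule nonneg_bdd_above_summable_on)
    show "bdd_above (sum (\<lambda>e. (cmod (cnj (\<phi> e)))\<^sup>2) ` {F. F \<subseteq> E \<and> finite F})"
    proof (rule bdd_aboveI2[where M = "M\<^sup>2"])
      fix F assume "F \<in> {F. F \<subseteq> E \<and> finite F}"
      then have F: "finite F" "F \<subseteq> E" by auto
      \<comment> \<open>At this vector the functional takes the value \<open>norm y\<close> squared,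
        so the bound forces \<open>norm y\<close> to vanish or to be at most \<open>M\<close>.
        Either way the squared mass is bounded uniformly in \<open>F\<close>.\<close>
      define y where "y = (\<Sum>e\<in>F. cscale (cnj (\<phi> e)) e)"
      define S where "S = (\<Sum>e\<in>F. (cmod (\<phi> e))\<^sup>2)"
      have "\<phi> y = (\<Sum>e\<in>F. of_real ((cmod (\<phi> e))\<^sup>2))"
        unfolding y_def sum scale by (simp only: complex_norm_square mult.commute)
      then have "\<phi> y = of_real S" by (simp add: S_def)
      have S0: "S \<ge> 0" by (simp add: S_def sum_nonneg)
      have ny: "(norm y)\<^sup>2 = S" 
        unfolding y_def S_def by (subst norm_sq_sum_orthonormal[OF on F]) simp
      have "S \<le> M * norm y" using bound[of y] S0 by (simp add: \<open>\<phi> y = of_real S\<close>)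
      then have "norm y * norm y \<le> M * norm y" using ny by (simp add: power2_eq_square)
      then have "norm y = 0 \<or> norm y \<le> M" by (auto simp: mult_le_cancel_right)
      then have "(norm y)\<^sup>2 \<le> M\<^sup>2" by (auto intro: power_mono)
      then show "(\<Sum>e\<in>F. (cmod (cnj (\<phi> e)))\<^sup>2) \<le> M\<^sup>2" by (simp add: ny S_def)
    qed
  qed auto
  from exists_l2_coefficients[OF on this] obtain x where x: "\<forall>e\<in>E. cinner x e = cnj (\<phi> e)" by auto
  have x': "cinner e x = \<phi> e" if "e \<in> E" for e using x that by (subst cinner_commute) simp
  have "bounded_linear \<phi>" by (rule bounded_linear_intro[where K = M])
       (auto simp: add scale scaleR_l2_cscale scaleR_conv_of_real bound mult.commute)
  have "\<phi> f = cinner f x" for f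
  proof (rule has_sum_unique)
    show "((\<lambda>e. cinner f e * \<phi> e) has_sum \<phi> f) E"
      using has_sum_bounded_linear[OF \<open>bounded_linear \<phi>\<close> Fourier_expansion[OF E, of f]]
      by (simp add: scale o_def)
    show "((\<lambda>e. cinner f e * \<phi> e) has_sum cinner f x) E"
      using Parseval_cinner[OF E, of f x] by (rule has_sum_cong[THEN iffD1, rotated]) (simp add: x')
  qed
  then show ?thesis by blast
qed

lemma cinner_eqI:
  assumes "\<And>g. cinner f g = cinner f' g"
  shows "f = f'"
proof -
  have "cinner (f - f') (f - f') = 0" unfolding cinner_diff_left using assms by simp
  then show ?thesis unfolding cinner_self by simp
qed

text \<open>\<open>fun_op_conv\<close> is a definite description of an operator with prescribed
  matrix elements; existence and uniqueness here give it its meaning. The representation of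
  functionals is applied to the conjugate of the form, which is linear in the second
  argument.\<close>

lemma bounded_op_of_form:
  assumes E: "is_onb (E :: 'a::euclidean_space l2 set)"
    and addl: "\<And>f g h. b (f + g) h = b f h + b g h" and scalel: "\<And>c f h. b (cscale c f) h = c * b f h"
    and addr: "\<And>f g h. b h (f + g) = b h f + b h g" and scaler: "\<And>c f h. b h (cscale c f) = cnj c * b h f"
    and bound: "\<And>f g. cmod (b f g) \<le> M * norm f * norm g"
  shows "\<exists>!T. bounded_op T \<and> (\<forall>f g. cinner (T f) g = b f (g :: 'a l2))"
proof -
  have "\<exists>x. \<forall>g. cnj (b f g) = cinner g x" for f
    by (rule Riesz_representation[OF E, where M = "M * norm f"])
       (auto simp: addr scaler bound)
  then obtain T where "\<And>f g. cnj (b f g) = cinner g (T f)" by metis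
  then have T: "cinner (T f) g = b f g" for f g by (metis cinner_commute complex_cnj_cnj)
  have scale: "T (cscale c f) = cscale c (T f)" for c f
    by (rule cinner_eqI) (simp add: T cinner_cscale_left scalel)
  have "bounded_linear T"
  proof (rule bounded_linear_intro[where K = M])
    show "T (f + g) = T f + T g" for f g by (rule cinner_eqI) (simp add: T cinner_add_left addl)
    show "T (r *\<^sub>R f) = r *\<^sub>R T f" for r f by (simp add: scaleR_l2_cscale scale)
    show "norm (T f) \<le> norm f * M" for f
    proof (cases "T f = 0")
      case True
      have "0 \<le> M * norm f * norm f" using bound[of f f] norm_ge_zero[of "b f f"] by linarith
      then show ?thesis using True by (cases "f = 0") (auto simp: zero_le_mult_iff mult.commute)
    next
      case False
      have "norm (T f) * norm (T f) = cmod (cinner (T f) (T f))" 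
        unfolding cinner_self by (simp add: power2_eq_square norm_mult)
      also have "\<dots> \<le> M * norm f * norm (T f)" by (simp add: T bound)
      finally show ?thesis using False by (simp add: mult.commute)
    qed
  qed
  then have "bounded_op T \<and> (\<forall>f g. cinner (T f) g = b f g)"
    by (simp add: bounded_op_def scale T)
  moreover have "T' = T" if "\<forall>f g. cinner (T' f) g = b f g" for T'
    using that T by (intro ext cinner_eqI) simp
  ultimately show ?thesis by blast
qed


section \<open>Continuity of translations\<close>

lemma nn_integral_lborel_plus:
  fixes c :: "'a::euclidean_space"
  assumes [measurable]: "f \<in> borel_measurable borel"
  shows "(\<integral>\<^sup>+x. f (x + c) \<partial>lborel) = (\<integral>\<^sup>+x. f x \<partial>lborel)"
proof -
  have "(\<integral>\<^sup>+x. f x \<partial>lborel) = (\<integral>\<^sup>+x. f x \<partial>distr lborel borel ((+) c))"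
    by (simp add: lborel_distr_plus)
  then show ?thesis by (simp add: nn_integral_distr add.commute)
qed

lemma nn_integral_lborel_uminus:
  assumes [measurable]: "f \<in> borel_measurable borel"
  shows "(\<integral>\<^sup>+x. f (- x) \<partial>lborel) = (\<integral>\<^sup>+x. f (x :: 'a::euclidean_space) \<partial>lborel)"
proof -
  have "(\<integral>\<^sup>+x. f x \<partial>lborel) = (\<integral>\<^sup>+x. f x \<partial>distr lborel borel uminus)"
    by (simp add: distr_lborel_reflect)
  then show ?thesis by (simp add: nn_integral_distr)
qed

lemma nn_integral_lborel_minus:
  fixes c :: "'a::euclidean_space"
  assumes [measurable]: "f \<in> borel_measurable borel"
  shows "(\<integral>\<^sup>+x. f (c - x) \<partial>lborel) = (\<integral>\<^sup>+x. f x \<partial>lborel)"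
  using nn_integral_lborel_uminus[of "\<lambda>x. f (x + c)"] nn_integral_lborel_plus[of f c]
  by simp

lemma integral_lborel_plus:
  fixes c :: "'a::euclidean_space" and f :: "'a \<Rightarrow> 'b::{banach, second_countable_topology}"
  assumes [measurable]: "f \<in> borel_measurable borel"
  shows "(\<integral>x. f (x + c) \<partial>lborel) = (\<integral>x. f x \<partial>lborel)"
proof -
  have "(\<integral>x. f x \<partial>lborel) = (\<integral>x. f x \<partial>distr lborel borel ((+) c))"
    by (simp add: lborel_distr_plus)
  then show ?thesis by (simp add: integral_distr add.commute)
qed

lemma integral_lborel_scaleR:
  fixes f :: "'a::euclidean_space \<Rightarrow> 'b::{banach, second_countable_topology}"
  assumes [measurable]: "f \<in> borel_measurable borel" and "c > 0"
  shows "(\<integral>x. f x \<partial>lborel) = (c ^ DIM('a)) *\<^sub>R (\<integral>x. f (c *\<^sub>R x) \<partial>lborel)"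
proof -
  have "(\<integral>x. f x \<partial>lborel)
      = (\<integral>x. f x \<partial>density (distr lborel borel (\<lambda>x. 0 + c *\<^sub>R x)) (\<lambda>_. ennreal (c ^ DIM('a))))"
    using lborel_affine[of c "0 :: 'a"] \<open>c > 0\<close> by simp
  also have "\<dots> = (c ^ DIM('a)) *\<^sub>R (\<integral>x. f (c *\<^sub>R x) \<partial>lborel)"
    using \<open>c > 0\<close> by (subst integral_density) (auto simp: integral_distr)
  finally show ?thesis .
qed

text \<open>Inner approximation first yields only a closed set, which a large ball then cuts down to
  a compact one. The three losses (outside \<open>A\<close>, between \<open>A\<close> and the closed
  set, outside the ball) each take e/3.\<close>

lemma borel_compact_open_approx:
  fixes A :: "'a::euclidean_space set"
  assumes A: "A \<in> sets borel" "emeasure lborel A < \<infinity>" and "e > (0::real)"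
  obtains K U where "compact K" "open U" "K \<subseteq> A" "A \<subseteq> U" "emeasure lborel (U - K) < ennreal e"
proof -
  have Al: "A \<in> sets lebesgue" using A by simp
  have e3: "e / 3 > 0" using \<open>e > 0\<close> by simp
  obtain U where U: "open U" "A \<subseteq> U" "emeasure lebesgue (U - A) < ennreal (e/3)"
    using sets_lebesgue_outer_open[OF Al e3] by metis
  obtain T where T: "closed T" "T \<subseteq> A" "emeasure lebesgue (A - T) < ennreal (e/3)"
    using sets_lebesgue_inner_closed[OF Al e3] by metis
  have bT: "T \<in> sets borel" "U \<in> sets borel" using T U by (auto intro: borel_closed borel_open)
  have "(\<lambda>n. emeasure lborel (A - cball 0 (real n))) \<longlonglongrightarrow> emeasure lborel (\<Inter>n. A - cball 0 (real n))"
  proof (rule Lim_emeasure_decseq)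
    show "decseq (\<lambda>n. A - cball 0 (real n))" by (auto simp: decseq_def)
    show "emeasure lborel (A - cball 0 (real i)) \<noteq> \<infinity>" for i
      using A emeasure_mono[of "A - cball 0 (real i)" A lborel] by (auto simp: top_unique)
  qed (use A in auto)
  moreover have "(\<Inter>n. A - cball 0 (real n)) = {}"
  proof -
    have "\<exists>n. x \<in> cball 0 (real n)" for x :: 'a
      using real_arch_simple[of "norm x"] by simp
    then show ?thesis by blast
  qed
  ultimately have "(\<lambda>n. emeasure lborel (A - cball 0 (real n))) \<longlonglongrightarrow> 0"
    by (simp only: emeasure_empty)
  then have "\<forall>\<^sub>F n in sequentially. emeasure lborel (A - cball 0 (real n)) < ennreal (e/3)"
    by (rule order_tendstoD) (use \<open>e > 0\<close> in simp)
  then obtain n where n: "emeasure lborel (A - cball 0 (real n)) < ennreal (e/3)"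
    by (auto simp: eventually_sequentially)
  define K where "K = T \<inter> cball 0 (real n)"
  have "compact K" unfolding K_def using T by (simp add: closed_Int_compact)
  have "emeasure lborel (U - K) \<le> emeasure lborel ((U - A) \<union> ((A - T) \<union> (A - cball 0 (real n))))"
    using bT A by (intro emeasure_mono) (auto simp: K_def)
  also have "\<dots> \<le> emeasure lborel (U - A) + (emeasure lborel (A - T) + emeasure lborel (A - cball 0 (real n)))"
    using bT A by (intro order_trans[OF emeasure_subadditive] add_mono emeasure_subadditive order_refl) auto
  also have "\<dots> < ennreal (e/3) + (ennreal (e/3) + ennreal (e/3))"
    using U(3) T(3) n bT A by (intro add_strict_mono) auto
  also have "\<dots> = ennreal e" using \<open>e > 0\<close> by (simp flip: ennreal_plus)
  finally have "emeasure lborel (U - K) < ennreal e" .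
  with \<open>compact K\<close> U T show thesis by (intro that[of K U]) (auto simp: K_def)
qed

text \<open>Induction over integrable functions. The content lies in the indicators; sums and limits
  are epsilon arguments, the latter using that translation preserves the integral of the
  approximation error.\<close>

lemma translation_nn_integral_tendsto_0:
  fixes f :: "'a::euclidean_space \<Rightarrow> real"
  assumes "integrable lborel f" "e > 0"
  shows "\<forall>\<^sub>F u in nhds 0. (\<integral>\<^sup>+t. ennreal \<bar>f (t + u) - f t\<bar> \<partial>lborel) < ennreal e"
  using assms
proof (induction f arbitrary: e rule: integrable_induct)
  case (base A c)
  have A: "A \<in> sets borel" "emeasure lborel A < \<infinity>" using base by auto
  define e' where "e' = e / (2 * (\<bar>c\<bar> + 1))"
  have "e' > 0" using base by (simp add: e'_def)
  obtain K U where KU: "compact K" "open U" "K \<subseteq> A" "A \<subseteq> U" "emeasure lborel (U - K) < ennreal e'"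
    using borel_compact_open_approx[OF A \<open>e' > 0\<close>] by metis
  have bK: "K \<in> sets borel" "U \<in> sets borel" using KU by (auto intro: borel_compact)
  obtain r where r: "r > 0" "(\<Union>x\<in>K. ball x r) \<subseteq> U"
    using compact_subset_open_imp_ball_epsilon_subset[OF KU(1,2)] KU by auto
  \<comment> \<open>A point of \<open>A\<close> that leaves \<open>A\<close> under the shift either
    lies outside \<open>K\<close>, or lies in \<open>K\<close> and lands in \<open>U - A\<close>,
    because \<open>v\<close> is shorter than the margin \<open>r\<close>. The sets
    \<open>A - K\<close> and \<open>U - A\<close> are disjoint parts of
    \<open>U - K\<close>.\<close>
  have shift: "(\<integral>\<^sup>+t. ennreal (indicator (A - {t. t + v \<in> A}) t) \<partial>lborel) \<le> ennreal e'" if "norm v < r" for v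
  proof -
    have mA: "Measurable.pred borel (\<lambda>t. t + v \<in> A)" "Measurable.pred borel (\<lambda>t. t \<in> A)"
      "Measurable.pred borel (\<lambda>t. t - v \<in> K)" "Measurable.pred borel (\<lambda>t. t \<in> K)"
      using A bK by (auto intro!: pred_sets2[where N = borel])
    have sets: "A - {t. t + v \<in> A} \<in> sets borel" "A - K \<in> sets borel" "{t \<in> A. t \<notin> A} \<in> sets borel"
       "{t \<in> K. t + v \<in> U - A} \<in> sets borel" "{t. t - v \<in> K} - A \<in> sets borel"
      using mA A bK by auto
    have "(\<integral>\<^sup>+t. ennreal (indicator (A - {t. t + v \<in> A}) t) \<partial>lborel)
        = (\<integral>\<^sup>+t. indicator (A - {t. t + v \<in> A}) t \<partial>lborel)"
      by (intro nn_integral_cong) (auto split: split_indicator)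
    also have "\<dots> \<le> (\<integral>\<^sup>+t. indicator (A - K) t + indicator (U - A) (t + v) \<partial>lborel)"
    proof (intro nn_integral_mono)
      fix t
      have "t + v \<in> U" if "t \<in> K"
      proof -
        have "t + v \<in> ball t r" using \<open>norm v < r\<close> by (simp add: dist_norm)
        then show ?thesis using r(2) that by blast
      qed
      then show "indicator (A - {t. t + v \<in> A}) t \<le> indicator (A - K) t + (indicator (U - A) (t + v) :: ennreal)"
        by (auto split: split_indicator)
    qed
    also have "\<dots> = emeasure lborel (A - K) + (\<integral>\<^sup>+t. indicator (U - A) t \<partial>lborel)"
      using A bK by (subst nn_integral_add) (auto simp: nn_integral_lborel_plus[of "indicator (U - A)"])
    also have "\<dots> = emeasure lborel ((A - K) \<union> (U - A))"
      using A bK by (subst plus_emeasure[symmetric]) auto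
    also have "\<dots> \<le> emeasure lborel (U - K)" using A bK KU by (intro emeasure_mono) auto
    also have "\<dots> \<le> ennreal e'" using KU by simp
    finally show ?thesis .
  qed
  show ?case unfolding eventually_nhds_metric
  proof (intro exI[of _ r] conjI allI impI r)
    fix u :: 'a assume "dist u 0 < r"
    then have u: "norm u < r" "norm (- u) < r" by auto
    have mA: "Measurable.pred borel (\<lambda>t. t + u \<in> A)" "Measurable.pred borel (\<lambda>t. t - u \<in> A)"
      using A by (auto intro!: pred_sets2[where N = borel])
    \<comment> \<open>\<open>B\<close> holds the points lost under the shift by \<open>u\<close>.
      The points gained are, seen from \<open>t + u\<close>, those lost under the opposite shift, so
      \<open>shift\<close> bounds both.\<close>
    define B where "B = A - {t. t + u \<in> A}"
    define B' where "B' = A - {t. t - u \<in> A}"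
    have [measurable]: "B \<in> sets borel" "B' \<in> sets borel"
      using mA A by (auto simp: B_def B'_def)
    have "(\<integral>\<^sup>+t. ennreal \<bar>indicator A (t + u) *\<^sub>R c - indicator A t *\<^sub>R c\<bar> \<partial>lborel)
        = (\<integral>\<^sup>+t. ennreal \<bar>c\<bar> * (ennreal (indicator B t) + ennreal (indicator B' (t + u))) \<partial>lborel)"
      by (intro nn_integral_cong) (auto simp: B_def B'_def split: split_indicator)
    also have "\<dots> = ennreal \<bar>c\<bar> * ((\<integral>\<^sup>+t. ennreal (indicator B t) \<partial>lborel)
              + (\<integral>\<^sup>+t. ennreal (indicator B' (t + u)) \<partial>lborel))"
      by (simp add: nn_integral_cmult nn_integral_add)
    also have "(\<integral>\<^sup>+t. ennreal (indicator B' (t + u)) \<partial>lborel) = (\<integral>\<^sup>+t. ennreal (indicator B' t) \<partial>lborel)"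
      by (rule nn_integral_lborel_plus) measurable
    also have "ennreal \<bar>c\<bar> * ((\<integral>\<^sup>+t. ennreal (indicator B t) \<partial>lborel) + (\<integral>\<^sup>+t. ennreal (indicator B' t) \<partial>lborel))
        \<le> ennreal \<bar>c\<bar> * (ennreal e' + ennreal e')"
      using shift[OF u(1)] shift[OF u(2)] by (intro mult_left_mono add_mono) (auto simp: B_def B'_def)
    also have "\<dots> = ennreal (\<bar>c\<bar> * (2 * e'))"
      using \<open>e' > 0\<close> by (simp add: ennreal_mult flip: ennreal_plus)
    also have "\<dots> < ennreal e"
      using base(3) by (intro ennreal_lessI) (auto simp: e'_def field_simps)
    finally show "(\<integral>\<^sup>+t. ennreal \<bar>indicator A (t + u) *\<^sub>R c - indicator A t *\<^sub>R c\<bar> \<partial>lborel) < ennreal e" .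
  qed
next
  case (add f g)
  have [measurable]: "f \<in> borel_measurable borel" "g \<in> borel_measurable borel"
    using add by auto
  have "\<forall>\<^sub>F u in nhds 0. (\<integral>\<^sup>+t. ennreal \<bar>f (t + u) - f t\<bar> \<partial>lborel) < ennreal (e/2)"
    "\<forall>\<^sub>F u in nhds 0. (\<integral>\<^sup>+t. ennreal \<bar>g (t + u) - g t\<bar> \<partial>lborel) < ennreal (e/2)"
    using add by auto
  then show ?case
  proof eventually_elim
    fix u assume h: "(\<integral>\<^sup>+t. ennreal \<bar>f (t + u) - f t\<bar> \<partial>lborel) < ennreal (e/2)"
      "(\<integral>\<^sup>+t. ennreal \<bar>g (t + u) - g t\<bar> \<partial>lborel) < ennreal (e/2)"
    have "(\<integral>\<^sup>+t. ennreal \<bar>f (t + u) + g (t + u) - (f t + g t)\<bar> \<partial>lborel)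
       \<le> (\<integral>\<^sup>+t. ennreal \<bar>f (t + u) - f t\<bar> + ennreal \<bar>g (t + u) - g t\<bar> \<partial>lborel)"
      by (intro nn_integral_mono) (auto simp flip: ennreal_plus intro!: ennreal_leI)
    also have "\<dots> = (\<integral>\<^sup>+t. ennreal \<bar>f (t + u) - f t\<bar> \<partial>lborel) + (\<integral>\<^sup>+t. ennreal \<bar>g (t + u) - g t\<bar> \<partial>lborel)"
      by (rule nn_integral_add) measurable
    also have "\<dots> < ennreal (e/2) + ennreal (e/2)" using h by (intro add_strict_mono)
    also have "\<dots> = ennreal e" using add.prems by (simp flip: ennreal_plus)
    finally show "(\<integral>\<^sup>+t. ennreal \<bar>f (t + u) + g (t + u) - (f t + g t)\<bar> \<partial>lborel) < ennreal e" .
  qed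
next
  case (lim f s)
  have [measurable]: "f \<in> borel_measurable borel" "s i \<in> borel_measurable borel" for i
    using lim(1,4) by auto
  have "(\<lambda>i. \<integral>\<^sup>+t. ennreal (norm (f t - s i t)) \<partial>lborel) \<longlonglongrightarrow> 0"
  proof (rule nn_integral_dominated_convergence_norm[where w = "\<lambda>t. 2 * norm (f t)"])
    show "(\<integral>\<^sup>+t. ennreal (2 * norm (f t)) \<partial>lborel) < \<infinity>"
      using lim(4) unfolding integrable_iff_bounded by (simp add: ennreal_mult nn_integral_cmult ennreal_mult_less_top)
  qed (use lim in \<open>auto simp: norm_minus_commute\<close>)
  then have "\<forall>\<^sub>F i in sequentially. (\<integral>\<^sup>+t. ennreal (norm (f t - s i t)) \<partial>lborel) < ennreal (e/3)"
    by (rule order_tendstoD) (use lim in simp)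
  then obtain i where i: "(\<integral>\<^sup>+t. ennreal (norm (s i t - f t)) \<partial>lborel) < ennreal (e/3)"
    by (auto simp: eventually_sequentially abs_minus_commute)
  have "\<forall>\<^sub>F u in nhds 0. (\<integral>\<^sup>+t. ennreal \<bar>s i (t + u) - s i t\<bar> \<partial>lborel) < ennreal (e/3)"
    using lim(5)[of "e/3" i] lim(6) by auto
  then show ?case
  proof eventually_elim
    fix u assume u: "(\<integral>\<^sup>+t. ennreal \<bar>s i (t + u) - s i t\<bar> \<partial>lborel) < ennreal (e/3)"
    have "(\<integral>\<^sup>+t. ennreal \<bar>f (t + u) - f t\<bar> \<partial>lborel)
      \<le> (\<integral>\<^sup>+t. ennreal \<bar>s i (t + u) - s i t\<bar> + (ennreal \<bar>s i (t + u) - f (t + u)\<bar> + ennreal \<bar>s i t - f t\<bar>) \<partial>lborel)"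
      by (intro nn_integral_mono) (auto simp flip: ennreal_plus intro!: ennreal_leI)
    also have "\<dots> = (\<integral>\<^sup>+t. ennreal \<bar>s i (t + u) - s i t\<bar> \<partial>lborel)
        + ((\<integral>\<^sup>+t. ennreal \<bar>s i (t + u) - f (t + u)\<bar> \<partial>lborel) + (\<integral>\<^sup>+t. ennreal \<bar>s i t - f t\<bar> \<partial>lborel))"
      by (simp add: nn_integral_add)
    also have "(\<integral>\<^sup>+t. ennreal \<bar>s i (t + u) - f (t + u)\<bar> \<partial>lborel) = (\<integral>\<^sup>+t. ennreal \<bar>s i t - f t\<bar> \<partial>lborel)"
      by (rule nn_integral_lborel_plus) measurable
    also have "(\<integral>\<^sup>+t. ennreal \<bar>s i (t + u) - s i t\<bar> \<partial>lborel)
        + ((\<integral>\<^sup>+t. ennreal \<bar>s i t - f t\<bar> \<partial>lborel) + (\<integral>\<^sup>+t. ennreal \<bar>s i t - f t\<bar> \<partial>lborel))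
        < ennreal (e/3) + (ennreal (e/3) + ennreal (e/3))"
      using u i by (intro add_strict_mono) auto
    also have "\<dots> = ennreal e" using lim(6) by (simp flip: ennreal_plus)
    finally show "(\<integral>\<^sup>+t. ennreal \<bar>f (t + u) - f t\<bar> \<partial>lborel) < ennreal e" .
  qed
qed

text \<open>The map x |x| sends square integrable functions to integrable ones and keeps the sign,
  so continuity of translations in quadratic mean can be deduced from continuity in mean. For equal
  signs |a - b| is at most |a + b|; opposite signs cause the factor 2.\<close>

lemma sq_diff_le_signed_square: "(a - b)\<^sup>2 \<le> 2 * \<bar>a * \<bar>a\<bar> - b * \<bar>b\<bar>\<bar>" for a b :: real
proof -
  have *: "(a - b)\<^sup>2 \<le> 2 * \<bar>a\<^sup>2 - b\<^sup>2\<bar>" if "a * b \<ge> 0" for a b :: real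
  proof -
    have "\<bar>a - b\<bar> \<le> \<bar>a + b\<bar>" using that by (auto simp: zero_le_mult_iff)
    then have "\<bar>a - b\<bar> * \<bar>a - b\<bar> \<le> \<bar>a + b\<bar> * \<bar>a - b\<bar>" by (intro mult_right_mono) auto
    then have "(a - b)\<^sup>2 \<le> \<bar>a\<^sup>2 - b\<^sup>2\<bar>"
      by (simp add: abs_mult[symmetric] power2_eq_square algebra_simps)
    also have "\<dots> \<le> 2 * \<bar>a\<^sup>2 - b\<^sup>2\<bar>" by simp
    finally show ?thesis .
  qed
  have **: "(a - b)\<^sup>2 \<le> 2 * (a\<^sup>2 + b\<^sup>2)"
    using zero_le_power2[of "a + b"] by (simp add: power2_eq_square algebra_simps)
  consider "a \<ge> 0" "b \<ge> 0" | "a \<le> 0" "b \<le> 0" | "a \<ge> 0" "b \<le> 0" | "a \<le> 0" "b \<ge> 0" by linarith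
  then show ?thesis
  proof cases
    case 1 then show ?thesis using *[of a b] by (simp add: power2_eq_square)
  next
    case 2 then show ?thesis using *[of a b] by (simp add: power2_eq_square mult_nonpos_nonpos abs_minus_commute)
  next
    case 3 then show ?thesis using ** by (simp add: power2_eq_square)
  next
    case 4 then show ?thesis using ** by (simp add: power2_eq_square)
  qed
qed

lemma translation_sq_tendsto_0:
  fixes f :: "'a::euclidean_space \<Rightarrow> complex"
  assumes f: "sq_integrable f" and "e > 0"
  shows "\<forall>\<^sub>F u in nhds 0. (\<integral>\<^sup>+t. ennreal ((cmod (f (t + u) - f t))\<^sup>2) \<partial>lborel) < ennreal e"
proof -
  have fm[measurable]: "f \<in> borel_measurable borel" using f by (simp add: sq_integrable_def)
  define q where "q x = x * \<bar>x\<bar>" for x :: real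
  have [measurable]: "q \<in> borel_measurable borel" unfolding q_def by measurable
  have int: "integrable lborel (\<lambda>t. q (Re (f t)))" "integrable lborel (\<lambda>t. q (Im (f t)))"
  proof -
    have i: "integrable lborel (\<lambda>t. (cmod (f t))\<^sup>2)" using f by (simp add: sq_integrable_def)
    show "integrable lborel (\<lambda>t. q (Re (f t)))" "integrable lborel (\<lambda>t. q (Im (f t)))"
      by (rule Bochner_Integration.integrable_bound[OF i];
          auto simp: q_def abs_mult cmod_power2 power2_eq_square[symmetric])+
  qed
  have "\<forall>\<^sub>F u in nhds 0. (\<integral>\<^sup>+t. ennreal \<bar>q (Re (f (t + u))) - q (Re (f t))\<bar> \<partial>lborel) < ennreal (e/4)"
    "\<forall>\<^sub>F u in nhds 0. (\<integral>\<^sup>+t. ennreal \<bar>q (Im (f (t + u))) - q (Im (f t))\<bar> \<partial>lborel) < ennreal (e/4)"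
    using translation_nn_integral_tendsto_0[OF int(1), of "e/4"]
      translation_nn_integral_tendsto_0[OF int(2), of "e/4"] \<open>e > 0\<close> by auto
  then show ?thesis
  proof eventually_elim
    fix u assume h: "(\<integral>\<^sup>+t. ennreal \<bar>q (Re (f (t + u))) - q (Re (f t))\<bar> \<partial>lborel) < ennreal (e/4)"
      "(\<integral>\<^sup>+t. ennreal \<bar>q (Im (f (t + u))) - q (Im (f t))\<bar> \<partial>lborel) < ennreal (e/4)"
    have "(\<integral>\<^sup>+t. ennreal ((cmod (f (t + u) - f t))\<^sup>2) \<partial>lborel)
      \<le> (\<integral>\<^sup>+t. 2 * (ennreal \<bar>q (Re (f (t + u))) - q (Re (f t))\<bar> + ennreal \<bar>q (Im (f (t + u))) - q (Im (f t))\<bar>) \<partial>lborel)"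
    proof (intro nn_integral_mono)
      fix t
      have "(cmod (f (t + u) - f t))\<^sup>2 \<le> 2 * (\<bar>q (Re (f (t + u))) - q (Re (f t))\<bar> + \<bar>q (Im (f (t + u))) - q (Im (f t))\<bar>)"
        unfolding cmod_power2 q_def distrib_left by (auto intro!: add_mono sq_diff_le_signed_square)
      then have "ennreal ((cmod (f (t + u) - f t))\<^sup>2) \<le> ennreal (2 * (\<bar>q (Re (f (t + u))) - q (Re (f t))\<bar> + \<bar>q (Im (f (t + u))) - q (Im (f t))\<bar>))"
        by (rule ennreal_leI)
      then show "ennreal ((cmod (f (t + u) - f t))\<^sup>2)
          \<le> 2 * (ennreal \<bar>q (Re (f (t + u))) - q (Re (f t))\<bar> + ennreal \<bar>q (Im (f (t + u))) - q (Im (f t))\<bar>)"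
        by (simp add: ennreal_mult)
    qed
    also have "\<dots> = 2 * ((\<integral>\<^sup>+t. ennreal \<bar>q (Re (f (t + u))) - q (Re (f t))\<bar> \<partial>lborel)
        + (\<integral>\<^sup>+t. ennreal \<bar>q (Im (f (t + u))) - q (Im (f t))\<bar> \<partial>lborel))"
      by (simp add: nn_integral_cmult nn_integral_add)
    also have "\<dots> < 2 * (ennreal (e/4) + ennreal (e/4))"
      using h by (intro ennreal_mult_strict_left_mono add_strict_mono) auto
    also have "\<dots> = ennreal e" using \<open>e > 0\<close> by (simp flip: ennreal_plus ennreal_numeral ennreal_mult)
    finally show "(\<integral>\<^sup>+t. ennreal ((cmod (f (t + u) - f t))\<^sup>2) \<partial>lborel) < ennreal e" .
  qed
qed


section \<open>Plancherel's theorem and Moyal's identity\<close>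

lemma lborel_prod_integral:
  fixes f :: "'a::euclidean_space \<Rightarrow> real \<Rightarrow> complex"
  assumes f: "\<And>b. b \<in> Basis \<Longrightarrow> integrable lborel (f b)"
  shows "integrable lborel (\<lambda>x::'a. \<Prod>b\<in>Basis. f b (x \<bullet> b))"
    "(\<integral>x. (\<Prod>b\<in>Basis. f b (x \<bullet> b)) \<partial>lborel) = (\<Prod>b\<in>Basis. integral\<^sup>L lborel (f b))"
proof -
  interpret product_sigma_finite "\<lambda>_::'a. lborel :: real measure" ..
  have [measurable]: "f b \<in> borel_measurable borel" if "b \<in> Basis" for b
    using f[OF that] by auto
  have m: "(\<lambda>x::'a. \<Prod>b\<in>Basis. f b (x \<bullet> b)) \<in> borel_measurable borel" by measurable
  have T: "(\<lambda>g. \<Sum>b\<in>Basis. g b *\<^sub>R b) \<in> measurable (\<Pi>\<^sub>M b\<in>(Basis::'a set). lborel) borel" by measurable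
  have eq: "(\<Prod>b\<in>Basis. f b ((\<Sum>b\<in>Basis. g b *\<^sub>R b) \<bullet> b)) = (\<Prod>b\<in>Basis. f b (g b))" for g :: "'a \<Rightarrow> real"
    by (intro prod.cong) (auto simp: inner_sum_left inner_Basis if_distrib cong: if_cong)
  show "integrable lborel (\<lambda>x::'a. \<Prod>b\<in>Basis. f b (x \<bullet> b))"
    by (subst lborel_eq, subst integrable_distr_eq[OF T m])
       (simp only: eq product_integrable_prod[OF finite_Basis f])
  show "(\<integral>x. (\<Prod>b\<in>Basis. f b (x \<bullet> b)) \<partial>lborel) = (\<Prod>b\<in>Basis. integral\<^sup>L lborel (f b))"
    by (subst lborel_eq, subst integral_distr[OF T m])
       (simp only: eq product_integral_prod[OF finite_Basis f])
qed

lemma gaussian_Fourier_real: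
  fixes y :: real
  shows "integrable lborel (\<lambda>x. of_real (exp (- pi * x\<^sup>2)) * cis (- 2 * pi * (x * y)))"
    "(\<integral>x. of_real (exp (- pi * x\<^sup>2)) * cis (- 2 * pi * (x * y)) \<partial>lborel) = of_real (exp (- pi * y\<^sup>2))"
proof -
  \<comment> \<open>This scale turns exp(-pi x^2) into a multiple of the standard normal density,
    whose characteristic function is known.\<close>
  define c where "c = sqrt (2 * pi)"
  have c: "c > 0" "c\<^sup>2 = 2 * pi" by (simp_all add: c_def)
  define F where "F x = std_normal_density x *\<^sub>R exp (\<i> * complex_of_real ((- c * y) * x))" for x
  have eq: "c *\<^sub>R F (0 + c * x) = of_real (exp (- pi * x\<^sup>2)) * cis (- 2 * pi * (x * y))" for x
  proof -
    have 1: "(- c * y) * (c * x) = - 2 * pi * (x * y)" using c(2) by (simp add: power2_eq_square)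
    have 2: "c * std_normal_density (c * x) = exp (- pi * x\<^sup>2)"
      using c unfolding std_normal_density_def by (simp add: power_mult_distrib c_def)
    have "c *\<^sub>R F (0 + c * x) = of_real (c * std_normal_density (c * x)) * exp (\<i> * complex_of_real ((- c * y) * (c * x)))"
      by (simp add: F_def scaleR_conv_of_real)
    then show ?thesis unfolding 1 2 by (simp add: cis_conv_exp)
  qed
  have iF: "integrable lborel F"
  proof -
    have [measurable]: "F \<in> borel_measurable borel" unfolding F_def by measurable
    have "integrable lborel (\<lambda>x. std_normal_density x)" by simp
    then show ?thesis by (rule Bochner_Integration.integrable_bound) (auto simp: F_def)
  qed
  have "integrable lborel (\<lambda>x. c *\<^sub>R F (0 + c * x))"
    using lborel_integrable_real_affine[OF iF, of c 0] c by simp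
  then show "integrable lborel (\<lambda>x. of_real (exp (- pi * x\<^sup>2)) * cis (- 2 * pi * (x * y)))"
    unfolding eq .
  have "(\<integral>x. c *\<^sub>R F (0 + c * x) \<partial>lborel) = (\<integral>x. F x \<partial>lborel)"
    using lborel_integral_real_affine[of c F 0] c by simp
  also have "\<dots> = char std_normal_distribution (- c * y)"
    unfolding char_def F_def by (subst integral_density) auto
  also have "\<dots> = of_real (exp (- pi * y\<^sup>2))"
    unfolding char_std_normal_distribution using c by (simp add: power_mult_distrib)
  finally show "(\<integral>x. of_real (exp (- pi * x\<^sup>2)) * cis (- 2 * pi * (x * y)) \<partial>lborel) = of_real (exp (- pi * y\<^sup>2))"
    unfolding eq .
qed

lemma gaussian_Fourier:
  fixes u :: "'a::euclidean_space"
  shows "integrable lborel (\<lambda>w::'a. of_real (exp (- pi * (norm w)\<^sup>2)) * cis (- 2 * pi * (w \<bullet> u)))"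
    "(\<integral>w. of_real (exp (- pi * (norm w)\<^sup>2)) * cis (- 2 * pi * (w \<bullet> u)) \<partial>lborel) = of_real (exp (- pi * (norm u)\<^sup>2))"
proof -
  have n: "(norm x)\<^sup>2 = (\<Sum>b\<in>Basis. (x \<bullet> b)\<^sup>2)" for x :: 'a
    unfolding power2_norm_eq_inner by (subst euclidean_inner) (simp add: power2_eq_square)
  have e: "exp (- pi * (norm x)\<^sup>2) = (\<Prod>b\<in>Basis. exp (- pi * (x \<bullet> b)\<^sup>2))" for x :: 'a
    unfolding n by (simp add: exp_sum[symmetric] sum_distrib_left sum_negf)
  have ci: "cis (- 2 * pi * (w \<bullet> u)) = (\<Prod>b\<in>Basis. cis (- 2 * pi * ((w \<bullet> b) * (u \<bullet> b))))" for w
    by (subst euclidean_inner) (simp add: cis_conv_exp exp_sum[symmetric] sum_distrib_left)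
  have eq: "of_real (exp (- pi * (norm w)\<^sup>2)) * cis (- 2 * pi * (w \<bullet> u))
      = (\<Prod>b\<in>Basis. of_real (exp (- pi * (w \<bullet> b)\<^sup>2)) * cis (- 2 * pi * ((w \<bullet> b) * (u \<bullet> b))))" for w
    unfolding e ci by (simp add: prod.distrib)
  show "integrable lborel (\<lambda>w::'a. of_real (exp (- pi * (norm w)\<^sup>2)) * cis (- 2 * pi * (w \<bullet> u)))"
    unfolding eq
    by (rule lborel_prod_integral(1)[of "\<lambda>b x. of_real (exp (- pi * x\<^sup>2)) * cis (- 2 * pi * (x * (u \<bullet> b)))"])
       (rule gaussian_Fourier_real)
  show "(\<integral>w. of_real (exp (- pi * (norm w)\<^sup>2)) * cis (- 2 * pi * (w \<bullet> u)) \<partial>lborel) = of_real (exp (- pi * (norm u)\<^sup>2))"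
    unfolding eq
    by (subst lborel_prod_integral(2)[of "\<lambda>b x. of_real (exp (- pi * x\<^sup>2)) * cis (- 2 * pi * (x * (u \<bullet> b)))"],
        rule gaussian_Fourier_real)
       (simp only: gaussian_Fourier_real e of_real_prod)
qed

lemma integrable_gaussian:
  "integrable lborel (\<lambda>w::'a::euclidean_space. exp (- pi * (norm w)\<^sup>2))"
  "(\<integral>w. exp (- pi * (norm (w::'a::euclidean_space))\<^sup>2) \<partial>lborel) = 1"
proof -
  have 1: "integrable lborel (\<lambda>w::'a. complex_of_real (exp (- pi * (norm w)\<^sup>2)))"
    using gaussian_Fourier(1)[of "0 :: 'a"] by simp
  then show "integrable lborel (\<lambda>w::'a. exp (- pi * (norm w)\<^sup>2))"
    by (simp only: complex_of_real_integrable_eq)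
  have "complex_of_real (\<integral>w. exp (- pi * (norm (w::'a))\<^sup>2) \<partial>lborel) = of_real 1"
    using gaussian_Fourier(2)[of "0 :: 'a"] by (simp flip: integral_complex_of_real)
  then show "(\<integral>w. exp (- pi * (norm (w::'a::euclidean_space))\<^sup>2) \<partial>lborel) = 1"
    by (simp only: of_real_eq_iff)
qed

section \<open>Autocorrelation and Plancherel's theorem\<close>

definition Fourier :: "('a::euclidean_space \<Rightarrow> complex) \<Rightarrow> 'a \<Rightarrow> complex" where
  "Fourier f w = (\<integral>t. f t * cis (- 2 * pi * (w \<bullet> t)) \<partial>lborel)"

definition autocorrelation :: "('a::euclidean_space \<Rightarrow> complex) \<Rightarrow> 'a \<Rightarrow> complex" where
  "autocorrelation f u = (\<integral>t. f (t + u) * cnj (f t) \<partial>lborel)"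

lemma borel_measurable_cis [measurable (raw)]:
  "f \<in> borel_measurable M \<Longrightarrow> (\<lambda>x. cis (f x)) \<in> borel_measurable M"
  unfolding cis_conv_exp by measurable

lemma borel_measurable_cnj [measurable (raw)]:
  "f \<in> borel_measurable M \<Longrightarrow> (\<lambda>x. cnj (f x)) \<in> borel_measurable M"
  by (rule borel_measurable_continuous_on[OF continuous_on_cnj]) (auto intro: continuous_on_id)

lemma integrable_autocorrelation_kernel:
  fixes f :: "'a::euclidean_space \<Rightarrow> complex"
  assumes f: "integrable lborel f"
  shows "integrable (lborel \<Otimes>\<^sub>M lborel) (\<lambda>(u, t). f (t + u) * cnj (f t))"
proof (rule integrableI_bounded)
  have [measurable]: "f \<in> borel_measurable borel" using f by auto
  show "(\<lambda>(u, t). f (t + u) * cnj (f t)) \<in> borel_measurable (lborel \<Otimes>\<^sub>M lborel)" by measurable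
  have "(\<integral>\<^sup>+p. ennreal (norm (case p of (u, t) \<Rightarrow> f (t + u) * cnj (f t))) \<partial>(lborel \<Otimes>\<^sub>M lborel))
      = (\<integral>\<^sup>+t. \<integral>\<^sup>+u. ennreal (cmod (f t)) * ennreal (cmod (f (u + t))) \<partial>lborel \<partial>lborel)"
    by (subst lborel_pair.nn_integral_snd[symmetric])
       (auto simp: norm_mult ennreal_mult mult.commute add.commute intro!: nn_integral_cong)
  also have "\<dots> = (\<integral>\<^sup>+t. ennreal (cmod (f t)) * (\<integral>\<^sup>+u. ennreal (cmod (f u)) \<partial>lborel) \<partial>lborel)"
    by (simp add: nn_integral_cmult nn_integral_lborel_plus[of "\<lambda>t. ennreal (cmod (f t))"])
  also have "\<dots> = (\<integral>\<^sup>+u. ennreal (cmod (f u)) \<partial>lborel) * (\<integral>\<^sup>+u. ennreal (cmod (f u)) \<partial>lborel)"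
    by (simp add: nn_integral_multc)
  also have "\<dots> < \<infinity>"
    using f by (simp add: integrable_iff_bounded ennreal_mult_less_top)
  finally show "(\<integral>\<^sup>+p. ennreal (norm (case p of (u, t) \<Rightarrow> f (t + u) * cnj (f t))) \<partial>(lborel \<Otimes>\<^sub>M lborel)) < \<infinity>" .
qed

lemma integrable_autocorrelation:
  assumes "integrable lborel f"
  shows "integrable lborel (autocorrelation f)"
  unfolding autocorrelation_def[abs_def]
  by (rule lborel_pair.integrable_fst[OF integrable_autocorrelation_kernel[OF assms]])

text \<open>The convolution theorem for \<open>f\<close> and its reflected conjugate: writing the
  phase \<open>w \<bullet> u\<close> as \<open>w \<bullet> (u + t)\<close> minus
  \<open>w \<bullet> t\<close> separates the variables once Fubini's theorem has swapped the
  integrals.\<close>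

lemma Fourier_autocorrelation:
  fixes f :: "'a::euclidean_space \<Rightarrow> complex"
  assumes f: "integrable lborel f"
  shows "Fourier (autocorrelation f) w = of_real ((cmod (Fourier f w))\<^sup>2)"
proof -
  have [measurable]: "f \<in> borel_measurable borel" using f by auto
  define H where "H u t = f (t + u) * cnj (f t) * cis (- 2 * pi * (w \<bullet> u))" for u t
  have [measurable]: "case_prod H \<in> borel_measurable (lborel \<Otimes>\<^sub>M lborel)" unfolding H_def by measurable
  have "integrable (lborel \<Otimes>\<^sub>M lborel) (case_prod H)"
    by (rule Bochner_Integration.integrable_bound[OF integrable_autocorrelation_kernel[OF f]])
       (auto simp: H_def norm_mult split_beta)
  then have "(\<integral>u. \<integral>t. H u t \<partial>lborel \<partial>lborel) = (\<integral>t. \<integral>u. H u t \<partial>lborel \<partial>lborel)"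
    by (rule lborel_pair.Fubini_integral[symmetric])
  moreover have "(\<integral>t. H u t \<partial>lborel) = autocorrelation f u * cis (- 2 * pi * (w \<bullet> u))" for u
    unfolding autocorrelation_def H_def by simp
  moreover have "(\<integral>u. H u t \<partial>lborel) = Fourier f w * cnj (f t * cis (- 2 * pi * (w \<bullet> t)))" for t
  proof -
    have "H u t = (f (u + t) * cis (- 2 * pi * (w \<bullet> (u + t)))) * cnj (f t * cis (- 2 * pi * (w \<bullet> t)))" for u
    proof -
      have "cis (- 2 * pi * (w \<bullet> u)) = cis (- 2 * pi * (w \<bullet> (u + t))) * cnj (cis (- 2 * pi * (w \<bullet> t)))"
        by (simp add: cis_cnj cis_mult inner_add_right algebra_simps)
      then show ?thesis by (simp add: H_def add.commute)
    qed
    then have "(\<integral>u. H u t \<partial>lborel)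
        = (\<integral>u. f (u + t) * cis (- 2 * pi * (w \<bullet> (u + t))) \<partial>lborel) * cnj (f t * cis (- 2 * pi * (w \<bullet> t)))"
      by simp
    also have "(\<integral>u. f (u + t) * cis (- 2 * pi * (w \<bullet> (u + t))) \<partial>lborel) = Fourier f w"
      unfolding Fourier_def
      by (rule integral_lborel_plus[of "\<lambda>u. f u * cis (- 2 * pi * (w \<bullet> u))"]) measurable
    finally show ?thesis .
  qed
  ultimately have "Fourier (autocorrelation f) w
      = (\<integral>t. Fourier f w * cnj (f t * cis (- 2 * pi * (w \<bullet> t))) \<partial>lborel)"
    unfolding Fourier_def by simp
  also have "\<dots> = Fourier f w * cnj (Fourier f w)"
    unfolding Fourier_def[of f] by (subst Bochner_Integration.integral_cnj[symmetric]) simp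
  finally show ?thesis by (simp only: complex_norm_square)
qed

lemma borel_measurable_Fourier [measurable]:
  assumes [measurable]: "f \<in> borel_measurable borel"
  shows "Fourier f \<in> borel_measurable borel"
  unfolding Fourier_def[abs_def] by measurable

lemma gaussian_regularized_Plancherel:
  fixes f :: "'a::euclidean_space \<Rightarrow> complex"
  assumes f: "integrable lborel f" and "c > 0"
  shows "integrable lborel (\<lambda>w. exp (- pi * (norm (c *\<^sub>R w))\<^sup>2) * (cmod (Fourier f w))\<^sup>2)"
    "(\<integral>w. exp (- pi * (norm (c *\<^sub>R w))\<^sup>2) * (cmod (Fourier f w))\<^sup>2 \<partial>lborel)
      = (\<integral>v. exp (- pi * (norm v)\<^sup>2) * Re (autocorrelation f (c *\<^sub>R v)) \<partial>lborel)"
proof -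
  define a where "a = autocorrelation f"
  define g where "g x = exp (- pi * (norm (x :: 'a))\<^sup>2)" for x
  have [measurable]: "g \<in> borel_measurable borel" unfolding g_def by measurable
  have [measurable]: "f \<in> borel_measurable borel" using f by auto
  have ia: "integrable lborel a" unfolding a_def by (rule integrable_autocorrelation[OF f])
  then have [measurable]: "a \<in> borel_measurable borel" by auto
  have ig: "integrable lborel (\<lambda>w. g (c *\<^sub>R w))"
  proof -
    have "integrable (density (distr lborel borel (\<lambda>x. 0 + c *\<^sub>R x)) (\<lambda>_. ennreal (\<bar>c\<bar> ^ DIM('a)))) g"
      using lborel_affine[of c "0 :: 'a"] \<open>c > 0\<close> integrable_gaussian(1)[where 'a = 'a] by (simp add: g_def[abs_def])
    then show ?thesis using \<open>c > 0\<close> by (simp add: integrable_density integrable_distr_eq)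
  qed
  define H where "H w u = of_real (g (c *\<^sub>R w)) * (a u * cis (- 2 * pi * (w \<bullet> u)))" for w u
  have mH [measurable]: "case_prod H \<in> borel_measurable (lborel \<Otimes>\<^sub>M lborel)" unfolding H_def by measurable
  have iH: "integrable (lborel \<Otimes>\<^sub>M lborel) (case_prod H)"
  proof (rule integrableI_bounded[OF mH])
    have "(\<integral>\<^sup>+p. ennreal (norm (case_prod H p)) \<partial>(lborel \<Otimes>\<^sub>M lborel))
        = (\<integral>\<^sup>+w. \<integral>\<^sup>+u. ennreal (norm (g (c *\<^sub>R w))) * ennreal (norm (a u)) \<partial>lborel \<partial>lborel)"
      by (subst lborel.nn_integral_fst[symmetric], measurable)
         (auto simp: H_def norm_mult ennreal_mult intro!: nn_integral_cong)
    also have "\<dots> = (\<integral>\<^sup>+w. ennreal (norm (g (c *\<^sub>R w))) \<partial>lborel) * (\<integral>\<^sup>+u. ennreal (norm (a u)) \<partial>lborel)"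
      by (simp add: nn_integral_cmult nn_integral_multc)
    also have "\<dots> < \<infinity>"
      using ia ig unfolding integrable_iff_bounded by (simp add: ennreal_mult_less_top)
    finally show "(\<integral>\<^sup>+p. ennreal (norm (case_prod H p)) \<partial>(lborel \<Otimes>\<^sub>M lborel)) < \<infinity>" .
  qed
  have H1: "(\<integral>u. H w u \<partial>lborel) = of_real (g (c *\<^sub>R w) * (cmod (Fourier f w))\<^sup>2)" for w
    using Fourier_autocorrelation[OF f, of w] by (simp add: H_def Fourier_def[of "autocorrelation f"] a_def)
  have H2: "(\<integral>w. H w u \<partial>lborel) = of_real (inverse (c ^ DIM('a)) * g (inverse c *\<^sub>R u)) * a u" for u
  proof -
    have "of_real (g (inverse c *\<^sub>R u)) = (\<integral>w. of_real (g w) * cis (- 2 * pi * (w \<bullet> (inverse c *\<^sub>R u))) \<partial>lborel)"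
      unfolding g_def gaussian_Fourier(2) ..
    also have "\<dots> = c ^ DIM('a) *\<^sub>R (\<integral>w. of_real (g (c *\<^sub>R w)) * cis (- 2 * pi * (w \<bullet> u)) \<partial>lborel)"
      using \<open>c > 0\<close> by (subst integral_lborel_scaleR[where c = c]) (auto simp flip: mult.assoc)
    finally have "(\<integral>w. of_real (g (c *\<^sub>R w)) * cis (- 2 * pi * (w \<bullet> u)) \<partial>lborel)
        = of_real (inverse (c ^ DIM('a)) * g (inverse c *\<^sub>R u))"
      using \<open>c > 0\<close> by (simp add: scaleR_conv_of_real field_simps)
    moreover have "(\<integral>w. H w u \<partial>lborel) = (\<integral>w. of_real (g (c *\<^sub>R w)) * cis (- 2 * pi * (w \<bullet> u)) \<partial>lborel) * a u"
      unfolding H_def by (subst integral_mult_left_zero[symmetric]) (simp add: mult_ac)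
    ultimately show ?thesis by simp
  qed
  have "integrable lborel (\<lambda>w. complex_of_real (g (c *\<^sub>R w) * (cmod (Fourier f w))\<^sup>2))"
    using lborel_pair.integrable_fst[OF iH] unfolding H1 .
  then show "integrable lborel (\<lambda>w. exp (- pi * (norm (c *\<^sub>R w))\<^sup>2) * (cmod (Fourier f w))\<^sup>2)"
    unfolding complex_of_real_integrable_eq g_def .
  have "complex_of_real (\<integral>w. g (c *\<^sub>R w) * (cmod (Fourier f w))\<^sup>2 \<partial>lborel) = (\<integral>w. \<integral>u. H w u \<partial>lborel \<partial>lborel)"
    unfolding H1 by (rule integral_complex_of_real[symmetric])
  also have "\<dots> = (\<integral>u. \<integral>w. H w u \<partial>lborel \<partial>lborel)"
    by (rule lborel_pair.Fubini_integral[OF iH, symmetric])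
  also have "\<dots> = c ^ DIM('a) *\<^sub>R (\<integral>v. of_real (inverse (c ^ DIM('a)) * g v) * a (c *\<^sub>R v) \<partial>lborel)"
    unfolding H2 using \<open>c > 0\<close> by (subst integral_lborel_scaleR[where c = c]) auto
  also have "\<dots> = (\<integral>v. of_real (g v) * a (c *\<^sub>R v) \<partial>lborel)"
    using \<open>c > 0\<close> by (simp add: scaleR_conv_of_real mult.assoc)
  finally have *: "complex_of_real (\<integral>w. g (c *\<^sub>R w) * (cmod (Fourier f w))\<^sup>2 \<partial>lborel)
      = (\<integral>v. of_real (g v) * a (c *\<^sub>R v) \<partial>lborel)" .
  have "integrable lborel (\<lambda>v. of_real (g v) * a (c *\<^sub>R v))"
  proof -
    have "integrable (density (distr lborel borel (\<lambda>x. 0 + c *\<^sub>R x)) (\<lambda>_. ennreal (\<bar>c\<bar> ^ DIM('a)))) a"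
      using lborel_affine[of c "0 :: 'a"] \<open>c > 0\<close> ia by simp
    then have "integrable lborel (\<lambda>v. c ^ DIM('a) *\<^sub>R a (c *\<^sub>R v))"
      using \<open>c > 0\<close> by (simp add: integrable_density integrable_distr_eq)
    then have "integrable lborel (\<lambda>v. inverse (c ^ DIM('a)) *\<^sub>R (c ^ DIM('a) *\<^sub>R a (c *\<^sub>R v)))"
      by (rule integrable_scaleR_right)
    then have "integrable lborel (\<lambda>v. a (c *\<^sub>R v))" using \<open>c > 0\<close> by simp
    then show ?thesis by (rule Bochner_Integration.integrable_bound)
         (auto simp: norm_mult g_def intro!: mult_left_le_one_le)
  qed
  then have "Re (\<integral>v. of_real (g v) * a (c *\<^sub>R v) \<partial>lborel) = (\<integral>v. g v * Re (a (c *\<^sub>R v)) \<partial>lborel)"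
    by (subst integral_Re[symmetric]) auto
  with arg_cong[OF *, of Re] show "(\<integral>w. exp (- pi * (norm (c *\<^sub>R w))\<^sup>2) * (cmod (Fourier f w))\<^sup>2 \<partial>lborel)
      = (\<integral>v. exp (- pi * (norm v)\<^sup>2) * Re (autocorrelation f (c *\<^sub>R v)) \<partial>lborel)"
    unfolding g_def a_def Re_complex_of_real by (rule trans)
qed

lemma sq_integrable_shift: "sq_integrable f \<Longrightarrow> sq_integrable (\<lambda>t. f (t - x))"
  using l2rel_comp[OF _ distr_lborel_shift, of x f f] by (auto simp: l2rel_def)

text \<open>Up to a factor 1/2, \<open>N - Re (autocorrelation f u)\<close> and
  \<open>N + Re (autocorrelation f u)\<close> are the squared norms of the difference and of the sum
  of \<open>f\<close> and its translate. Continuity of translations gives the limit, and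
  nonnegativity of both gives the bound.\<close>

lemma autocorrelation_tendsto:
  fixes f :: "'a::euclidean_space \<Rightarrow> complex"
  assumes f: "sq_integrable f"
  defines "N \<equiv> (\<integral>t. (cmod (f t))\<^sup>2 \<partial>lborel)"
  shows "((\<lambda>u. Re (autocorrelation f u)) \<longlongrightarrow> N) (nhds 0)" "\<bar>Re (autocorrelation f u)\<bar> \<le> N"
proof -
  have [measurable]: "f \<in> borel_measurable borel" and i: "integrable lborel (\<lambda>t. (cmod (f t))\<^sup>2)"
    using f by (auto simp: sq_integrable_def)
  have sq_shift: "sq_integrable (\<lambda>t. f (t + u))" for u
    using sq_integrable_shift[OF f, of "- u"] by simp
  have iu: "integrable lborel (\<lambda>t. (cmod (f (t + u)))\<^sup>2)" "(\<integral>t. (cmod (f (t + u)))\<^sup>2 \<partial>lborel) = N" for u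
    using sq_shift[of u] integral_lborel_plus[of "\<lambda>t. (cmod (f t))\<^sup>2" u] by (auto simp: sq_integrable_def N_def)
  have ip: "integrable lborel (\<lambda>t. f (t + u) * cnj (f t))" for u
    by (rule sq_integrable_mult_cnj[OF sq_shift f])
  have id: "integrable lborel (\<lambda>t. (cmod (f (t + u) - f t))\<^sup>2)" for u
    using sq_integrable_diff[OF sq_shift f, of u] by (simp add: sq_integrable_def)
  define P where "P u t = Re (f (t + u) * cnj (f t))" for u t
  have iP: "integrable lborel (P u)" for u unfolding P_def using ip by (rule integrable_Re)
  have Re_a: "Re (autocorrelation f u) = integral\<^sup>L lborel (P u)" for u
    unfolding autocorrelation_def P_def by (rule integral_Re[symmetric, OF ip])
  have "(cmod (f (t + u) - f t))\<^sup>2 = ((cmod (f (t + u)))\<^sup>2 + (cmod (f t))\<^sup>2) - 2 * P u t"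
    "(cmod (f (t + u) + f t))\<^sup>2 = ((cmod (f (t + u)))\<^sup>2 + (cmod (f t))\<^sup>2) + 2 * P u t" for t u
    unfolding cmod_power2 P_def by (simp_all add: power2_eq_square algebra_simps)
  then have *: "N - Re (autocorrelation f u) = (\<integral>t. (cmod (f (t + u) - f t))\<^sup>2 \<partial>lborel) / 2"
    and **: "N + Re (autocorrelation f u) = (\<integral>t. (cmod (f (t + u) + f t))\<^sup>2 \<partial>lborel) / 2" for u
    using i iu[of u] iP[of u] by (simp_all add: N_def Re_a)
  have "0 \<le> (\<integral>t. (cmod (f (t + u) - f t))\<^sup>2 \<partial>lborel)" "0 \<le> (\<integral>t. (cmod (f (t + u) + f t))\<^sup>2 \<partial>lborel)"
    by (auto intro: integral_nonneg_AE)
  then show "\<bar>Re (autocorrelation f u)\<bar> \<le> N" using *[of u] **[of u] by linarith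
  show "((\<lambda>u. Re (autocorrelation f u)) \<longlongrightarrow> N) (nhds 0)"
  proof (rule tendstoI)
    fix e :: real assume "e > 0"
    from translation_sq_tendsto_0[OF f this]
    show "\<forall>\<^sub>F u in nhds 0. dist (Re (autocorrelation f u)) N < e"
    proof eventually_elim
      fix u assume "(\<integral>\<^sup>+t. ennreal ((cmod (f (t + u) - f t))\<^sup>2) \<partial>lborel) < ennreal e"
      then have "(\<integral>t. (cmod (f (t + u) - f t))\<^sup>2 \<partial>lborel) < e"
        by (subst (asm) nn_integral_eq_integral[OF id]) (auto simp: ennreal_less_iff)
      moreover have "0 \<le> (\<integral>t. (cmod (f (t + u) - f t))\<^sup>2 \<partial>lborel)"
        by (auto intro: integral_nonneg_AE)
      ultimately show "dist (Re (autocorrelation f u)) N < e"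
        using *[of u] unfolding dist_real_def by linarith
    qed
  qed
qed

text \<open>The parameter of the Gaussian weight tends to zero. On the frequency side the weights
  increase to 1, so convergence is monotone; on the time side \<open>N\<close> times a Gaussian of
  integral one dominates.\<close>

theorem Plancherel:
  fixes f :: "'a::euclidean_space \<Rightarrow> complex"
  assumes f: "integrable lborel f" "sq_integrable f"
  shows "(\<integral>\<^sup>+w. ennreal ((cmod (Fourier f w))\<^sup>2) \<partial>lborel) = (\<integral>\<^sup>+t. ennreal ((cmod (f t))\<^sup>2) \<partial>lborel)"
proof -
  have [measurable]: "f \<in> borel_measurable borel" and i: "integrable lborel (\<lambda>t. (cmod (f t))\<^sup>2)"
    using f by (auto simp: sq_integrable_def)
  define N where "N = (\<integral>t. (cmod (f t))\<^sup>2 \<partial>lborel)"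
  define c where "c n = inverse (real (Suc n))" for n
  have c: "c n > 0" for n by (simp add: c_def)
  have c0: "c \<longlonglongrightarrow> 0" unfolding c_def by (rule LIMSEQ_inverse_real_of_nat)
  have c_mono: "c n \<le> c m" if "m \<le> n" for m n using that by (simp add: c_def le_imp_inverse_le)
  have a_meas [measurable]: "autocorrelation f \<in> borel_measurable borel"
    using integrable_autocorrelation[OF f(1)] by auto
  have "(\<lambda>n. \<integral>\<^sup>+w. ennreal (exp (- pi * (norm (c n *\<^sub>R w))\<^sup>2) * (cmod (Fourier f w))\<^sup>2) \<partial>lborel)
      \<longlonglongrightarrow> (\<integral>\<^sup>+w. ennreal ((cmod (Fourier f w))\<^sup>2) \<partial>lborel)"
  proof (rule nn_integral_LIMSEQ)
    show "incseq (\<lambda>n w. ennreal (exp (- pi * (norm (c n *\<^sub>R w))\<^sup>2) * (cmod (Fourier f w))\<^sup>2))"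
      using c c_mono by (auto simp: incseq_def le_fun_def less_imp_le abs_of_pos
          intro!: ennreal_leI mult_right_mono power_mono)
    show "(\<lambda>n. ennreal (exp (- pi * (norm (c n *\<^sub>R w))\<^sup>2) * (cmod (Fourier f w))\<^sup>2))
        \<longlonglongrightarrow> ennreal ((cmod (Fourier f w))\<^sup>2)" for w
    proof -
      have "(\<lambda>n. exp (- pi * (norm (c n *\<^sub>R w))\<^sup>2) * (cmod (Fourier f w))\<^sup>2)
        \<longlonglongrightarrow> exp (- pi * (norm (0 *\<^sub>R w))\<^sup>2) * (cmod (Fourier f w))\<^sup>2"
        by (intro tendsto_intros c0)
      then show ?thesis by (intro tendsto_ennrealI) simp
    qed
  qed measurable
  moreover have "(\<lambda>n. \<integral>\<^sup>+w. ennreal (exp (- pi * (norm (c n *\<^sub>R w))\<^sup>2) * (cmod (Fourier f w))\<^sup>2) \<partial>lborel)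
      \<longlonglongrightarrow> ennreal N"
  proof -
    have "(\<integral>\<^sup>+w. ennreal (exp (- pi * (norm (c n *\<^sub>R w))\<^sup>2) * (cmod (Fourier f w))\<^sup>2) \<partial>lborel)
        = ennreal (\<integral>v. exp (- pi * (norm v)\<^sup>2) * Re (autocorrelation f (c n *\<^sub>R v)) \<partial>lborel)" for n
      by (subst nn_integral_eq_integral[OF gaussian_regularized_Plancherel(1)[OF f(1) c]])
         (auto simp only: gaussian_regularized_Plancherel(2)[OF f(1) c] intro!: AE_I2 mult_nonneg_nonneg exp_ge_zero zero_le_power2)
    moreover have "(\<lambda>n. \<integral>v. exp (- pi * (norm (v::'a))\<^sup>2) * Re (autocorrelation f (c n *\<^sub>R v)) \<partial>lborel)
        \<longlonglongrightarrow> (\<integral>v. exp (- pi * (norm (v::'a))\<^sup>2) * N \<partial>lborel)"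
    proof (rule integral_dominated_convergence[where w = "\<lambda>v. exp (- pi * (norm v)\<^sup>2) * N"])
      show "integrable lborel (\<lambda>v::'a. exp (- pi * (norm v)\<^sup>2) * N)"
        using integrable_gaussian(1) by (rule integrable_mult_left)
      show "AE v in lborel. (\<lambda>n. exp (- pi * (norm (v::'a))\<^sup>2) * Re (autocorrelation f (c n *\<^sub>R v)))
          \<longlonglongrightarrow> exp (- pi * (norm v)\<^sup>2) * N"
      proof (rule AE_I2)
        fix v :: 'a
        have "(\<lambda>n. c n *\<^sub>R v) \<longlonglongrightarrow> 0 *\<^sub>R v" by (intro tendsto_intros c0)
        then have "(\<lambda>n. c n *\<^sub>R v) \<longlonglongrightarrow> 0" by simp
        then have "(\<lambda>n. Re (autocorrelation f (c n *\<^sub>R v))) \<longlonglongrightarrow> N"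
          unfolding N_def by (rule filterlim_compose[OF autocorrelation_tendsto(1)[OF f(2)]])
        then show "(\<lambda>n. exp (- pi * (norm v)\<^sup>2) * Re (autocorrelation f (c n *\<^sub>R v)))
          \<longlonglongrightarrow> exp (- pi * (norm v)\<^sup>2) * N" by (intro tendsto_intros)
      qed
      show "AE v in lborel. norm (exp (- pi * (norm (v::'a))\<^sup>2) * Re (autocorrelation f (c n *\<^sub>R v)))
          \<le> exp (- pi * (norm v)\<^sup>2) * N" for n
        using autocorrelation_tendsto(2)[OF f(2)] by (auto simp: abs_mult N_def)
    qed measurable
    ultimately show ?thesis
      using integrable_gaussian(2)[where 'a = 'a] by (simp add: tendsto_ennrealI)
  qed
  ultimately have "(\<integral>\<^sup>+w. ennreal ((cmod (Fourier f w))\<^sup>2) \<partial>lborel) = ennreal N"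
    by (rule LIMSEQ_unique)
  then show ?thesis unfolding N_def by (subst nn_integral_eq_integral[OF i]) auto
qed

section \<open>The short-time Fourier transform and its orthogonality relation\<close>

lemma rep_l2_tf_shift:
  "AE t in lborel. rep_l2 (tf_shift (x, w) f) t = cis (2 * pi * (w \<bullet> t)) * rep_l2 f (t - x)"
proof -
  have "sq_integrable (\<lambda>t. cis (2 * pi * (w \<bullet> t)) * rep_l2 f (t - x))"
    using sq_integrable_shift[OF sq_integrable_rep_l2[of f], of x]
    by (auto simp: sq_integrable_def norm_mult)
  moreover have "tf_shift (x, w) f = abs_l2 (\<lambda>t. cis (2 * pi * (w \<bullet> t)) * rep_l2 f (t - x))"
    by (simp add: tf_shift_def)
  ultimately show ?thesis using rep_l2_abs_l2 by simp
qed

lemma cinner_tf_shift: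
  "cinner f (tf_shift (x, w) g) = Fourier (\<lambda>t. rep_l2 f t * cnj (rep_l2 g (t - x))) w"
  unfolding cinner_rep_l2 Fourier_def
proof (rule integral_cong_AE)
  show "AE t in lborel. rep_l2 f t * cnj (rep_l2 (tf_shift (x, w) g) t)
      = rep_l2 f t * cnj (rep_l2 g (t - x)) * cis (- 2 * pi * (w \<bullet> t))"
    using rep_l2_tf_shift[of x w g] by eventually_elim (simp add: cis_cnj mult_ac)
qed measurable

lemma borel_measurable_cinner_tf_shift [measurable]:
  "(\<lambda>z. cinner f (tf_shift z g)) \<in> borel_measurable borel"
proof -
  have "(\<lambda>(x, w). Fourier (\<lambda>t. rep_l2 f t * cnj (rep_l2 g (t - x))) w) \<in> borel_measurable (borel \<Otimes>\<^sub>M borel)"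
    unfolding Fourier_def by measurable
  moreover have "(\<lambda>z. cinner f (tf_shift z g)) = (\<lambda>(x, w). Fourier (\<lambda>t. rep_l2 f t * cnj (rep_l2 g (t - x))) w)"
    by (auto simp: cinner_tf_shift)
  ultimately show ?thesis by (simp add: borel_prod)
qed

text \<open>For fixed \<open>x\<close> the matrix element is the Fourier transform of
  \<open>f\<close> times the conjugate of the translated \<open>g\<close>. That product is
  integrable for every \<open>x\<close>, and square integrable for almost every \<open>x\<close>
  because the double integral of its squared modulus is finite; so Plancherel's theorem applies
  under the outer integral.\<close>

theorem Moyal:
  "(\<integral>\<^sup>+z. ennreal ((cmod (cinner f (tf_shift z g)))\<^sup>2) \<partial>lborel) = ennreal ((norm f)\<^sup>2 * (norm g)\<^sup>2)"
proof -
  let ?h = "\<lambda>x t. rep_l2 f t * cnj (rep_l2 g (t - x))"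
  have int: "integrable lborel (?h x)" for x
    by (rule sq_integrable_mult_cnj[OF sq_integrable_rep_l2 sq_integrable_shift[OF sq_integrable_rep_l2]])
  have prod: "(\<integral>\<^sup>+x. \<integral>\<^sup>+t. ennreal ((cmod (?h x t))\<^sup>2) \<partial>lborel \<partial>lborel) = ennreal ((norm f)\<^sup>2 * (norm g)\<^sup>2)"
  proof -
    have "(\<integral>\<^sup>+x. \<integral>\<^sup>+t. ennreal ((cmod (?h x t))\<^sup>2) \<partial>lborel \<partial>lborel)
        = (\<integral>\<^sup>+t. \<integral>\<^sup>+x. ennreal ((cmod (?h x t))\<^sup>2) \<partial>lborel \<partial>lborel)"
      by (rule lborel_pair.Fubini') measurable
    also have "\<dots> = (\<integral>\<^sup>+t. ennreal ((cmod (rep_l2 f t))\<^sup>2) * (\<integral>\<^sup>+x. ennreal ((cmod (rep_l2 g (t - x)))\<^sup>2) \<partial>lborel) \<partial>lborel)"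
      by (simp add: norm_mult power_mult_distrib ennreal_mult nn_integral_cmult)
    also have "\<dots> = (\<integral>\<^sup>+t. ennreal ((cmod (rep_l2 f t))\<^sup>2) * ennreal ((norm g)\<^sup>2) \<partial>lborel)"
      unfolding norm_sq_rep_l2' by (subst nn_integral_lborel_minus[of "\<lambda>x. ennreal ((cmod (rep_l2 g x))\<^sup>2)"]) auto
    also have "\<dots> = ennreal ((norm f)\<^sup>2 * (norm g)\<^sup>2)"
      by (simp add: nn_integral_multc norm_sq_rep_l2'[symmetric] ennreal_mult)
    finally show ?thesis .
  qed
  have "AE x in lborel. (\<integral>\<^sup>+t. ennreal ((cmod (?h x t))\<^sup>2) \<partial>lborel) \<noteq> \<infinity>"
    by (rule nn_integral_PInf_AE) (use prod in auto)
  then have *: "AE x in lborel. (\<integral>\<^sup>+w. ennreal ((cmod (Fourier (?h x) w))\<^sup>2) \<partial>lborel)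
      = (\<integral>\<^sup>+t. ennreal ((cmod (?h x t))\<^sup>2) \<partial>lborel)"
  proof eventually_elim
    fix x assume fin: "(\<integral>\<^sup>+t. ennreal ((cmod (?h x t))\<^sup>2) \<partial>lborel) \<noteq> \<infinity>"
    have "sq_integrable (?h x)"
      unfolding sq_integrable_def integrable_iff_bounded using fin by (auto simp: less_top)
    then show "(\<integral>\<^sup>+w. ennreal ((cmod (Fourier (?h x) w))\<^sup>2) \<partial>lborel)
      = (\<integral>\<^sup>+t. ennreal ((cmod (?h x t))\<^sup>2) \<partial>lborel)"
      by (rule Plancherel[OF int])
  qed
  have "(\<integral>\<^sup>+z. ennreal ((cmod (cinner f (tf_shift z g)))\<^sup>2) \<partial>lborel)
      = (\<integral>\<^sup>+z. ennreal ((cmod (cinner f (tf_shift z g)))\<^sup>2) \<partial>(lborel \<Otimes>\<^sub>M lborel))"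
    by (simp add: lborel_prod)
  also have "\<dots> = (\<integral>\<^sup>+x. \<integral>\<^sup>+w. ennreal ((cmod (cinner f (tf_shift (x, w) g)))\<^sup>2) \<partial>lborel \<partial>lborel)"
    by (rule lborel.nn_integral_fst[symmetric]) (simp add: lborel_prod)
  also have "\<dots> = (\<integral>\<^sup>+x. \<integral>\<^sup>+t. ennreal ((cmod (?h x t))\<^sup>2) \<partial>lborel \<partial>lborel)"
    unfolding cinner_tf_shift by (rule nn_integral_cong_AE[OF *])
  finally show ?thesis unfolding prod .
qed


section \<open>Translations and perimeter\<close>

definition pos_sq :: "real \<Rightarrow> real" where
  "pos_sq s = (max 0 s)\<^sup>2"

lemma pos_sq_has_derivative: "(pos_sq has_real_derivative 2 * max 0 s) (at s)"
proof -
  consider "s < 0" | "s > 0" | "s = 0" by linarith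
  then show ?thesis
  proof cases
    case 1
    have "((\<lambda>_. 0) has_real_derivative 2 * max 0 s) (at s)" using 1 by (auto intro!: derivative_eq_intros)
    then show ?thesis
      by (rule has_field_derivative_transform_within_open[where S = "{..<0}"]) (use 1 in \<open>auto simp: pos_sq_def\<close>)
  next
    case 2
    have "((\<lambda>s. s\<^sup>2) has_real_derivative 2 * max 0 s) (at s)" using 2 by (auto intro!: derivative_eq_intros)
    then show ?thesis
      by (rule has_field_derivative_transform_within_open[where S = "{0<..}"]) (use 2 in \<open>auto simp: pos_sq_def\<close>)
  next
    case 3
    have "((\<lambda>h. (pos_sq (0 + h) - pos_sq 0) / h) \<longlongrightarrow> 0) (at 0)"
    proof (rule Lim_transform_eventually)
      have "((\<lambda>h::real. max 0 h) \<longlongrightarrow> max 0 0) (at 0)" by (intro tendsto_intros)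
      then show "((\<lambda>h::real. max 0 h) \<longlongrightarrow> 0) (at 0)" by simp
      show "\<forall>\<^sub>F h in at 0. max 0 h = (pos_sq (0 + h) - pos_sq 0) / h"
        by (auto simp: eventually_at_filter pos_sq_def max_def power2_eq_square intro!: always_eventually)
    qed
    then show ?thesis using 3 by (simp add: DERIV_def)
  qed
qed

text \<open>Squared positive parts are continuously differentiable, which is the smoothness that
  \<open>test_fields\<close> asks for. Summed over a finite cover of \<open>K\<close> by balls, they
  give a function that is positive on \<open>K\<close> and vanishes outside closed balls contained
  in \<open>U\<close>.\<close>

lemma C1_bump_function:
  fixes K U :: "'b::euclidean_space set"
  assumes "compact K" "open U" "K \<subseteq> U"
  obtains \<phi> :: "'b \<Rightarrow> real" and D where
    "\<And>z. (\<phi> has_derivative D z) (at z)" "\<And>v. continuous_on UNIV (\<lambda>z. D z v)"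
    "\<And>z. 0 \<le> \<phi> z" "\<And>z. \<phi> z \<le> 1" "\<And>z. z \<in> K \<Longrightarrow> \<phi> z = 1" "\<And>z. z \<notin> U \<Longrightarrow> \<phi> z = 0"
    "compact (closure {z. \<phi> z \<noteq> 0})"
proof (cases "K = {}")
  case True
  then show thesis by (intro that[of "\<lambda>_. 0" "\<lambda>_ _. 0"]) auto
next
  case False
  obtain e where e: "e > 0" "(\<Union>x\<in>K. cball x e) \<subseteq> U"
    using compact_subset_open_imp_cball_epsilon_subset[OF assms] by metis
  have "K \<subseteq> (\<Union>x\<in>K. ball x e)" using e by auto
  then obtain X where X: "X \<subseteq> K" "finite X" "K \<subseteq> (\<Union>x\<in>X. ball x e)"
    using compactE_image[OF assms(1), of K "\<lambda>x. ball x e"] by (metis open_ball)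
  define p where "p y = (\<Sum>x\<in>X. pos_sq (e\<^sup>2 - (norm (y - x))\<^sup>2))" for y
  define Dp where "Dp y v = (\<Sum>x\<in>X. (2 * max 0 (e\<^sup>2 - (norm (y - x))\<^sup>2)) * (- (2 * ((y - x) \<bullet> v))))" for y v
  have p_deriv: "(p has_derivative Dp y) (at y)" for y
  proof -
    have "((\<lambda>y. pos_sq (e\<^sup>2 - (norm (y - x))\<^sup>2)) has_derivative
      (\<lambda>v. (2 * max 0 (e\<^sup>2 - (norm (y - x))\<^sup>2)) * (- (2 * ((y - x) \<bullet> v))))) (at y)" for x
    proof -
      have 1: "((\<lambda>y. e\<^sup>2 - (norm (y - x))\<^sup>2) has_derivative (\<lambda>v. - (2 * ((y - x) \<bullet> v)))) (at y)"
        unfolding power2_norm_eq_inner by (auto intro!: derivative_eq_intros simp: inner_commute)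
      show ?thesis
        using has_derivative_compose[OF 1 pos_sq_has_derivative[unfolded has_field_derivative_def]] by simp
    qed
    then show ?thesis unfolding p_def Dp_def by (rule has_derivative_sum)
  qed
  have p_cont: "continuous_on UNIV p"
    using p_deriv by (meson continuous_at_imp_continuous_on has_derivative_continuous)
  have p_nonneg: "p y \<ge> 0" for y by (simp add: p_def pos_sq_def sum_nonneg)
  have p_pos: "p y > 0" if yK: "y \<in> K" for y
  proof -
    obtain x where x: "x \<in> X" "y \<in> ball x e" using X(3) yK by blast
    have "norm (y - x) < e" using x by (simp add: dist_norm norm_minus_commute)
    then have "(norm (y - x))\<^sup>2 < e\<^sup>2" by (intro power_strict_mono) auto
    then have "pos_sq (e\<^sup>2 - (norm (y - x))\<^sup>2) > 0" by (simp add: pos_sq_def)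
    then show ?thesis unfolding p_def using x X by (intro sum_pos2[of X x]) (auto simp: pos_sq_def)
  qed
  have p_zero: "p y = 0" if "y \<notin> (\<Union>x\<in>X. cball x e)" for y
  proof -
    have "pos_sq (e\<^sup>2 - (norm (y - x))\<^sup>2) = 0" if "x \<in> X" for x
    proof -
      have "e \<le> norm (y - x)" using that \<open>y \<notin> _\<close> by (auto simp: dist_norm norm_minus_commute less_imp_le)
      then have "e\<^sup>2 \<le> (norm (y - x))\<^sup>2" using \<open>e > 0\<close> by (intro power_mono) auto
      then show ?thesis by (simp add: pos_sq_def)
    qed
    then show ?thesis by (simp add: p_def)
  qed
  obtain x0 where x0: "x0 \<in> K" "\<And>y. y \<in> K \<Longrightarrow> p x0 \<le> p y"
    using continuous_attains_inf[OF assms(1) False continuous_on_subset[OF p_cont]] by auto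
  define m where "m = p x0"
  have m: "m > 0" "\<And>y. y \<in> K \<Longrightarrow> m \<le> p y" using x0 p_pos by (auto simp: m_def)
  \<comment> \<open>Since \<open>m\<close> is the minimum of \<open>p\<close> on \<open>K\<close>,
    this equals 1 wherever \<open>p y \<ge> m\<close> and 0 where \<open>p y = 0\<close>, and the
    squared positive part keeps it continuously differentiable where the plateau begins.\<close>
  define \<phi> where "\<phi> y = 1 - pos_sq (1 - p y / m)" for y
  define D where "D y v = (2 * max 0 (1 - p y / m)) * (Dp y v / m)" for y v
  have \<phi>0: "\<phi> y = 0" if "y \<notin> (\<Union>x\<in>X. cball x e)" for y
    using p_zero[OF that] by (simp add: \<phi>_def pos_sq_def)
  have "compact (\<Union>x\<in>X. cball x e)" using X by (intro compact_UN) auto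
  moreover have "{z. \<phi> z \<noteq> 0} \<subseteq> (\<Union>x\<in>X. cball x e)" using \<phi>0 by blast
  ultimately have supp: "compact (closure {z. \<phi> z \<noteq> 0})"
    by (meson bounded_subset closure_minimal compact_closure compact_imp_bounded compact_imp_closed)
  show thesis
  proof (rule that[of \<phi> D])
    fix z :: 'b
    have 1: "((\<lambda>y. 1 - p y / m) has_derivative (\<lambda>v. - (Dp z v / m))) (at z)"
      using m by (auto intro!: derivative_eq_intros p_deriv)
    have "((\<lambda>y. 1 - pos_sq (1 - p y / m)) has_derivative
        (\<lambda>v. 0 - (2 * max 0 (1 - p z / m)) * (- (Dp z v / m)))) (at z)"
      by (intro has_derivative_diff has_derivative_const
          has_derivative_compose[OF 1 pos_sq_has_derivative[unfolded has_field_derivative_def]])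
    then show "(\<phi> has_derivative D z) (at z)" unfolding \<phi>_def D_def by simp
    show "0 \<le> \<phi> z" "\<phi> z \<le> 1"
      using p_nonneg[of z] m(1) by (auto simp: \<phi>_def pos_sq_def max_def power_le_one)
    show "\<phi> z = 1" if "z \<in> K" using m(2)[OF that] m(1) by (simp add: \<phi>_def pos_sq_def)
    show "\<phi> z = 0" if "z \<notin> U" using \<phi>0[of z] that e X by blast
  next
    show "continuous_on UNIV (\<lambda>z. D z v)" for v
      unfolding D_def Dp_def using m(1) by (intro continuous_intros p_cont) auto
  qed (rule supp)
qed

text \<open>A scalar function times a constant vector has as its divergence the derivative in that
  direction, so the perimeter controls directional derivatives of every translate of one
  cutoff.\<close>

lemma translate_test_field:
  fixes \<phi> :: "'b::euclidean_space \<Rightarrow> real"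
  assumes D: "\<And>z. (\<phi> has_derivative D z) (at z)" "\<And>v. continuous_on UNIV (\<lambda>z. D z v)"
    and "\<And>z. 0 \<le> \<phi> z" "\<And>z. \<phi> z \<le> 1" and supp: "compact (closure {z. \<phi> z \<noteq> 0})"
    and n: "norm n \<le> 1"
  shows "(\<lambda>z. \<phi> (z + a) *\<^sub>R n) \<in> test_fields"
    "divergence (\<lambda>z. \<phi> (z + a) *\<^sub>R n) z = D (z + a) n"
proof -
  have "((\<lambda>z. z + a) has_derivative (\<lambda>v. v)) (at z)" for z :: 'b
    by (auto intro!: derivative_eq_intros)
  then have "((\<lambda>z. \<phi> (z + a)) has_derivative D (z + a)) (at z)" for z
    using has_derivative_compose[OF _ D(1)] by fastforce
  then have d: "((\<lambda>z. \<phi> (z + a) *\<^sub>R n) has_derivative (\<lambda>v. D (z + a) v *\<^sub>R n)) (at z)" for z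
    by (rule has_derivative_scaleR_left)
  then have fd: "frechet_derivative (\<lambda>z. \<phi> (z + a) *\<^sub>R n) (at z) = (\<lambda>v. D (z + a) v *\<^sub>R n)" for z
    by (metis frechet_derivative_at)
  have lin: "linear (D z)" for z using D(1) has_derivative_linear by blast
  have "D (z + a) n = D (z + a) (\<Sum>b\<in>Basis. (n \<bullet> b) *\<^sub>R b)" by (simp add: euclidean_representation)
  also have "\<dots> = (\<Sum>b\<in>Basis. (n \<bullet> b) * D (z + a) b)"
    by (simp add: linear_sum[OF lin] linear_scale[OF lin] o_def)
  finally show "divergence (\<lambda>z. \<phi> (z + a) *\<^sub>R n) z = D (z + a) n"
    unfolding divergence_def fd by (simp add: mult.commute)
  have "{z. \<phi> (z + a) *\<^sub>R n \<noteq> 0} \<subseteq> (\<lambda>z. z - a) ` closure {z. \<phi> z \<noteq> 0}"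
  proof
    fix z assume "z \<in> {z. \<phi> (z + a) *\<^sub>R n \<noteq> 0}"
    then have "z + a \<in> closure {z. \<phi> z \<noteq> 0}" using closure_subset by force
    then have "(z + a) - a \<in> (\<lambda>z. z - a) ` closure {z. \<phi> z \<noteq> 0}" by (rule imageI)
    then show "z \<in> (\<lambda>z. z - a) ` closure {z. \<phi> z \<noteq> 0}" by simp
  qed
  moreover have "compact ((\<lambda>z. z - a) ` closure {z. \<phi> z \<noteq> 0})"
    by (intro compact_continuous_image supp continuous_intros)
  ultimately have "compact (closure {z. \<phi> (z + a) *\<^sub>R n \<noteq> 0})"
    by (meson bounded_subset closure_minimal compact_closure compact_imp_bounded compact_imp_closed)
  moreover have "(\<lambda>z. \<phi> (z + a) *\<^sub>R n) differentiable (at z)" for z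
    using d by (auto simp: differentiable_def)
  moreover have "continuous_on UNIV (\<lambda>z. D (z + a) b *\<^sub>R n)" for b
    by (intro continuous_intros continuous_on_compose2[OF D(2)]) auto
  moreover have "norm (\<phi> (z + a) *\<^sub>R n) \<le> 1" for z
    using assms(3,4)[of "z + a"] n by (simp add: mult_le_one)
  ultimately show "(\<lambda>z. \<phi> (z + a) *\<^sub>R n) \<in> test_fields"
    unfolding test_fields_def mem_Collect_eq fd by blast
qed

text \<open>The finite difference of \<open>\<phi>\<close> is an average of directional derivatives
  along the segment from \<open>z\<close> to \<open>z + u\<close>. After Fubini's theorem each
  parameter \<open>t\<close> contributes the pairing of \<open>\<Omega>\<close> with one test field,
  which the perimeter bounds.\<close>

lemma translation_le_perimeter_aux:
  fixes \<Omega> :: "'b::euclidean_space set"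
  assumes \<Omega>: "compact \<Omega>" and per: "perimeter \<Omega> < \<infinity>" and "u \<noteq> 0"
    and D: "\<And>z. (\<phi> has_derivative D z) (at z)" "\<And>v. continuous_on UNIV (\<lambda>z. D z v)"
    and \<phi>: "\<And>z. 0 \<le> \<phi> z" "\<And>z. \<phi> z \<le> 1" and supp: "compact (closure {z. \<phi> z \<noteq> 0})"
  shows "(\<integral>z. indicat_real \<Omega> z * (\<phi> z - \<phi> (z + u)) \<partial>lborel) \<le> norm u * enn2real (perimeter \<Omega>)"
proof -
  have P: "perimeter \<Omega> = ennreal (enn2real (perimeter \<Omega>))" using per by simp
  \<comment> \<open>The direction opposes \<open>u\<close> because the difference is taken as
    \<open>\<phi> z - \<phi> (z + u)\<close>.\<close>
  define n where "n = - (u /\<^sub>R norm u)"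
  have n: "norm n \<le> 1" "norm u *\<^sub>R n = - u" using \<open>u \<noteq> 0\<close> by (auto simp: n_def)
  have lin: "linear (D z)" for z using D(1) has_derivative_linear by blast
  have Dn: "- D z u = norm u * D z n" for z
    using linear_scale[OF lin, of z "norm u" n] linear_neg[OF lin, of z u] n(2) by simp
  define g where "g t z = indicat_real {0..1} t * (indicat_real \<Omega> z * D (z + t *\<^sub>R u) n)" for t :: real and z
  have m\<Omega> [measurable]: "\<Omega> \<in> sets borel" using \<Omega> by (rule borel_compact)
  have [measurable]: "(\<lambda>z. D z v) \<in> borel_measurable borel" for v
    using D(2) by (intro borel_measurable_continuous_onI)
  \<comment> \<open>The derivative is bounded on the compact set swept out by
    \<open>\<Omega>\<close> along the segment, and the domain of integration has finite
    measure.\<close>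
  have ig: "integrable (lborel \<Otimes>\<^sub>M lborel) (case_prod g)"
  proof -
    have c1: "compact ((\<lambda>(t, z). z + t *\<^sub>R u) ` ({0..1} \<times> \<Omega>))"
      unfolding split_beta
      by (intro compact_continuous_image compact_Times \<Omega> continuous_intros compact_Icc)
    have "compact ((\<lambda>z. D z n) ` ((\<lambda>(t, z). z + t *\<^sub>R u) ` ({0..1} \<times> \<Omega>)))"
      by (intro compact_continuous_image continuous_on_subset[OF D(2)] c1) auto
    from compact_imp_bounded[OF this, unfolded bounded_iff] obtain B
      where "\<forall>r\<in>(\<lambda>z. D z n) ` ((\<lambda>(t, z). z + t *\<^sub>R u) ` ({0..1} \<times> \<Omega>)). norm r \<le> B" ..
    then have B: "\<bar>D (z + t *\<^sub>R u) n\<bar> \<le> B" if "t \<in> {0..1}" "z \<in> \<Omega>" for t z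
    proof -
      have "z + t *\<^sub>R u \<in> (\<lambda>(t, z). z + t *\<^sub>R u) ` ({0..1} \<times> \<Omega>)"
        using that by (intro image_eqI[of _ _ "(t, z)"]) auto
      then show ?thesis
        using \<open>\<forall>r\<in>_. norm r \<le> B\<close> unfolding real_norm_def by blast
    qed
    have "emeasure (lborel \<Otimes>\<^sub>M lborel) ({0..1::real} \<times> \<Omega>) < \<infinity>"
      using emeasure_compact_finite[OF \<Omega>]
      by (subst lborel.emeasure_pair_measure_Times) (auto simp: less_top)
    then have "integrable (lborel \<Otimes>\<^sub>M lborel) (\<lambda>p. indicator ({0..1::real} \<times> \<Omega>) p * B)"
      by (intro integrable_mult_left integrable_real_indicator) auto
    then show ?thesis
    proof (rule Bochner_Integration.integrable_bound)
      show "case_prod g \<in> borel_measurable (lborel \<Otimes>\<^sub>M lborel)" unfolding g_def by measurable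
      show "AE p in lborel \<Otimes>\<^sub>M lborel. norm (case_prod g p) \<le> norm (indicator ({0..1::real} \<times> \<Omega>) p * B)"
      proof (rule AE_I2)
        fix p :: "real \<times> 'b"
        obtain t z where p: "p = (t, z)" by (cases p)
        show "norm (case_prod g p) \<le> norm (indicator ({0..1::real} \<times> \<Omega>) p * B)"
        proof (cases "t \<in> {0..1} \<and> z \<in> \<Omega>")
          case True
          then have "\<bar>D (z + t *\<^sub>R u) n\<bar> \<le> \<bar>B\<bar>" using B[of t z] by linarith
          with True show ?thesis by (simp add: p g_def)
        next
          case False
          then show ?thesis by (auto simp: p g_def)
        qed
      qed
    qed
  qed
  have inner: "(\<integral>z. g t z \<partial>lborel) \<le> indicat_real {0..1} t * enn2real (perimeter \<Omega>)" for t
  proof -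
    have "ennreal (\<integral>z. indicat_real \<Omega> z * D (z + t *\<^sub>R u) n \<partial>lborel) \<le> perimeter \<Omega>"
      unfolding perimeter_def total_variation_def
      by (rule SUP_upper2[OF translate_test_field(1)[OF D \<phi> supp n(1), of "t *\<^sub>R u"]])
         (simp only: translate_test_field(2)[OF D \<phi> supp n(1)] order_refl)
    then have "(\<integral>z. indicat_real \<Omega> z * D (z + t *\<^sub>R u) n \<partial>lborel) \<le> enn2real (perimeter \<Omega>)"
      by (subst (asm) P) (simp only: ennreal_le_iff[OF enn2real_nonneg])
    then show ?thesis unfolding g_def by (auto split: split_indicator)
  qed
  have ftc: "indicat_real \<Omega> z * (\<phi> z - \<phi> (z + u)) = norm u * (\<integral>t. g t z \<partial>lborel)" for z
  proof -
    have "(\<integral>t. indicator {0..1} t *\<^sub>R D (z + t *\<^sub>R u) u \<partial>lborel) = \<phi> (z + 1 *\<^sub>R u) - \<phi> (z + 0 *\<^sub>R u)"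
    proof (rule integral_FTC_atLeastAtMost)
      fix t :: real
      have 1: "((\<lambda>t. z + t *\<^sub>R u) has_derivative (\<lambda>s. s *\<^sub>R u)) (at t within {0..1})"
        by (auto intro!: derivative_eq_intros)
      have "((\<lambda>t. \<phi> (z + t *\<^sub>R u)) has_derivative (\<lambda>s. D (z + t *\<^sub>R u) (s *\<^sub>R u))) (at t within {0..1})"
        by (rule has_derivative_compose[OF 1 D(1)])
      then show "((\<lambda>t. \<phi> (z + t *\<^sub>R u)) has_vector_derivative D (z + t *\<^sub>R u) u) (at t within {0..1})"
        unfolding has_vector_derivative_def by (simp add: linear_scale[OF lin])
    next
      show "continuous_on {0..1} (\<lambda>t. D (z + t *\<^sub>R u) u)"
        by (rule continuous_on_compose2[OF D(2)]) (auto intro!: continuous_intros)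
    qed simp
    then have "\<phi> z - \<phi> (z + u) = (\<integral>t. indicator {0..1} t * (- D (z + t *\<^sub>R u) u) \<partial>lborel)" by simp
    also have "\<dots> = norm u * (\<integral>t. indicator {0..1} t * D (z + t *\<^sub>R u) n \<partial>lborel)"
      unfolding Dn by (subst integral_mult_right_zero[symmetric]) (simp add: mult_ac)
    finally show ?thesis unfolding g_def by (auto split: split_indicator)
  qed
  have "(\<integral>z. indicat_real \<Omega> z * (\<phi> z - \<phi> (z + u)) \<partial>lborel) = norm u * (\<integral>z. \<integral>t. g t z \<partial>lborel \<partial>lborel)"
    unfolding ftc by simp
  also have "(\<integral>z. \<integral>t. g t z \<partial>lborel \<partial>lborel) = (\<integral>t. \<integral>z. g t z \<partial>lborel \<partial>lborel)"
    by (rule pair_sigma_finite.Fubini_integral[OF _ ig]) (rule pair_sigma_finite.intro; unfold_locales)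
  also have "\<dots> \<le> (\<integral>t. indicat_real {0..1::real} t * enn2real (perimeter \<Omega>) \<partial>lborel)"
  proof (rule Bochner_Integration.integral_mono)
    show "integrable lborel (\<lambda>t. \<integral>z. g t z \<partial>lborel)"
      by (rule pair_sigma_finite.integrable_fst[OF _ ig]) (rule pair_sigma_finite.intro; unfold_locales)
  qed (use inner in auto)
  also have "\<dots> = enn2real (perimeter \<Omega>)" by simp
  finally show ?thesis by (simp add: mult_left_mono)
qed

text \<open>Pairing the difference of the indicators of \<open>\<Omega>\<close> and of its translate
  with a cutoff close to the indicator of the lost set \<open>A\<close> moves the shift onto the
  cutoff, where the estimate for smooth functions applies.\<close>

theorem translation_le_perimeter:
  fixes \<Omega> :: "'b::euclidean_space set"
  assumes \<Omega>: "compact \<Omega>" and per: "perimeter \<Omega> < \<infinity>"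
  shows "emeasure lborel {z\<in>\<Omega>. z - u \<notin> \<Omega>} \<le> ennreal (norm u) * perimeter \<Omega>"
proof (cases "u = 0")
  case False
  define A where "A = {z\<in>\<Omega>. z - u \<notin> \<Omega>}"
  have m\<Omega> [measurable]: "\<Omega> \<in> sets borel" using \<Omega> by (rule borel_compact)
  have A: "A \<in> sets borel" 
  proof -
    have "Measurable.pred borel (\<lambda>z. z - u \<in> \<Omega>)" by measurable
    then show ?thesis unfolding A_def by measurable
  qed
  have fin\<Omega>: "emeasure lborel \<Omega> < \<infinity>" using \<Omega> by (rule emeasure_compact_finite)
  have finA: "emeasure lborel A < \<infinity>"
    by (rule le_less_trans[OF emeasure_mono fin\<Omega>]) (auto simp: A_def)
  have main: "measure lborel A \<le> norm u * enn2real (perimeter \<Omega>) + 2 * e" if "e > 0" for e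
  proof -
    obtain K U where KU: "compact K" "open U" "K \<subseteq> A" "A \<subseteq> U" "emeasure lborel (U - K) < ennreal e"
      using borel_compact_open_approx[OF A finA \<open>e > 0\<close>] by metis
    have [measurable]: "K \<in> sets borel" "U \<in> sets borel" using KU by (auto intro: borel_compact)
    obtain \<phi> :: "'b \<Rightarrow> real" and D where D: "\<And>z. (\<phi> has_derivative D z) (at z)" "\<And>v. continuous_on UNIV (\<lambda>z. D z v)"
      and \<phi>: "\<And>z. 0 \<le> \<phi> z" "\<And>z. \<phi> z \<le> 1" and \<phi>K: "\<And>z. z \<in> K \<Longrightarrow> \<phi> z = 1" and \<phi>U: "\<And>z. z \<notin> U \<Longrightarrow> \<phi> z = 0"
      and supp: "compact (closure {z. \<phi> z \<noteq> 0})"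
      by (rule C1_bump_function[OF KU(1,2) order_trans[OF KU(3,4)]]) (rule that; assumption)
    have [measurable]: "\<phi> \<in> borel_measurable borel"
      using D(1) by (intro borel_measurable_continuous_onI continuous_at_imp_continuous_on)
        (auto intro: has_derivative_continuous)
    have finK: "emeasure lborel K < \<infinity>" using KU(1) by (rule emeasure_compact_finite)
    have finUK: "emeasure lborel (U - K) < \<infinity>" using KU by (auto intro: less_trans)
    have iK: "integrable lborel (indicat_real K)" "integrable lborel (indicat_real (U - K))"
      using finK finUK by (auto intro!: integrable_real_indicator)
    have i1: "integrable lborel (\<lambda>z. indicat_real \<Omega> z * \<phi> z)"
      by (rule Bochner_Integration.integrable_bound[of _ "indicat_real \<Omega>"])
         (use fin\<Omega> \<phi> in \<open>auto intro!: integrable_real_indicator split: split_indicator\<close>)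
    have i2: "integrable lborel (\<lambda>z. indicat_real \<Omega> z * \<phi> (z + u))"
      by (rule Bochner_Integration.integrable_bound[of _ "indicat_real \<Omega>"])
         (use fin\<Omega> \<phi> in \<open>auto intro!: integrable_real_indicator split: split_indicator\<close>)
    have i3: "integrable lborel (\<lambda>z. indicat_real \<Omega> (z - u) * \<phi> z)"
    proof -
      have "integrable (distr lborel borel (\<lambda>t. t - u)) (\<lambda>z. indicat_real \<Omega> z * \<phi> (z + u))"
        using i2 by (simp only: distr_lborel_shift)
      then show ?thesis by (subst (asm) integrable_distr_eq) auto
    qed
    have A_le: "measure lborel A \<le> measure lborel K + measure lborel (U - K)"
    proof -
      have "measure lborel A \<le> measure lborel (K \<union> (U - K))" using KU A finK finUK
        by (intro measure_mono_fmeasurable fmeasurable.Un) (auto simp: fmeasurable_def)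
      also have "\<dots> \<le> measure lborel K + measure lborel (U - K)"
        using finK finUK by (intro measure_Un_le) auto
      finally show ?thesis .
    qed
    have e_le: "measure lborel (U - K) \<le> e"
      unfolding measure_def using KU(5) \<open>e > 0\<close> by (intro enn2real_leI) auto
    have "measure lborel K - measure lborel (U - K) = (\<integral>z. indicat_real K z - indicat_real (U - K) z \<partial>lborel)"
      using iK by simp
    also have "\<dots> \<le> (\<integral>z. indicat_real \<Omega> z * \<phi> z - indicat_real \<Omega> (z - u) * \<phi> z \<partial>lborel)"
    proof (rule Bochner_Integration.integral_mono)
      fix z
      \<comment> \<open>On \<open>K\<close> the right-hand side is 1, outside \<open>U\<close> it
        vanishes, and on \<open>U - K\<close> it is at least -1. The set \<open>U - K\<close> costs
        \<open>e\<close> here and once more when \<open>A\<close> is compared with \<open>K\<close>,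
        whence \<open>2 * e\<close>.\<close>
      show "indicat_real K z - indicat_real (U - K) z \<le> indicat_real \<Omega> z * \<phi> z - indicat_real \<Omega> (z - u) * \<phi> z"
        using \<phi>[of z] \<phi>K[of z] \<phi>U[of z] KU(3) by (auto simp: A_def split: split_indicator)
    qed (use iK i1 i3 in auto)
    also have "\<dots> = (\<integral>z. indicat_real \<Omega> z * \<phi> z \<partial>lborel) - (\<integral>z. indicat_real \<Omega> (z - u) * \<phi> z \<partial>lborel)"
      using i1 i3 by simp
    also have "(\<integral>z. indicat_real \<Omega> (z - u) * \<phi> z \<partial>lborel) = (\<integral>z. indicat_real \<Omega> z * \<phi> (z + u) \<partial>lborel)"
      using integral_lborel_plus[of "\<lambda>z. indicat_real \<Omega> (z - u) * \<phi> z" u] by simp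
    also have "(\<integral>z. indicat_real \<Omega> z * \<phi> z \<partial>lborel) - \<dots> = (\<integral>z. indicat_real \<Omega> z * (\<phi> z - \<phi> (z + u)) \<partial>lborel)"
      using i1 i2 by (simp add: right_diff_distrib)
    also have "\<dots> \<le> norm u * enn2real (perimeter \<Omega>)"
      by (rule translation_le_perimeter_aux[OF \<Omega> per False D \<phi> supp])
    finally show ?thesis using A_le e_le by linarith
  qed
  have "measure lborel A \<le> norm u * enn2real (perimeter \<Omega>)"
  proof (rule field_le_epsilon)
    fix e :: real assume "e > 0"
    then show "measure lborel A \<le> norm u * enn2real (perimeter \<Omega>) + e" using main[of "e/2"] by simp
  qed
  then have "ennreal (measure lborel A) \<le> ennreal (norm u) * ennreal (enn2real (perimeter \<Omega>))"
    by (simp add: ennreal_leI flip: ennreal_mult)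
  then have "ennreal (measure lborel A) \<le> ennreal (norm u) * perimeter \<Omega>"
    using per by simp
  then show ?thesis using finA by (simp add: emeasure_eq_ennreal_measure A_def)
qed simp


section \<open>Time-frequency shifts and positive operators\<close>

lemma sq_integrable_reflect: "sq_integrable f \<Longrightarrow> sq_integrable (\<lambda>t. f (- t))"
  using l2rel_comp[OF _ distr_lborel_reflect, of f f] by (auto simp: l2rel_def)

lemma l2_eq_repI:
  assumes "AE t in lborel. rep_l2 f t = rep_l2 g t"
  shows "f = g"
  using abs_l2_eq_iff[OF sq_integrable_rep_l2 sq_integrable_rep_l2, of f g] assms
  by (simp add: abs_l2_rep_l2)

lemma AE_lborel_minus:
  fixes x :: "'a::euclidean_space"
  assumes "AE t in lborel. P t" and [measurable]: "Measurable.pred borel P"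
  shows "AE t in lborel. P (t - x)"
proof -
  have "AE t in distr lborel borel (\<lambda>t. t - x). P t" using assms(1) by (simp only: distr_lborel_shift)
  then show ?thesis by (subst (asm) AE_distr_iff) auto
qed

lemma AE_lborel_uminus:
  assumes "AE t in lborel. P (t :: 'a::euclidean_space)" and [measurable]: "Measurable.pred borel P"
  shows "AE t in lborel. P (- t)"
proof -
  have "AE t in distr lborel borel uminus. P t" using assms(1) by (simp only: distr_lborel_reflect)
  then show ?thesis by (subst (asm) AE_distr_iff) auto
qed

lemma rep_l2_cscale: "AE t in lborel. rep_l2 (cscale c f) t = c * rep_l2 f t"
proof -
  have "cscale c f = abs_l2 (\<lambda>t. c * rep_l2 f t)" by (simp add: cscale_def)
  then show ?thesis using rep_l2_abs_l2[OF sq_integrable_cmult[OF sq_integrable_rep_l2]] by simp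
qed

lemma rep_l2_parity: "AE t in lborel. rep_l2 (parity f) t = rep_l2 f (- t)"
proof -
  have "parity f = abs_l2 (\<lambda>t. rep_l2 f (- t))" by (simp add: parity_def)
  then show ?thesis using rep_l2_abs_l2[OF sq_integrable_reflect[OF sq_integrable_rep_l2]] by simp
qed

lemma tf_shift_cscale: "tf_shift z (cscale c f) = cscale c (tf_shift z f)"
proof (cases z)
  case (Pair x w)
  have "AE t in lborel. rep_l2 (cscale c f) (t - x) = c * rep_l2 f (t - x)"
    by (rule AE_lborel_minus[OF rep_l2_cscale]) measurable
  with rep_l2_tf_shift[of x w "cscale c f"] rep_l2_tf_shift[of x w f] rep_l2_cscale[of c "tf_shift z f"]
  have "AE t in lborel. rep_l2 (tf_shift z (cscale c f)) t = rep_l2 (cscale c (tf_shift z f)) t"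
    unfolding Pair by eventually_elim simp
  then show ?thesis by (rule l2_eq_repI)
qed

lemma tf_shift_tf_shift:
  "tf_shift (x, w) (tf_shift (x', w') f) = cscale (cis (- 2 * pi * (w' \<bullet> x))) (tf_shift (x + x', w + w') f)"
proof -
  have "AE t in lborel. rep_l2 (tf_shift (x', w') f) (t - x) = cis (2 * pi * (w' \<bullet> (t - x))) * rep_l2 f (t - x - x')"
    by (rule AE_lborel_minus[OF rep_l2_tf_shift]) measurable
  with rep_l2_tf_shift[of x w "tf_shift (x', w') f"] rep_l2_tf_shift[of "x + x'" "w + w'" f]
    rep_l2_cscale[of "cis (- 2 * pi * (w' \<bullet> x))" "tf_shift (x + x', w + w') f"]
  have "AE t in lborel. rep_l2 (tf_shift (x, w) (tf_shift (x', w') f)) t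
      = rep_l2 (cscale (cis (- 2 * pi * (w' \<bullet> x))) (tf_shift (x + x', w + w') f)) t"
  proof eventually_elim
    case (elim t)
    have "cis (2 * pi * (w \<bullet> t)) * cis (2 * pi * (w' \<bullet> (t - x)))
        = cis (- 2 * pi * (w' \<bullet> x)) * cis (2 * pi * ((w + w') \<bullet> t))"
      by (simp only: cis_mult inner_diff_right inner_add_left) (simp add: algebra_simps)
    then show ?case unfolding elim diff_diff_eq mult.assoc[symmetric] by (simp only:)
  qed
  then show ?thesis by (rule l2_eq_repI)
qed

lemma tf_shift_zero [simp]: "tf_shift 0 f = f"
proof -
  have "AE t in lborel. rep_l2 (tf_shift 0 f) t = rep_l2 f t"
    using rep_l2_tf_shift[of 0 0 f] unfolding zero_prod_def by eventually_elim simp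
  then show ?thesis by (rule l2_eq_repI)
qed

lemma cinner_tf_shift_tf_shift: "cinner (tf_shift z f) (tf_shift z g) = cinner f g"
proof (cases z)
  case (Pair x w)
  have "cinner (tf_shift z f) (tf_shift z g) = (\<integral>t. rep_l2 f (t - x) * cnj (rep_l2 g (t - x)) \<partial>lborel)"
    unfolding cinner_rep_l2
  proof (rule integral_cong_AE)
    show "AE t in lborel. rep_l2 (tf_shift z f) t * cnj (rep_l2 (tf_shift z g) t)
        = rep_l2 f (t - x) * cnj (rep_l2 g (t - x))"
      using rep_l2_tf_shift[of x w f] rep_l2_tf_shift[of x w g] unfolding Pair
    proof eventually_elim
      case (elim t)
      have "cis (2 * pi * (w \<bullet> t)) * cnj (cis (2 * pi * (w \<bullet> t))) = 1"
        by (simp add: cis_cnj cis_mult)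
      then show ?case unfolding elim by (simp add: mult_ac)
    qed
  qed measurable
  also have "\<dots> = cinner f g" unfolding cinner_rep_l2
    using integral_lborel_plus[of "\<lambda>t. rep_l2 f t * cnj (rep_l2 g t)" "- x"] by simp
  finally show ?thesis .
qed

lemma norm_eq_cinner: "cinner f f = cinner g g \<Longrightarrow> norm f = norm g"
  unfolding cinner_self of_real_eq_iff by (simp add: power2_eq_iff_nonneg)

lemma norm_tf_shift [simp]: "norm (tf_shift z f) = norm f"
  by (rule norm_eq_cinner[OF cinner_tf_shift_tf_shift])

text \<open>Composing two shifts produces a phase, which the modulus removes. That only the
  difference of the two points survives is what later makes overlaps of shifted states a function of
  \<open>w - z\<close>.\<close>

lemma cmod_cinner_tf_shift: "cmod (cinner (tf_shift z f) (tf_shift w g)) = cmod (cinner f (tf_shift (w - z) g))"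
proof -
  obtain x \<omega> where z: "z = (x, \<omega>)" by (cases z)
  obtain y \<eta> where w: "w - z = (y, \<eta>)" by (cases "w - z")
  have w': "w = (x + y, \<omega> + \<eta>)" using z w by (metis add.commute add_Pair diff_add_cancel)
  have "cinner f (tf_shift (w - z) g) = cinner (tf_shift z f) (tf_shift z (tf_shift (w - z) g))"
    by (rule cinner_tf_shift_tf_shift[symmetric])
  also have "tf_shift z (tf_shift (w - z) g) = cscale (cis (- 2 * pi * (\<eta> \<bullet> x))) (tf_shift w g)"
    unfolding w unfolding z w' by (rule tf_shift_tf_shift)
  finally show ?thesis by (simp add: cinner_cscale_right norm_mult)
qed

lemma tf_shift_inverse:
  "tf_shift (x, w) (cscale (cis (- 2 * pi * (w \<bullet> x))) (tf_shift (- x, - w) f)) = f"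
  by (simp add: tf_shift_cscale tf_shift_tf_shift cis_mult flip: zero_prod_def)

text \<open>\<open>adj\<close> is a definite description, so the adjoint has to be exhibited: the
  shift by the opposite point, with the phase that cancels the one from composition.\<close>

lemma cinner_adj_tf_shift: "cinner (tf_shift z f) g = cinner f (adj (tf_shift z) g)"
proof -
  obtain x w where z: "z = (x, w)" by (cases z)
  define B where "B g = cscale (cis (- 2 * pi * (w \<bullet> x))) (tf_shift (- x, - w) g)" for g
  have B: "cinner (tf_shift z f) g = cinner f (B g)" for f g
    using cinner_tf_shift_tf_shift[of z f "B g"] unfolding z B_def tf_shift_inverse .
  have "adj (tf_shift z) = B" unfolding adj_def
  proof (rule the_equality)
    fix B' assume B': "\<forall>f g. cinner (tf_shift z f) g = cinner f (B' g)"
    show "B' = B"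
    proof (intro ext cinner_eqI)
      fix f g show "cinner (B' f) g = cinner (B f) g"
        using B' B by (metis cinner_commute)
    qed
  qed (use B in blast)
  then show ?thesis by (simp add: B)
qed

lemma adj_tf_shift: "adj (tf_shift (x, w)) g = cscale (cis (- 2 * pi * (w \<bullet> x))) (tf_shift (- x, - w) g)"
proof (rule cinner_eqI)
  fix f
  have "cinner f (adj (tf_shift (x, w)) g) = cinner f (cscale (cis (- 2 * pi * (w \<bullet> x))) (tf_shift (- x, - w) g))"
    using cinner_tf_shift_tf_shift[of "(x, w)" f "cscale (cis (- 2 * pi * (w \<bullet> x))) (tf_shift (- x, - w) g)"]
    unfolding tf_shift_inverse cinner_adj_tf_shift .
  then show "cinner (adj (tf_shift (x, w)) g) f
      = cinner (cscale (cis (- 2 * pi * (w \<bullet> x))) (tf_shift (- x, - w) g)) f"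
    by (metis cinner_commute)
qed

lemma cinner_parity: "cinner (parity f) g = cinner f (parity g)"
proof -
  have "cinner (parity f) g = (\<integral>t. rep_l2 f (- t) * cnj (rep_l2 g (- (- t))) \<partial>lborel)"
    unfolding cinner_rep_l2
  proof (rule integral_cong_AE)
    show "AE t in lborel. rep_l2 (parity f) t * cnj (rep_l2 g t) = rep_l2 f (- t) * cnj (rep_l2 g (- (- t)))"
      using rep_l2_parity[of f] by eventually_elim simp
  qed measurable
  also have "\<dots> = (\<integral>t. rep_l2 f t * cnj (rep_l2 g (- t)) \<partial>distr lborel borel uminus)"
    by (subst integral_distr) auto
  also have "\<dots> = cinner f (parity g)" unfolding distr_lborel_reflect cinner_rep_l2
  proof (rule integral_cong_AE)
    show "AE t in lborel. rep_l2 f t * cnj (rep_l2 g (- t)) = rep_l2 f t * cnj (rep_l2 (parity g) t)"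
      using rep_l2_parity[of g] by eventually_elim simp
  qed measurable
  finally show ?thesis .
qed

lemma parity_parity [simp]: "parity (parity f) = f"
proof (rule l2_eq_repI)
  have "AE t in lborel. rep_l2 (parity f) (- t) = rep_l2 f (- (- t))"
    by (rule AE_lborel_uminus[OF rep_l2_parity]) measurable
  with rep_l2_parity[of "parity f"] show "AE t in lborel. rep_l2 (parity (parity f)) t = rep_l2 f t"
    by eventually_elim simp
qed

lemma parity_cscale: "parity (cscale c f) = cscale c (parity f)"
  by (rule cinner_eqI) (simp add: cinner_parity cinner_cscale_left)

lemma parity_tf_shift_parity: "parity (tf_shift (x, w) (parity f)) = tf_shift (- x, - w) f"
proof (rule l2_eq_repI)
  have 1: "AE t in lborel. rep_l2 (tf_shift (x, w) (parity f)) (- t)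
      = cis (2 * pi * (w \<bullet> (- t))) * rep_l2 (parity f) (- t - x)"
    by (rule AE_lborel_uminus[OF rep_l2_tf_shift]) measurable
  have "AE t in lborel. rep_l2 (parity f) (t - x) = rep_l2 f (- (t - x))"
    by (rule AE_lborel_minus[OF rep_l2_parity]) measurable
  then have 2: "AE t in lborel. rep_l2 (parity f) (- t - x) = rep_l2 f (- (- t - x))"
    by (rule AE_lborel_uminus) measurable
  from rep_l2_parity[of "tf_shift (x, w) (parity f)"] 1 2 rep_l2_tf_shift[of "- x" "- w" f]
  show "AE t in lborel. rep_l2 (parity (tf_shift (x, w) (parity f))) t = rep_l2 (tf_shift (- x, - w) f) t"
    by eventually_elim (simp add: add.commute)
qed

text \<open>Countability replaces separability of the space: by Bessel's inequality the integrals of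
  \<open>|\<langle>e, \<pi>(z)\<phi>\<rangle>|\<^sup>2\<close> over a ball have bounded sum over \<open>e\<close>, and by Moyal's identity each \<open>e\<close> has a
  positive integral over some ball.\<close>

lemma countable_orthonormal:
  fixes E :: "'a::euclidean_space l2 set"
  assumes E: "orthonormal E"
  shows "countable E"
proof (cases "E = {}")
  case False
  then obtain g where g: "g \<in> E" by auto
  define I where "I n e = (\<integral>\<^sup>+z\<in>ball 0 (real n). ennreal ((cmod (cinner e (tf_shift z g)))\<^sup>2) \<partial>lborel)" for n e
  have [measurable]: "ball 0 (real n) \<in> sets (borel :: ('a \<times> 'a) measure)" for n by simp
  have sum_I: "(\<Sum>e\<in>F. I n e) \<le> emeasure lborel (ball (0::'a \<times> 'a) (real n))" if "finite F" "F \<subseteq> E" for F n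
  proof -
    have "(\<Sum>e\<in>F. I n e)
        = (\<integral>\<^sup>+z. (\<Sum>e\<in>F. ennreal ((cmod (cinner e (tf_shift z g)))\<^sup>2) * indicator (ball 0 (real n)) z) \<partial>lborel)"
      unfolding I_def by (rule nn_integral_sum[symmetric]) auto
    also have "\<dots> \<le> (\<integral>\<^sup>+z. indicator (ball (0 :: 'a \<times> 'a) (real n)) z \<partial>lborel)"
    proof (intro nn_integral_mono)
      fix z
      have "(\<Sum>e\<in>F. (cmod (cinner e (tf_shift z g)))\<^sup>2) = (\<Sum>e\<in>F. (cmod (cinner (tf_shift z g) e))\<^sup>2)"
        by (intro sum.cong refl) (metis cinner_commute complex_mod_cnj)
      also have "\<dots> \<le> 1"
        using Bessel_finite[OF E that, of "tf_shift z g"] orthonormal_norm[OF E g] by simp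
      finally have "(\<Sum>e\<in>F. ennreal ((cmod (cinner e (tf_shift z g)))\<^sup>2)) \<le> ennreal 1"
        by (subst sum_ennreal) (auto intro!: ennreal_leI)
      then show "(\<Sum>e\<in>F. ennreal ((cmod (cinner e (tf_shift z g)))\<^sup>2) * indicator (ball 0 (real n)) z)
          \<le> indicator (ball 0 (real n)) z"
        by (auto simp: sum_distrib_right[symmetric] split: split_indicator)
    qed
    finally show ?thesis by simp
  qed
  have fin_ball: "emeasure lborel (ball (0::'a \<times> 'a) (real n)) < \<infinity>" for n
    by (rule emeasure_bounded_finite) simp
  have fin_I: "I n e < \<infinity>" if "e \<in> E" for n e
    using sum_I[of "{e}" n] fin_ball[of n] that by (auto intro: le_less_trans)
  have "countable {e \<in> E. enn2real (I n e) \<noteq> 0}" for n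
  proof (rule summable_countable_real)
    show "(\<lambda>e. enn2real (I n e)) summable_on E"
    proof (rule nonneg_bdd_above_summable_on)
      show "bdd_above (sum (\<lambda>e. enn2real (I n e)) ` {F. F \<subseteq> E \<and> finite F})"
      proof (rule bdd_aboveI2)
        fix F assume "F \<in> {F. F \<subseteq> E \<and> finite F}"
        then have F: "finite F" "F \<subseteq> E" by auto
        have "(\<Sum>e\<in>F. enn2real (I n e)) = enn2real (\<Sum>e\<in>F. I n e)"
          using fin_I F by (subst enn2real_sum) auto
        also have "\<dots> \<le> enn2real (emeasure lborel (ball (0::'a \<times> 'a) (real n)))"
          using sum_I[OF F] fin_ball by (intro enn2real_mono) auto
        finally show "(\<Sum>e\<in>F. enn2real (I n e)) \<le> enn2real (emeasure lborel (ball (0::'a \<times> 'a) (real n)))" .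
      qed
    qed simp
  qed
  then have "countable (\<Union>n. {e \<in> E. enn2real (I n e) \<noteq> 0})" by simp
  moreover have "E \<subseteq> (\<Union>n. {e \<in> E. enn2real (I n e) \<noteq> 0})"
  proof
    fix e assume e: "e \<in> E"
    show "e \<in> (\<Union>n. {e \<in> E. enn2real (I n e) \<noteq> 0})"
    proof (rule ccontr)
      assume "e \<notin> (\<Union>n. {e \<in> E. enn2real (I n e) \<noteq> 0})"
      then have "I n e = 0" for n using e fin_I[OF e, of n] by (auto simp: enn2real_eq_0_iff)
      then have "AE z in lborel. ennreal ((cmod (cinner e (tf_shift z g)))\<^sup>2) * indicator (ball 0 (real n)) z = 0" for n
        unfolding I_def by (subst (asm) nn_integral_0_iff_AE) auto
      then have "AE z in lborel. \<forall>n. ennreal ((cmod (cinner e (tf_shift z g)))\<^sup>2) * indicator (ball 0 (real n)) z = 0"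
        unfolding AE_all_countable by (rule allI)
      then have "AE z in lborel. ennreal ((cmod (cinner e (tf_shift z g)))\<^sup>2) = 0"
      proof eventually_elim
        case (elim z)
        obtain n where "norm z < real n" using reals_Archimedean2 by blast
        with elim[rule_format, of n] show ?case by simp
      qed
      then have "(\<integral>\<^sup>+z. ennreal ((cmod (cinner e (tf_shift z g)))\<^sup>2) \<partial>lborel) = 0"
        by (subst nn_integral_0_iff_AE) auto
      then show False using orthonormal_norm[OF E e] orthonormal_norm[OF E g] by (simp add: Moyal)
    qed
  qed
  ultimately show ?thesis by (rule countable_subset[rotated])
qed simp

section \<open>Positive semidefinite forms and elimination of pivots\<close>

definition psd :: "'a::euclidean_space l2op \<Rightarrow> bool" where
  "psd A \<longleftrightarrow> (\<forall>f g. A (f + g) = A f + A g) \<and> (\<forall>c f. A (cscale c f) = cscale c (A f)) \<and>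
     (\<forall>f. cinner (A f) f \<in> \<real>\<^sub>\<ge>\<^sub>0)"

text \<open>\<open>psd\<close> keeps the algebraic conditions, which survive the subtraction of a
  suitable rank-one term by computation with the form alone; the bound on the form is carried along
  separately.\<close>

lemma positive_op_psd: "positive_op A \<Longrightarrow> psd A"
  unfolding positive_op_def bounded_op_def psd_def using bounded_linear.linear linear_add by blast

text \<open>Polarization: that the form is real at \<open>f + g\<close> compares the imaginary
  parts, and that it is real at \<open>f + cscale \<i> g\<close> compares the real parts.\<close>

lemma psd_hermitian:
  assumes "psd A"
  shows "cinner (A g) f = cnj (cinner (A f) g)"
proof -
  have add: "A (f + g) = A f + A g" and sc: "A (cscale c f) = cscale c (A f)" for f g c
    using assms by (auto simp: psd_def)
  have real: "Im (cinner (A f) f) = 0" for f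
    using assms by (auto simp: psd_def complex_nonneg_Reals_iff)
  have "Im (cinner (A f) g) + Im (cinner (A g) f) = 0"
    using real[of "f + g"] real[of f] real[of g] by (simp add: add cinner_add_left cinner_add_right)
  moreover have "Re (cinner (A g) f) = Re (cinner (A f) g)"
    using real[of "f + cscale \<i> g"] real[of f] real[of g]
    by (simp add: add sc cinner_add_left cinner_add_right cinner_cscale_left cinner_cscale_right)
  ultimately show ?thesis by (simp add: complex_eq_iff)
qed

lemma psd_Re_nonneg: "psd A \<Longrightarrow> 0 \<le> Re (cinner (A f) f)"
  by (auto simp: psd_def complex_nonneg_Reals_iff)

lemma psd_cinner_self: "psd A \<Longrightarrow> cinner (A f) f = of_real (Re (cinner (A f) f))"
  by (auto simp: psd_def complex_nonneg_Reals_iff complex_eq_iff)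

lemma psd_combine:
  assumes "psd A"
  shows "Re (cinner (A (f + cscale c g)) (f + cscale c g))
     = Re (cinner (A f) f) + 2 * Re (cnj c * cinner (A f) g) + (cmod c)\<^sup>2 * Re (cinner (A g) g)"
proof -
  have add: "A (f + g) = A f + A g" and sc: "A (cscale c f) = cscale c (A f)" for f g c
    using assms by (auto simp: psd_def)
  have "Re (c * cinner (A g) f) = Re (cnj c * cinner (A f) g)"
    by (subst psd_hermitian[OF assms]) simp
  moreover have "Re (cnj c * (c * cinner (A g) g)) = (cmod c)\<^sup>2 * Re (cinner (A g) g)"
    by (subst mult.assoc[symmetric], subst mult.commute[of "cnj c" c], subst complex_norm_square[symmetric]) simp
  ultimately show ?thesis
    by (simp add: add sc cinner_add_left cinner_add_right cinner_cscale_left cinner_cscale_right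
        distrib_left del: times_complex.sel)
qed

lemma psd_Cauchy_Schwarz:
  assumes "psd A"
  shows "(cmod (cinner (A f) g))\<^sup>2 \<le> Re (cinner (A f) f) * Re (cinner (A g) g)"
proof -
  define w where "w = cinner (A f) g"
  define a where "a = Re (cinner (A f) f)"
  define b where "b = Re (cinner (A g) g)"
  have ab: "a \<ge> 0" "b \<ge> 0" using psd_Re_nonneg[OF assms] by (auto simp: a_def b_def)
  have ww: "Re (cnj w * w) = (cmod w)\<^sup>2" 
    by (subst mult.commute, subst complex_norm_square[symmetric]) (simp only: Re_complex_of_real)
  have quad: "0 \<le> a - 2 * s * (cmod w)\<^sup>2 + s\<^sup>2 * (cmod w)\<^sup>2 * b" for s :: real
  proof -
    have "0 \<le> Re (cinner (A (f + cscale (- of_real s * w) g)) (f + cscale (- of_real s * w) g))"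
      by (rule psd_Re_nonneg[OF assms])
    also have "\<dots> = a + 2 * Re (cnj (- of_real s * w) * w) + (cmod (- of_real s * w))\<^sup>2 * b"
      unfolding psd_combine[OF assms] a_def b_def w_def ..
    also have "Re (cnj (- of_real s * w) * w) = - s * (cmod w)\<^sup>2"
      unfolding ww[symmetric] by (simp add: algebra_simps)
    finally show ?thesis by (simp add: norm_mult power_mult_distrib)
  qed
  have "(cmod w)\<^sup>2 \<le> a * b"
  proof (cases "b = 0")
    case False
    then have "b > 0" using ab by simp
    \<comment> \<open>The quadratic in \<open>s\<close> attains its minimum at 1/b.\<close>
    have "0 \<le> b * (a - 2 * (1/b) * (cmod w)\<^sup>2 + (1/b)\<^sup>2 * (cmod w)\<^sup>2 * b)"
      using \<open>b > 0\<close> by (intro mult_nonneg_nonneg quad) simp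
    also have "\<dots> = a * b - (cmod w)\<^sup>2"
      using \<open>b > 0\<close> by (simp add: field_simps power2_eq_square)
    finally show ?thesis by simp
  next
    case True
    have "cmod w = 0"
    proof (rule ccontr)
      assume "cmod w \<noteq> 0"
      then have "(cmod w)\<^sup>2 > 0" by simp
      \<comment> \<open>For \<open>b = 0\<close> the quadratic degenerates to a linear function of
        \<open>s\<close>; this \<open>s\<close> would give it the value \<open>- a - 2\<close>,
        which is negative.\<close>
      moreover have "0 \<le> a - 2 * ((a + 1) / (cmod w)\<^sup>2) * (cmod w)\<^sup>2"
        using quad[of "(a + 1) / (cmod w)\<^sup>2"] True by simp
      ultimately have "0 \<le> a - 2 * (a + 1)" by simp
      then show False using ab by simp
    qed
    then show ?thesis using True by simp
  qed
  then show ?thesis by (simp add: w_def a_def b_def)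
qed

definition Cholesky_vec :: "'a::euclidean_space l2op \<Rightarrow> 'a l2 \<Rightarrow> 'a l2" where
  "Cholesky_vec A e = cscale (of_real (inverse (sqrt (Re (cinner (A e) e))))) (A e)"

text \<open>A Schur complement: the pivot \<open>e\<close> is eliminated by a rank-one term, as in
  Gaussian elimination on a Hermitian matrix.\<close>

definition Cholesky_step :: "'a::euclidean_space l2op \<Rightarrow> 'a l2 \<Rightarrow> 'a l2op" where
  "Cholesky_step A e f = A f - cscale (cinner f (Cholesky_vec A e)) (Cholesky_vec A e)"

lemma Cholesky_step_cinner:
  "cinner (Cholesky_step A e f) g
    = cinner (A f) g - cinner f (Cholesky_vec A e) * cinner (Cholesky_vec A e) g"
  by (simp add: Cholesky_step_def cinner_diff_left cinner_cscale_left)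

text \<open>If \<open>\<langle>A e, e\<rangle> = 0\<close> then \<open>A e = 0\<close>, and the inverse of zero makes \<^term>\<open>Cholesky_vec A e\<close> zero.\<close>

lemma Cholesky_step_psd:
  assumes A: "psd A"
  shows "psd (Cholesky_step A e)"
    and "Re (cinner (Cholesky_step A e f) f) \<le> Re (cinner (A f) f)"
    and "Cholesky_step A e e = 0"
    and "A g = 0 \<Longrightarrow> Cholesky_step A e g = 0"
proof -
  have add: "A (f + g) = A f + A g" and sc: "A (cscale c f) = cscale c (A f)" for f g c
    using A by (auto simp: psd_def)
  define a where "a = Re (cinner (A e) e)"
  define v where "v = Cholesky_vec A e"
  have a0: "a \<ge> 0" using psd_Re_nonneg[OF A] by (simp add: a_def)
  have vf: "cinner v f = of_real (inverse (sqrt a)) * cinner (A e) f" for f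
    by (simp add: v_def Cholesky_vec_def a_def cinner_cscale_left)
  have fv: "cinner f v = cnj (cinner v f)" for f by (rule cinner_commute)
  have self: "cinner (Cholesky_step A e f) f = of_real (Re (cinner (A f) f) - (cmod (cinner v f))\<^sup>2)" for f
    unfolding Cholesky_step_cinner v_def[symmetric] fv
    by (simp only: complex_norm_square mult.commute of_real_diff psd_cinner_self[OF A, of f, symmetric])
  \<comment> \<open>Cauchy-Schwarz for the form of \<open>A\<close> is precisely positivity of the
    remainder.\<close>
  have le: "(cmod (cinner v f))\<^sup>2 \<le> Re (cinner (A f) f)" for f
  proof (cases "a = 0")
    case True
    then show ?thesis using psd_Re_nonneg[OF A, of f] by (simp add: vf)
  next
    case False
    then have "a > 0" using a0 by simp
    have "(cmod (cinner v f))\<^sup>2 = (cmod (cinner (A e) f))\<^sup>2 / a"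
      using a0 by (simp add: vf norm_divide power_divide field_simps)
    also have "\<dots> \<le> Re (cinner (A f) f)"
      using psd_Cauchy_Schwarz[OF A, of e f] \<open>a > 0\<close> by (simp add: a_def field_simps)
    finally show ?thesis .
  qed
  show "psd (Cholesky_step A e)" unfolding psd_def
  proof (intro conjI allI)
    fix f g c
    show "Cholesky_step A e (f + g) = Cholesky_step A e f + Cholesky_step A e g"
      by (rule cinner_eqI) (simp add: Cholesky_step_cinner cinner_add_left add algebra_simps)
    show "Cholesky_step A e (cscale c f) = cscale c (Cholesky_step A e f)"
      by (rule cinner_eqI) (simp add: Cholesky_step_cinner cinner_cscale_left sc algebra_simps)
    show "cinner (Cholesky_step A e f) f \<in> \<real>\<^sub>\<ge>\<^sub>0"
      using le[of f] by (simp add: self complex_nonneg_Reals_iff)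
  qed
  show "Re (cinner (Cholesky_step A e f) f) \<le> Re (cinner (A f) f)" by (simp add: self)
  show "Cholesky_step A e g = 0" if "A g = 0"
  proof -
    have "cinner v g = 0" using psd_hermitian[OF A, of e g] that by (simp add: vf)
    then show ?thesis
      by (intro cinner_eqI) (simp add: Cholesky_step_cinner that v_def[symmetric] fv)
  qed
  show "Cholesky_step A e e = 0"
  proof (cases "a = 0")
    case True
    have "(cmod (cinner (A e) f))\<^sup>2 \<le> 0" for f
      using psd_Cauchy_Schwarz[OF A, of e f] True by (simp add: a_def)
    then show ?thesis by (intro cinner_eqI) (simp add: Cholesky_step_cinner v_def[symmetric] vf)
  next
    case False
    then have "a > 0" using a0 by simp
    have "cinner e v = of_real (sqrt a)"
    proof -
      have "cinner (A e) e = of_real a" unfolding a_def by (rule psd_cinner_self[OF A])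
      then have "cinner e v = of_real (a / sqrt a)" by (simp add: fv vf divide_inverse mult.commute)
      then show ?thesis using \<open>a > 0\<close> by (simp only: real_div_sqrt less_imp_le)
    qed
    then show ?thesis
      using \<open>a > 0\<close> by (intro cinner_eqI) (simp add: Cholesky_step_cinner v_def[symmetric] vf)
  qed
qed

text \<open>A Cholesky factorisation takes the place of the spectral theorem: a positive operator is a
  weakly convergent sum of rank-one operators, although its vectors need not be orthogonal.\<close>

lemma Cholesky_expansion:
  fixes A :: "'a::euclidean_space l2op"
  assumes A: "psd A" and bound: "\<And>f. Re (cinner (A f) f) \<le> M * (norm f)\<^sup>2" and E: "is_onb (E :: 'a l2 set)"
  obtains \<phi> :: "nat \<Rightarrow> 'a l2" where "\<And>f g. (\<lambda>j. cinner f (\<phi> j) * cinner (\<phi> j) g) sums cinner (A f) g"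
proof -
  have "countable E" by (rule countable_orthonormal[OF is_onb_orthonormal[OF E]])
  then obtain e :: "nat \<Rightarrow> 'a l2" where e: "E \<subseteq> range e"
    using subset_range_from_nat_into by blast
  define S where "S = rec_nat A (\<lambda>n B. Cholesky_step B (e n))"
  have S0: "S 0 = A" and SS: "S (Suc n) = Cholesky_step (S n) (e n)" for n by (auto simp: S_def)
  define \<phi> where "\<phi> n = Cholesky_vec (S n) (e n)" for n
  have psd: "psd (S n)" for n by (induction n) (auto simp: S0 SS A Cholesky_step_psd)
  have le: "Re (cinner (S n f) f) \<le> M * (norm f)\<^sup>2" for n f
  proof (induction n)
    case (Suc n)
    then show ?case using Cholesky_step_psd(2)[OF psd, of n "e n" f] by (simp add: SS)
  qed (simp add: S0 bound)
  \<comment> \<open>An eliminated vector stays in the kernel, because later steps annihilate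
    whatever is annihilated already.\<close>
  have kill: "S n (e m) = 0" if "m < n" for m n using that
  proof (induction n)
    case (Suc n)
    then show ?case
      using Cholesky_step_psd(3)[OF psd, of n "e n"] Cholesky_step_psd(4)[OF psd, of n "e m" "e n"]
      by (cases "m = n") (auto simp: SS)
  qed simp
  have partial: "(\<Sum>j<n. cinner f (\<phi> j) * cinner (\<phi> j) g) = cinner (A f) g - cinner (S n f) g" for n f g
    by (induction n) (auto simp: S0 SS Cholesky_step_cinner \<phi>_def)
  \<comment> \<open>A finite combination \<open>s\<close> of basis vectors approximates
    \<open>f\<close>. Once all of them are eliminated, the remainder has the same form value at
    \<open>f\<close> and at \<open>f - s\<close>; the forms never exceed the bound \<open>M\<close>,
    so this value is at most \<open>M\<close> times the squared error.\<close>
  have lim0: "(\<lambda>n. Re (cinner (S n f) f)) \<longlonglongrightarrow> 0" for f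
  proof (rule LIMSEQ_I)
    fix \<epsilon> :: real assume "\<epsilon> > 0"
    define \<delta> where "\<delta> = sqrt (\<epsilon> / (2 * (\<bar>M\<bar> + 1)))"
    have \<delta>: "\<delta> > 0" "2 * (\<bar>M\<bar> + 1) * \<delta>\<^sup>2 = \<epsilon>"
      using \<open>\<epsilon> > 0\<close> by (auto simp: \<delta>_def)
    have "\<forall>\<^sub>F F in finite_subsets_at_top E. dist (\<Sum>e\<in>F. cscale (cinner f e) e) f < \<delta>"
      using Fourier_expansion[OF E, of f] \<delta>(1) unfolding has_sum_def by (rule tendstoD)
    then obtain F where F: "finite F" "F \<subseteq> E" "dist (\<Sum>e\<in>F. cscale (cinner f e) e) f < \<delta>"
      by (auto simp: eventually_finite_subsets_at_top)
    define s where "s = (\<Sum>e\<in>F. cscale (cinner f e) e)"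
    obtain J where J: "finite J" "F = e ` J" 
      using finite_subset_image[OF F(1) order_trans[OF F(2) e]] by blast
    obtain N where N: "\<And>m. m \<in> J \<Longrightarrow> m < N"
      using J(1) finite_nat_set_iff_bounded by auto
    have "norm (Re (cinner (S n f) f) - 0) < \<epsilon>" if "n \<ge> N" for n
    proof -
      have add: "S n (f + g) = S n f + S n g" and sc: "S n (cscale c f) = cscale c (S n f)" for f g c
        using psd[of n] by (auto simp: psd_def)
      have z: "S n 0 = 0" using sc[of 0 0] by simp
      have "S n (\<Sum>e\<in>F. cscale (cinner f e) e) = 0" if "F \<subseteq> e ` J" for F
        using finite_subset[OF that finite_imageI[OF J(1)]] that
      proof (induction F rule: finite_induct)
        case (insert x F)
        then obtain m where "m \<in> J" "x = e m" by auto
        then have "S n x = 0" using kill[of m n] N[of m] \<open>n \<ge> N\<close> by simp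
        with insert show ?case by (simp add: add sc)
      qed (simp add: z)
      then have s0: "S n s = 0" unfolding s_def using J by simp
      have d: "f - s = f + cscale (-1) s" by (simp add: cscale_minus_one)
      have "Re (cinner (S n (f - s)) (f - s)) = Re (cinner (S n f) f) + 2 * Re (- cinner (S n f) s)"
        unfolding d psd_combine[OF psd] by (simp add: s0)
      moreover have "cinner (S n f) s = 0" using psd_hermitian[OF psd, of n s f] s0 by simp
      ultimately have "Re (cinner (S n f) f) = Re (cinner (S n (f - s)) (f - s))" by simp
      also have "\<dots> \<le> M * (norm (f - s))\<^sup>2" by (rule le)
      also have "\<dots> \<le> (\<bar>M\<bar> + 1) * (norm (f - s))\<^sup>2" by (intro mult_right_mono) auto
      also have "\<dots> \<le> (\<bar>M\<bar> + 1) * \<delta>\<^sup>2"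
        using F(3) by (intro mult_left_mono power_mono) (auto simp: s_def dist_norm norm_minus_commute)
      also have "\<dots> < \<epsilon>" using \<delta> \<open>\<epsilon> > 0\<close> by (simp add: algebra_simps)
      finally show ?thesis using psd_Re_nonneg[OF psd, of n f] by simp
    qed
    then show "\<exists>no. \<forall>n\<ge>no. norm (Re (cinner (S n f) f) - 0) < \<epsilon>" by blast
  qed
  have "(\<lambda>n. cinner (S n f) g) \<longlonglongrightarrow> 0" for f g
  proof -
    have "(\<lambda>n. (cmod (cinner (S n f) g))\<^sup>2) \<longlonglongrightarrow> 0"
    proof (rule Lim_null_comparison)
      show "(\<lambda>n. Re (cinner (S n f) f) * Re (cinner (S n g) g)) \<longlonglongrightarrow> 0"
        using tendsto_mult[OF lim0 lim0, of f g] by simp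
      show "\<forall>\<^sub>F n in sequentially. norm ((cmod (cinner (S n f) g))\<^sup>2) \<le> Re (cinner (S n f) f) * Re (cinner (S n g) g)"
        using psd_Cauchy_Schwarz[OF psd] by simp
    qed
    then have "(\<lambda>n. cmod (cinner (S n f) g)) \<longlonglongrightarrow> 0"
      using tendsto_real_sqrt by fastforce
    then show ?thesis by (rule tendsto_norm_zero_cancel)
  qed
  then have "(\<lambda>n. \<Sum>j<n. cinner f (\<phi> j) * cinner (\<phi> j) g) \<longlonglongrightarrow> cinner (A f) g" for f g
    unfolding partial using tendsto_diff[OF tendsto_const, of "\<lambda>n. cinner (S n f) g" 0 sequentially "cinner (A f) g"] by simp
  then show thesis by (intro that[of \<phi>]) (simp add: sums_def)
qed


section \<open>Density operators\<close>

lemma suminf_ennreal_sums: "f sums s \<Longrightarrow> (\<And>j. 0 \<le> f j) \<Longrightarrow> (\<Sum>j. ennreal (f j)) = ennreal s"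
  by (simp add: suminf_ennreal2 sums_iff)

text \<open>Turns an unconditional sum over a basis into an integral, so that exchanging it with
  series and with Lebesgue integrals becomes Tonelli's theorem.\<close>

lemma nn_integral_count_space_has_sum:
  fixes f :: "'i \<Rightarrow> real"
  assumes f: "(f has_sum s) A" and nn: "\<And>x. x \<in> A \<Longrightarrow> 0 \<le> f x"
  shows "(\<integral>\<^sup>+x. ennreal (f x) \<partial>count_space A) = ennreal s"
proof -
  have "f summable_on A" using f by (auto simp: summable_on_def)
  moreover have "((\<lambda>x. norm (f x)) summable_on A) = (f summable_on A)"
    using nn by (intro summable_on_cong) auto
  ultimately have "Infinite_Set_Sum.abs_summable_on f A" by (simp add: abs_summable_equivalent[symmetric])
  then show ?thesis
    using infsumI[OF f] by (subst nn_integral_conv_infsetsum) (auto simp: nn infsetsum_infsum)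
qed

lemma cmod_cinner_commute: "cmod (cinner f g) = cmod (cinner g f)"
  by (metis cinner_commute complex_mod_cnj)

lemma cinner_mult_commute: "cinner f g * cinner g f = of_real ((cmod (cinner f g))\<^sup>2)"
  by (subst (2) cinner_commute) (simp only: complex_norm_square)

lemma Parseval_nn_integral:
  assumes "is_onb E"
  shows "(\<integral>\<^sup>+e. ennreal ((cmod (cinner e f))\<^sup>2) \<partial>count_space E) = ennreal ((norm f)\<^sup>2)"
  by (subst cmod_cinner_commute) (rule nn_integral_count_space_has_sum[OF Parseval[OF assms]], simp)

lemma op_trace_rank_one:
  assumes "is_onb (SOME E :: 'a::euclidean_space l2 set. is_onb E)"
  shows "op_trace (\<lambda>f. cscale (cinner f v) u) = cinner u (v :: 'a l2)"
  unfolding op_trace_def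
  by (rule infsumI) (use Parseval_cinner[OF assms, of u v] in \<open>simp add: cinner_cscale_left mult.commute\<close>)

text \<open>\<open>S\<close> is seen as a mixture of the vectors \<open>\<phi> j\<close> with total
  weight one. Since \<open>op_trace\<close> selects its basis by a choice operator,
  \<open>onb\<close> records that the selected set really is a basis.\<close>

locale mixed_state =
  fixes S :: "'a::euclidean_space l2op" and \<phi> :: "nat \<Rightarrow> 'a l2"
  assumes expansion: "\<And>f g. (\<lambda>j. cinner f (\<phi> j) * cinner (\<phi> j) g) sums cinner (S f) g"
    and trace_one: "(\<lambda>j. (norm (\<phi> j))\<^sup>2) sums 1"
    and onb: "is_onb (SOME E :: 'a l2 set. is_onb E)"

text \<open>On the basis used by \<open>op_trace\<close>, Parseval's identity turns the trace into
  the sum of the squared norms of the Cholesky vectors; all terms are nonnegative, so the two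
  summations may be exchanged.\<close>

lemma density_operator_mixed_state:
  fixes S :: "'a::euclidean_space l2op"
  assumes S: "density_operator S"
  obtains \<phi> where "mixed_state S \<phi>"
proof -
  define E where "E = (SOME E :: 'a l2 set. is_onb E)"
  have pos: "positive_op S" and tc: "trace_class S" and tr: "op_trace S = 1"
    using S by (auto simp: density_operator_def)
  from tc have "\<exists>E :: 'a l2 set. is_onb E" by (auto simp: trace_class_def)
  then have E: "is_onb E" unfolding E_def by (rule someI_ex)
  have psd: "psd S" using pos by (rule positive_op_psd)
  have "bounded_linear S" using pos by (simp add: positive_op_def bounded_op_def)
  then obtain M where M: "\<And>f. norm (S f) \<le> norm f * M" by (metis bounded_linear.bounded)
  have "Re (cinner (S f) f) \<le> M * (norm f)\<^sup>2" for f
  proof -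
    have "Re (cinner (S f) f) \<le> norm (S f) * norm f"
      using complex_Re_le_cmod cinner_Cauchy_Schwarz by (rule order_trans)
    also have "\<dots> \<le> (norm f * M) * norm f" by (intro mult_right_mono M) simp
    finally show ?thesis by (simp add: power2_eq_square mult_ac)
  qed
  from Cholesky_expansion[OF psd this E] obtain \<phi> where
    \<phi>: "\<And>f g. (\<lambda>j. cinner f (\<phi> j) * cinner (\<phi> j) g) sums cinner (S f) g" by blast
  have inf: "infsum (\<lambda>e. cinner (S e) e) E = 1" using tr by (simp add: op_trace_def E_def)
  \<comment> \<open>A family that is not summable has the default sum 0, so the value 1 proves
    summability.\<close>
  then have "(\<lambda>e. cinner (S e) e) summable_on E" using infsum_not_exists by fastforce
  then have "((\<lambda>e. cinner (S e) e) has_sum 1) E" using inf by (metis has_sum_infsum)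
  then have "((\<lambda>e. Re (cinner (S e) e)) has_sum Re 1) E"
    by (rule has_sum_bounded_linear[OF bounded_linear_Re, unfolded o_def])
  then have "ennreal 1 = (\<integral>\<^sup>+e. ennreal (Re (cinner (S e) e)) \<partial>count_space E)"
    using psd_Re_nonneg[OF psd] by (subst nn_integral_count_space_has_sum) auto
  also have "\<dots> = (\<integral>\<^sup>+e. (\<Sum>j. ennreal ((cmod (cinner e (\<phi> j)))\<^sup>2)) \<partial>count_space E)"
  proof (intro nn_integral_cong)
    fix e
    have "(\<lambda>j. Re (cinner e (\<phi> j) * cinner (\<phi> j) e)) sums Re (cinner (S e) e)"
      by (rule sums_Re[OF \<phi>])
    then have "(\<lambda>j. (cmod (cinner e (\<phi> j)))\<^sup>2) sums Re (cinner (S e) e)"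
      by (simp only: cinner_mult_commute Re_complex_of_real)
    then show "ennreal (Re (cinner (S e) e)) = (\<Sum>j. ennreal ((cmod (cinner e (\<phi> j)))\<^sup>2))"
      by (subst suminf_ennreal_sums) auto
  qed
  also have "\<dots> = (\<Sum>j. \<integral>\<^sup>+e. ennreal ((cmod (cinner e (\<phi> j)))\<^sup>2) \<partial>count_space E)"
    by (rule nn_integral_suminf) simp
  also have "\<dots> = (\<Sum>j. ennreal ((norm (\<phi> j))\<^sup>2))"
    by (simp only: Parseval_nn_integral[OF E])
  finally have 1: "(\<Sum>j. ennreal ((norm (\<phi> j))\<^sup>2)) = ennreal 1" ..
  then have "summable (\<lambda>j. (norm (\<phi> j))\<^sup>2)" by (intro summable_suminf_not_top) auto
  moreover from this 1 have "suminf (\<lambda>j. (norm (\<phi> j))\<^sup>2) = 1"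
    by (subst (asm) suminf_ennreal2) (auto simp: suminf_nonneg)
  ultimately have "(\<lambda>j. (norm (\<phi> j))\<^sup>2) sums 1" by (simp add: sums_iff)
  with \<phi> E show thesis by (intro that[of \<phi>]) (unfold_locales, auto simp: E_def)
qed

section \<open>Phase-space densities of a vector in a mixed state\<close>

context mixed_state
begin

text \<open>A mixed-state spectrogram: each term is the squared modulus of a short-time Fourier
  transform of \<open>f\<close> with window \<open>\<phi> j\<close>. It is the diagonal matrix
  element of \<open>op_shift z S\<close> at \<open>f\<close>.\<close>

definition husimi :: "'a \<times> 'a \<Rightarrow> 'a l2 \<Rightarrow> real" where
  "husimi z f = (\<Sum>j. (cmod (cinner f (tf_shift z (\<phi> j))))\<^sup>2)"

lemma cinner_tf_le: "(cmod (cinner f (tf_shift z (\<phi> j))))\<^sup>2 \<le> (norm f)\<^sup>2 * (norm (\<phi> j))\<^sup>2"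
  using power_mono[OF cinner_Cauchy_Schwarz[of f "tf_shift z (\<phi> j)"], of 2]
  by (simp add: power_mult_distrib)

lemma husimi_sums: "(\<lambda>j. (cmod (cinner f (tf_shift z (\<phi> j))))\<^sup>2) sums husimi z f"
proof -
  have "summable (\<lambda>j. (norm f)\<^sup>2 * (norm (\<phi> j))\<^sup>2)"
    using trace_one by (intro summable_mult) (auto simp: sums_iff)
  then have "summable (\<lambda>j. (cmod (cinner f (tf_shift z (\<phi> j))))\<^sup>2)"
    by (rule summable_comparison_test'[where N = 0]) (simp add: cinner_tf_le)
  then show ?thesis by (simp add: husimi_def summable_sums)
qed

lemma husimi_nonneg: "0 \<le> husimi z f"
  unfolding husimi_def using husimi_sums[of f z] by (intro suminf_nonneg) (auto simp: sums_iff)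

lemma ennreal_husimi: "ennreal (husimi z f) = (\<Sum>j. ennreal ((cmod (cinner f (tf_shift z (\<phi> j))))\<^sup>2))"
  by (rule suminf_ennreal_sums[symmetric, OF husimi_sums]) simp

lemma borel_measurable_ennreal_husimi: "(\<lambda>z. ennreal (husimi z f)) \<in> borel_measurable borel"
  unfolding ennreal_husimi by measurable

lemma borel_measurable_husimi [measurable]: "(\<lambda>z. husimi z f) \<in> borel_measurable borel"
proof -
  have "(\<lambda>z. enn2real (ennreal (husimi z f))) \<in> borel_measurable borel"
    by (rule borel_measurable_enn2real[OF borel_measurable_ennreal_husimi])
  then show ?thesis by (simp add: husimi_nonneg)
qed

lemma nn_integral_husimi: "(\<integral>\<^sup>+z. ennreal (husimi z f) \<partial>lborel) = ennreal ((norm f)\<^sup>2)"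
proof -
  have "(\<integral>\<^sup>+z. ennreal (husimi z f) \<partial>lborel)
      = (\<Sum>j. \<integral>\<^sup>+z. ennreal ((cmod (cinner f (tf_shift z (\<phi> j))))\<^sup>2) \<partial>lborel)"
    unfolding ennreal_husimi by (rule nn_integral_suminf) measurable
  also have "\<dots> = (\<Sum>j. ennreal ((norm f)\<^sup>2 * (norm (\<phi> j))\<^sup>2))" by (simp only: Moyal)
  also have "\<dots> = ennreal ((norm f)\<^sup>2 * 1)"
    by (rule suminf_ennreal_sums[OF sums_mult[OF trace_one]]) simp
  finally show ?thesis by simp
qed

text \<open>Bessel's inequality for each vector \<open>tf_shift z (\<phi> j)\<close>, whose squared
  norms have sum one. This is the pointwise bound on the accumulated distribution.\<close>

lemma husimi_sum_le_1:
  assumes "orthonormal E" "finite F" "F \<subseteq> E"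
  shows "(\<Sum>e\<in>F. husimi z e) \<le> 1"
proof -
  have "(\<lambda>j. \<Sum>e\<in>F. (cmod (cinner e (tf_shift z (\<phi> j))))\<^sup>2) sums (\<Sum>e\<in>F. husimi z e)"
    by (rule sums_sum) (rule husimi_sums)
  then show ?thesis
  proof (rule sums_le[rotated, OF _ trace_one])
    show "(\<Sum>e\<in>F. (cmod (cinner e (tf_shift z (\<phi> j))))\<^sup>2) \<le> (norm (\<phi> j))\<^sup>2" for j
      using Bessel_finite[OF assms, of "tf_shift z (\<phi> j)"] by (subst cmod_cinner_commute) simp
  qed
qed

lemma husimi_onb:
  assumes "is_onb E"
  shows "(\<integral>\<^sup>+e. ennreal (husimi z e) \<partial>count_space E) = 1"
proof -
  have "(\<integral>\<^sup>+e. ennreal (husimi z e) \<partial>count_space E)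
      = (\<Sum>j. \<integral>\<^sup>+e. ennreal ((cmod (cinner e (tf_shift z (\<phi> j))))\<^sup>2) \<partial>count_space E)"
    unfolding ennreal_husimi by (rule nn_integral_suminf) simp
  also have "\<dots> = (\<Sum>j. ennreal ((norm (\<phi> j))\<^sup>2))"
    by (simp only: Parseval_nn_integral[OF assms] norm_tf_shift)
  also have "\<dots> = ennreal 1" by (rule suminf_ennreal_sums[OF trace_one]) simp
  finally show ?thesis by simp
qed

lemma cinner_op_shift:
  "(\<lambda>j. cinner f (tf_shift z (\<phi> j)) * cinner (tf_shift z (\<phi> j)) g) sums cinner (op_shift z S f) g"
proof -
  have 1: "cinner (adj (tf_shift z) f) h = cinner f (tf_shift z h)" for f h
    by (metis cinner_adj_tf_shift cinner_commute)
  show ?thesis using expansion[of "adj (tf_shift z) f" "adj (tf_shift z) g"]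
    by (simp add: op_shift_def cinner_adj_tf_shift 1)
qed

lemma cinner_op_shift_self: "cinner (op_shift z S f) f = of_real (husimi z f)"
proof (rule sums_unique2[OF cinner_op_shift])
  show "(\<lambda>j. cinner f (tf_shift z (\<phi> j)) * cinner (tf_shift z (\<phi> j)) f) sums of_real (husimi z f)"
    unfolding cinner_mult_commute by (rule sums_of_real[OF husimi_sums])
qed

text \<open>The trace against a rank-one operator is a single matrix element. The reflections in
  \<open>op_check\<close> turn the shift by \<open>z\<close> into the shift by the opposite point,
  which agrees with the adjoint up to a phase that a quadratic form does not see.\<close>

lemma Cohen_eq_husimi: "Cohen S f z = of_real (husimi z f)"
proof -
  obtain x w where z: "z = (x, w)" by (cases z)
  define g where "g = tf_shift z (parity f)"
  have 1: "cinner (adj (tf_shift z) f) h = cinner f (tf_shift z h)" for f h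
    by (metis cinner_adj_tf_shift cinner_commute)
  have op: "op_check S \<circ> op_shift z (op_check (rank_one f f)) = (\<lambda>e. cscale (cinner e g) (op_check S g))"
  proof
    fix e
    \<comment> \<open>The locale describes \<open>S\<close> by its expansion alone, so homogeneity
      is read off from there.\<close>
    have lin: "S (cscale c h) = cscale c (S h)" for c h
      by (rule cinner_eqI, rule sums_unique2[OF expansion])
         (simp add: cinner_cscale_left mult.assoc sums_mult[OF expansion])
    have "cinner (parity (adj (tf_shift z) e)) f = cinner e g" by (simp add: cinner_parity 1 g_def)
    then show "(op_check S \<circ> op_shift z (op_check (rank_one f f))) e = cscale (cinner e g) (op_check S g)"
      by (simp add: op_check_def op_shift_def rank_one_def parity_cscale tf_shift_cscale lin g_def)
  qed
  have "Cohen S f z = cinner (op_check S g) g"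
    unfolding Cohen_def op_op_conv_def op by (rule op_trace_rank_one[OF onb])
  also have "\<dots> = cinner (S (parity g)) (parity g)" by (simp add: op_check_def cinner_parity)
  also have "parity g = tf_shift (- x, - w) f" by (simp add: g_def z parity_tf_shift_parity)
  also have "tf_shift (- x, - w) f = cscale (cis (2 * pi * (w \<bullet> x))) (adj (tf_shift z) f)"
    by (simp add: z adj_tf_shift cis_mult)
  also have "cinner (S (cscale c h)) (cscale c h) = (cmod c)\<^sup>2 * cinner (S h) h" for c h
  proof (rule sums_unique2[OF expansion])
    have "(\<lambda>j. c * cnj c * (cinner h (\<phi> j) * cinner (\<phi> j) h)) sums (c * cnj c * cinner (S h) h)"
      by (rule sums_mult[OF expansion])
    then show "(\<lambda>j. cinner (cscale c h) (\<phi> j) * cinner (\<phi> j) (cscale c h)) sums ((cmod c)\<^sup>2 * cinner (S h) h)"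
      unfolding complex_norm_square by (simp add: cinner_cscale_left cinner_cscale_right mult_ac)
  qed
  also have "cinner (S (adj (tf_shift z) f)) (adj (tf_shift z) f) = cinner (op_shift z S f) f"
    by (simp add: op_shift_def cinner_adj_tf_shift)
  finally show ?thesis by (simp add: cinner_op_shift_self)
qed

section \<open>Localization operators as bounded forms\<close>

lemma borel_measurable_cinner_op_shift [measurable]:
  "(\<lambda>z. cinner (op_shift z S f) g) \<in> borel_measurable borel"
proof (rule borel_measurable_LIMSEQ_metric)
  show "(\<lambda>n. \<Sum>j<n. cinner f (tf_shift z (\<phi> j)) * cinner (tf_shift z (\<phi> j)) g) \<longlonglongrightarrow> cinner (op_shift z S f) g" for z
    using cinner_op_shift[of f z g] by (simp add: sums_def)
  show "(\<lambda>z. \<Sum>j<n. cinner f (tf_shift z (\<phi> j)) * cinner (tf_shift z (\<phi> j)) g) \<in> borel_measurable borel" for n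
  proof -
    have "(\<lambda>z. cnj (cinner g (tf_shift z (\<phi> j)))) \<in> borel_measurable borel" for j by measurable
    then have [measurable]: "(\<lambda>z. cinner (tf_shift z (\<phi> j)) g) \<in> borel_measurable borel" for j
      by (subst cinner_commute)
    show ?thesis by measurable
  qed
qed

lemma cmod_cinner_op_shift_le: "cmod (cinner (op_shift z S f) g) \<le> norm f * norm g"
proof -
  have le: "cmod (cinner f (tf_shift z (\<phi> j)) * cinner (tf_shift z (\<phi> j)) g) \<le> (norm f * norm g) * (norm (\<phi> j))\<^sup>2" for j
    using mult_mono[OF cinner_Cauchy_Schwarz[of f "tf_shift z (\<phi> j)"] cinner_Cauchy_Schwarz[of "tf_shift z (\<phi> j)" g]]
    by (simp add: norm_mult power2_eq_square mult_ac)
  have s: "(\<lambda>j. (norm f * norm g) * (norm (\<phi> j))\<^sup>2) sums (norm f * norm g * 1)"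
    by (rule sums_mult[OF trace_one])
  have "norm (\<Sum>j. cinner f (tf_shift z (\<phi> j)) * cinner (tf_shift z (\<phi> j)) g) \<le> (\<Sum>j. (norm f * norm g) * (norm (\<phi> j))\<^sup>2)"
    by (rule norm_suminf_le[OF le]) (use s in \<open>simp add: sums_iff\<close>)
  then show ?thesis using s cinner_op_shift[of f z g] by (simp add: sums_iff)
qed

lemma cinner_op_shift_add: "cinner (op_shift z S (f + g)) h = cinner (op_shift z S f) h + cinner (op_shift z S g) h"
  by (rule sums_unique2[OF cinner_op_shift])
     (simp add: cinner_add_left distrib_right sums_add[OF cinner_op_shift cinner_op_shift])

lemma cinner_op_shift_cscale: "cinner (op_shift z S (cscale c f)) h = c * cinner (op_shift z S f) h"
  by (rule sums_unique2[OF cinner_op_shift])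
     (simp add: cinner_cscale_left mult.assoc sums_mult[OF cinner_op_shift])

text \<open>The matrix elements of \<open>op_shift z S\<close> are bounded by the product of the
  norms, uniformly in \<open>z\<close>, and \<open>\<Omega>\<close> has finite measure; so the
  integral is a bounded form and the definite description is resolved.\<close>

lemma fun_op_conv_indicator:
  assumes [measurable]: "\<Omega> \<in> sets borel" and fin: "emeasure lborel \<Omega> < \<infinity>"
  shows "cinner (fun_op_conv (indicator \<Omega>) S f) g
    = (\<integral>z. indicator \<Omega> z * cinner (op_shift z S f) g \<partial>lborel)"
proof -
  define b where "b f g = (\<integral>z. indicator \<Omega> z * cinner (op_shift z S f) g \<partial>lborel)" for f g
  have i\<Omega>: "integrable lborel (indicat_real \<Omega>)" using fin by simp
  have int: "integrable lborel (\<lambda>z. indicator \<Omega> z * cinner (op_shift z S f) g)" for f g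
  proof (rule Bochner_Integration.integrable_bound)
    show "integrable lborel (\<lambda>z. indicat_real \<Omega> z * (norm f * norm g))" using i\<Omega> by simp
    show "AE z in lborel. norm (indicator \<Omega> z * cinner (op_shift z S f) g) \<le> norm (indicat_real \<Omega> z * (norm f * norm g))"
      using cmod_cinner_op_shift_le by (auto intro!: AE_I2 split: split_indicator)
  qed measurable
  have "\<exists>!T. bounded_op T \<and> (\<forall>f g. cinner (T f) g = b f g)"
  proof (rule bounded_op_of_form[OF onb, where M = "measure lborel \<Omega>"])
    fix f g h c
    show "b (f + g) h = b f h + b g h" "b h (f + g) = b h f + b h g" unfolding b_def using int
      by (simp_all add: cinner_op_shift_add cinner_add_right distrib_left)
    show "b (cscale c f) h = c * b f h" "b h (cscale c f) = cnj c * b h f" unfolding b_def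
      by (simp_all add: cinner_op_shift_cscale cinner_cscale_right mult.left_commute)
    show "cmod (b f g) \<le> measure lborel \<Omega> * norm f * norm g"
    proof -
      have "cmod (b f g) \<le> (\<integral>z. norm (indicator \<Omega> z * cinner (op_shift z S f) g) \<partial>lborel)"
        unfolding b_def by (rule integral_norm_bound)
      also have "\<dots> \<le> (\<integral>z. indicat_real \<Omega> z * (norm f * norm g) \<partial>lborel)"
        using cmod_cinner_op_shift_le i\<Omega>
        by (intro Bochner_Integration.integral_mono integrable_norm int) (auto split: split_indicator)
      also have "\<dots> = measure lborel \<Omega> * norm f * norm g" by simp
      finally show ?thesis .
    qed
  qed
  from theI'[OF this] show ?thesis
    unfolding fun_op_conv_def b_def by blast
qed

lemma fun_op_conv_indicator_self:
  assumes [measurable]: "\<Omega> \<in> sets borel" and fin: "emeasure lborel \<Omega> < \<infinity>"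
  shows "ennreal (Re (cinner (fun_op_conv (indicator \<Omega>) S f) f)) = (\<integral>\<^sup>+z\<in>\<Omega>. ennreal (husimi z f) \<partial>lborel)"
    "0 \<le> Re (cinner (fun_op_conv (indicator \<Omega>) S f) f)"
proof -
  have eq: "(\<integral>\<^sup>+z\<in>\<Omega>. ennreal (husimi z f) \<partial>lborel) = (\<integral>\<^sup>+z. ennreal (indicator \<Omega> z * husimi z f) \<partial>lborel)"
    by (intro nn_integral_cong) (auto split: split_indicator)
  have "(\<integral>\<^sup>+z. ennreal (indicator \<Omega> z * husimi z f) \<partial>lborel) \<le> (\<integral>\<^sup>+z. ennreal (husimi z f) \<partial>lborel)"
    using husimi_nonneg by (intro nn_integral_mono) (auto split: split_indicator)
  also have "\<dots> < \<infinity>" by (simp add: nn_integral_husimi)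
  finally have int: "integrable lborel (\<lambda>z. indicator \<Omega> z * husimi z f)"
    using husimi_nonneg by (intro integrableI_nonneg) auto
  have "cinner (fun_op_conv (indicator \<Omega>) S f) f = (\<integral>z. of_real (indicator \<Omega> z * husimi z f) \<partial>lborel)"
    unfolding fun_op_conv_indicator[OF assms] cinner_op_shift_self
    by (intro Bochner_Integration.integral_cong) (auto split: split_indicator)
  also have "\<dots> = of_real (\<integral>z. indicator \<Omega> z * husimi z f \<partial>lborel)" by (rule integral_complex_of_real)
  finally have *: "Re (cinner (fun_op_conv (indicator \<Omega>) S f) f) = (\<integral>z. indicator \<Omega> z * husimi z f \<partial>lborel)"
    by simp
  show "ennreal (Re (cinner (fun_op_conv (indicator \<Omega>) S f) f)) = (\<integral>\<^sup>+z\<in>\<Omega>. ennreal (husimi z f) \<partial>lborel)"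
    unfolding * eq using husimi_nonneg by (intro nn_integral_eq_integral[symmetric] int) auto
  show "0 \<le> Re (cinner (fun_op_conv (indicator \<Omega>) S f) f)"
    unfolding * using husimi_nonneg by (intro integral_nonneg_AE) auto
qed

end


section \<open>Eigenvalues of mixed-state localization operators\<close>

lemma sums_infsum:
  fixes f :: "nat \<Rightarrow> 'b::banach"
  assumes "f sums s" "summable (\<lambda>n. norm (f n))"
  shows "infsum f UNIV = s"
  by (rule infsumI[OF norm_summable_imp_has_sum[OF assms(2,1)]])

lemma suminf_swap_ennreal:
  fixes f :: "nat \<Rightarrow> nat \<Rightarrow> ennreal"
  shows "(\<Sum>i. \<Sum>j. f i j) = (\<Sum>j. \<Sum>i. f i j)"
  using nn_integral_suminf[of "\<lambda>i j. f i j" "count_space UNIV"]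
  by (simp add: nn_integral_count_space_nat)

section \<open>The correlation function of a state\<close>

context mixed_state
begin

text \<open>This is \<open>op_tilde S\<close>, written as a series of extended reals so that
  Tonelli's theorem applies without a summability argument; \<open>corr_eq_op_tilde\<close> proves
  the identification.\<close>

definition corr :: "'a \<times> 'a \<Rightarrow> ennreal" where
  "corr z = (\<Sum>i. ennreal (husimi z (\<phi> i)))"

lemma borel_measurable_corr [measurable]: "corr \<in> borel_measurable borel"
  unfolding corr_def[abs_def] by measurable

lemma nn_integral_corr: "(\<integral>\<^sup>+z. corr z \<partial>lborel) = 1"
proof -
  have "(\<integral>\<^sup>+z. corr z \<partial>lborel) = (\<Sum>i. \<integral>\<^sup>+z. ennreal (husimi z (\<phi> i)) \<partial>lborel)"
    unfolding corr_def by (rule nn_integral_suminf) measurable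
  also have "\<dots> = ennreal 1"
    unfolding nn_integral_husimi by (rule suminf_ennreal_sums[OF trace_one]) simp
  finally show ?thesis by simp
qed

lemma suminf_husimi_tf_shift: "(\<Sum>j. ennreal (husimi w (tf_shift z (\<phi> j)))) = corr (w - z)"
  unfolding corr_def ennreal_husimi cmod_cinner_tf_shift ..

lemma summable_norm_pairs:
  "(\<lambda>(i, j). (norm (\<phi> i))\<^sup>2 * (norm (\<phi> j))\<^sup>2) summable_on UNIV \<times> UNIV"
proof -
  have a: "((\<lambda>j. (norm (\<phi> j))\<^sup>2) has_sum 1) UNIV"
    using trace_one by (intro norm_summable_imp_has_sum) (auto simp: sums_iff)
  have "Infinite_Sum.abs_summable_on (\<lambda>(i, j). (norm (\<phi> i))\<^sup>2 * (norm (\<phi> j))\<^sup>2) (UNIV \<times> UNIV)"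
  proof (rule Infinite_Sum.abs_summable_on_Sigma_iff[THEN iffD2], intro conjI ballI)
    fix i
    show "(\<lambda>j. norm (case (i, j) of (i, j) \<Rightarrow> (norm (\<phi> i))\<^sup>2 * (norm (\<phi> j))\<^sup>2)) summable_on UNIV"
      using has_sum_imp_summable[OF a] by (auto simp: abs_mult intro!: summable_on_cmult_right)
  next
    have "infsum (\<lambda>j. norm (case (i, j) of (i, j) \<Rightarrow> (norm (\<phi> i))\<^sup>2 * (norm (\<phi> j))\<^sup>2)) UNIV = (norm (\<phi> i))\<^sup>2" for i
      using infsumI[OF a] by (simp add: abs_mult infsum_cmult_right')
    then show "(\<lambda>i. norm (infsum (\<lambda>j. norm (case (i, j) of (i, j) \<Rightarrow> (norm (\<phi> i))\<^sup>2 * (norm (\<phi> j))\<^sup>2)) UNIV)) summable_on UNIV"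
      using has_sum_imp_summable[OF a] by simp
  qed
  then show ?thesis by (rule abs_summable_summable)
qed

text \<open>The trace of the product is a sum over the basis of a double series in (i, j) with
  complex terms. The family over pairs and basis vectors is absolutely summable, so the basis may be
  summed first; Parseval's identity then leaves the squared moduli that make up
  \<open>corr\<close>.\<close>

lemma corr_eq_op_tilde: "corr z = ennreal (Re (op_tilde S z))"
proof -
  define E where "E = (SOME E :: 'a l2 set. is_onb E)"
  have E: "is_onb E" unfolding E_def by (rule onb)
  have on: "orthonormal E" using E by (rule is_onb_orthonormal)
  define F where "F j = tf_shift z (\<phi> j)" for j
  have nF: "norm (F j) = norm (\<phi> j)" for j by (simp add: F_def)
  define G where "G p e = cinner e (F (snd p)) * cinner (F (snd p)) (\<phi> (fst p)) * cinner (\<phi> (fst p)) e" for p e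
  define K where "K p = (cmod (cinner (\<phi> (fst p)) (F (snd p))))\<^sup>2" for p
  define a where "a p = (norm (\<phi> (fst p)))\<^sup>2 * (norm (\<phi> (snd p)))\<^sup>2" for p
  have a: "a summable_on UNIV"
    using summable_norm_pairs by (simp add: a_def[abs_def] case_prod_unfold)
  have a0: "a p \<ge> 0" for p by (simp add: a_def)
  have G_le: "norm (G p e) \<le> a p * (norm e)\<^sup>2" for p e
  proof -
    have "norm (G p e) \<le> (norm e * norm (F (snd p))) * (norm (F (snd p)) * norm (\<phi> (fst p))) * (norm (\<phi> (fst p)) * norm e)"
      unfolding G_def norm_mult by (intro mult_mono cinner_Cauchy_Schwarz mult_nonneg_nonneg) auto
    then show ?thesis by (simp add: a_def nF power2_eq_square mult_ac)
  qed
  \<comment> \<open>Cauchy-Schwarz over \<open>H\<close>, then Bessel's inequality for each factor.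
    The majorant \<open>a p\<close> does not depend on \<open>H\<close> and is summable over
    pairs.\<close>
  have G_sum: "(\<Sum>e\<in>H. norm (G p e)) \<le> a p" if H: "finite H" "H \<subseteq> E" for H p
  proof -
    have "(\<Sum>e\<in>H. norm (G p e))
        = cmod (cinner (F (snd p)) (\<phi> (fst p))) * (\<Sum>e\<in>H. cmod (cinner (F (snd p)) e) * cmod (cinner (\<phi> (fst p)) e))"
      unfolding G_def norm_mult sum_distrib_left
    proof (intro sum.cong refl)
      fix e
      have "cmod (cinner e (F (snd p))) = cmod (cinner (F (snd p)) e)" by (rule cmod_cinner_commute)
      then show "cmod (cinner e (F (snd p))) * cmod (cinner (F (snd p)) (\<phi> (fst p))) * cmod (cinner (\<phi> (fst p)) e)
          = cmod (cinner (F (snd p)) (\<phi> (fst p))) * (cmod (cinner (F (snd p)) e) * cmod (cinner (\<phi> (fst p)) e))"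
        by simp
    qed
    also have "\<dots> \<le> (norm (F (snd p)) * norm (\<phi> (fst p))) * (norm (F (snd p)) * norm (\<phi> (fst p)))"
    proof (intro mult_mono cinner_Cauchy_Schwarz)
      have "(\<Sum>e\<in>H. cmod (cinner (F (snd p)) e) * cmod (cinner (\<phi> (fst p)) e))\<^sup>2
          \<le> (\<Sum>e\<in>H. (cmod (cinner (F (snd p)) e))\<^sup>2) * (\<Sum>e\<in>H. (cmod (cinner (\<phi> (fst p)) e))\<^sup>2)"
        by (rule Cauchy_Schwarz_ineq_sum)
      also have "\<dots> \<le> (norm (F (snd p)))\<^sup>2 * (norm (\<phi> (fst p)))\<^sup>2"
        by (intro mult_mono Bessel_finite[OF on H]) (auto intro: sum_nonneg)
      also have "\<dots> = (norm (F (snd p)) * norm (\<phi> (fst p)))\<^sup>2" by (rule power_mult_distrib[symmetric])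
      finally show "(\<Sum>e\<in>H. cmod (cinner (F (snd p)) e) * cmod (cinner (\<phi> (fst p)) e)) \<le> norm (F (snd p)) * norm (\<phi> (fst p))"
        by (rule power2_le_imp_le) simp
    qed (simp_all add: sum_nonneg)
    also have "\<dots> = a p" by (simp add: a_def nF power2_eq_square)
    finally show ?thesis .
  qed
  have G_summable_e: "(\<lambda>e. norm (G p e)) summable_on E" for p
    by (rule nonneg_bdd_above_summable_on) (auto intro!: bdd_aboveI2[where M = "a p"] G_sum)
  have "Infinite_Sum.abs_summable_on (\<lambda>(p, e). G p e) (UNIV \<times> E)"
  proof (rule Infinite_Sum.abs_summable_on_Sigma_iff[THEN iffD2], intro conjI ballI)
    show "(\<lambda>e. norm (case (p, e) of (p, e) \<Rightarrow> G p e)) summable_on E" for p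
      using G_summable_e by simp
    have "infsum (\<lambda>e. norm (G p e)) E \<le> a p" for p
      by (rule infsum_le_finite_sums[OF G_summable_e]) (rule G_sum)
    then show "(\<lambda>p. norm (infsum (\<lambda>e. norm (case (p, e) of (p, e) \<Rightarrow> G p e)) E)) summable_on UNIV"
      by (intro summable_on_comparison_test[OF a]) (auto simp: infsum_nonneg)
  qed
  then have "(\<lambda>(p, e). G p e) summable_on UNIV \<times> E" by (rule abs_summable_summable)
  then have swap: "infsum (\<lambda>p. infsum (\<lambda>e. G p e) E) UNIV = infsum (\<lambda>e. infsum (\<lambda>p. G p e) UNIV) E"
    by (rule infsum_swap_banach)
  have inner_e: "infsum (\<lambda>e. G p e) E = of_real (K p)" for p
  proof (rule infsumI)
    have "((\<lambda>e. cinner (F (snd p)) (\<phi> (fst p)) * (cinner (\<phi> (fst p)) e * cinner e (F (snd p))))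
        has_sum cinner (F (snd p)) (\<phi> (fst p)) * cinner (\<phi> (fst p)) (F (snd p))) E"
      by (intro has_sum_cmult_right Parseval_cinner[OF E])
    then show "((\<lambda>e. G p e) has_sum of_real (K p)) E"
      unfolding cinner_mult_commute by (simp add: G_def K_def mult_ac cmod_cinner_commute)
  qed
  have suma: "summable (\<lambda>j. (norm (\<phi> j))\<^sup>2 * c)" for c
    using trace_one by (intro summable_mult2) (auto simp: sums_iff)
  have inner_p: "infsum (\<lambda>p. G p e) UNIV = cinner (S (op_shift z S e)) e" for e
  proof -
    have "Infinite_Sum.abs_summable_on (\<lambda>p. G p e) UNIV"
      by (rule summable_on_comparison_test[OF summable_on_cmult_left[OF a, of "(norm e)\<^sup>2"]])
         (auto simp: G_le)
    then have "(\<lambda>(i, j). G (i, j) e) summable_on Sigma UNIV (\<lambda>_. UNIV)"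
      by (simp add: abs_summable_summable)
    then have "infsum (\<lambda>i. infsum (\<lambda>j. G (i, j) e) UNIV) UNIV = infsum (\<lambda>(i, j). G (i, j) e) (Sigma UNIV (\<lambda>_. UNIV))"
      by (rule infsum_Sigma'_banach)
    moreover have "infsum (\<lambda>j. G (i, j) e) UNIV = cinner (op_shift z S e) (\<phi> i) * cinner (\<phi> i) e" for i
    proof (rule sums_infsum)
      show "(\<lambda>j. G (i, j) e) sums (cinner (op_shift z S e) (\<phi> i) * cinner (\<phi> i) e)"
        unfolding G_def F_def fst_conv snd_conv by (intro sums_mult2 cinner_op_shift)
      show "summable (\<lambda>j. norm (G (i, j) e))"
        by (rule summable_comparison_test'[OF suma[of "(norm (\<phi> i))\<^sup>2 * (norm e)\<^sup>2"], of 0])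
           (use G_le[of "(i, _)" e] in \<open>simp add: a_def mult_ac\<close>)
    qed
    moreover have "infsum (\<lambda>i. cinner (op_shift z S e) (\<phi> i) * cinner (\<phi> i) e) UNIV = cinner (S (op_shift z S e)) e"
    proof (rule sums_infsum[OF expansion])
      have "norm (cinner (op_shift z S e) (\<phi> i) * cinner (\<phi> i) e) \<le> (norm (\<phi> i))\<^sup>2 * (norm (op_shift z S e) * norm e)" for i
        using mult_mono[OF cinner_Cauchy_Schwarz[of "op_shift z S e" "\<phi> i"] cinner_Cauchy_Schwarz[of "\<phi> i" e]]
        by (simp add: norm_mult power2_eq_square mult_ac)
      then show "summable (\<lambda>i. norm (cinner (op_shift z S e) (\<phi> i) * cinner (\<phi> i) e))"
        by (intro summable_comparison_test'[OF suma[of "norm (op_shift z S e) * norm e"], of 0]) simp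
    qed
    ultimately show ?thesis by (simp add: case_prod_unfold)
  qed
  have K_le: "K p \<le> a p" for p
    using cinner_tf_le[of "\<phi> (fst p)" z "snd p"] by (simp add: K_def F_def a_def)
  have Ks: "K summable_on UNIV"
    by (rule summable_on_comparison_test[OF a]) (use K_le in \<open>auto simp: K_def\<close>)
  \<comment> \<open>The reflection in \<open>op_tilde\<close> cancels the one built into
    \<open>op_op_conv\<close>.\<close>
  have "op_check (op_check S) = S" by (simp add: op_check_def fun_eq_iff)
  then have "op_tilde S z = infsum (\<lambda>e. cinner (S (op_shift z S e)) e) E"
    by (simp add: op_tilde_def op_op_conv_def op_trace_def E_def)
  also have "\<dots> = infsum (\<lambda>p. complex_of_real (K p)) UNIV"
    using swap by (simp only: inner_e inner_p)
  also have "\<dots> = of_real (infsum K UNIV)"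
    by (rule infsumI[OF has_sum_of_real[OF has_sum_infsum[OF Ks]]])
  finally have tilde: "op_tilde S z = of_real (infsum K UNIV)" .
  from Ks have "(\<lambda>(i, j). K (i, j)) summable_on Sigma UNIV (\<lambda>_. UNIV)" by simp
  then have 1: "infsum (\<lambda>i. infsum (\<lambda>j. K (i, j)) UNIV) UNIV = infsum (\<lambda>(i, j). K (i, j)) (Sigma UNIV (\<lambda>_. UNIV))"
    and 2: "(\<lambda>i. infsum (\<lambda>j. K (i, j)) UNIV) summable_on UNIV"
    by (rule infsum_Sigma'_banach, rule summable_on_Sigma_banach)
  have 3: "infsum (\<lambda>j. K (i, j)) UNIV = husimi z (\<phi> i)" for i
    by (rule sums_infsum) (use husimi_sums[of "\<phi> i" z] in \<open>auto simp: K_def F_def sums_iff\<close>)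
  have "((\<lambda>i. husimi z (\<phi> i)) has_sum infsum K UNIV) UNIV"
    using 1 has_sum_infsum[OF 2] by (simp add: 3 case_prod_unfold)
  then have "(\<lambda>i. husimi z (\<phi> i)) sums infsum K UNIV" by (rule has_sum_imp_sums)
  then have "corr z = ennreal (infsum K UNIV)"
    unfolding corr_def by (rule suminf_ennreal_sums) (rule husimi_nonneg)
  then show ?thesis by (simp add: tilde)
qed

lemma Mop_norm_sq_eq: "Mop_norm_sq S = (\<integral>\<^sup>+z. corr z * ennreal (norm z) \<partial>lborel)"
  unfolding Mop_norm_sq_def corr_eq_op_tilde by (simp add: ennreal_mult'')

end

text \<open>Put \<mu> = \<open>eig A\<close>, the first eigenvalue past the block since indices
  start at 0. The defect \<open>\<Lambda> - q\<close> dominates \<mu> times the gap \<open>U\<close>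
  of the block plus 1 - \<mu> times the tail sum, and the tail sum is at least \<open>U - 1\<close>
  because rounding up costs at most 1. The two weights add up to 1, which leaves
  \<open>U - 1 + \<mu>\<close>.\<close>

lemma sum_one_minus_eigenvalues_le:
  fixes eig :: "nat \<Rightarrow> real"
  assumes dec: "decseq eig" and b: "\<And>k. 0 \<le> eig k" "\<And>k. eig k \<le> 1"
    and s1: "eig sums \<Lambda>" and s2: "(\<lambda>k. (eig k)\<^sup>2) sums q" and A: "real A \<le> \<Lambda> + 1"
  shows "(\<Sum>k<A. 1 - eig k) \<le> 1 + (\<Lambda> - q)"
proof -
  define \<mu> where "\<mu> = eig A"
  define U where "U = (\<Sum>k<A. 1 - eig k)"
  have \<mu>: "0 \<le> \<mu>" "\<mu> \<le> 1" using b by (auto simp: \<mu>_def)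
  have d: "(\<lambda>k. eig k * (1 - eig k)) sums (\<Lambda> - q)"
    using sums_diff[OF s1 s2] by (simp add: algebra_simps power2_eq_square)
  have tail1: "(\<lambda>k. eig (k + A)) sums (\<Lambda> - (\<Sum>k<A. eig k))"
    using sums_split_initial_segment[OF s1, of A] .
  have tail2: "(\<lambda>k. eig (k + A) * (1 - eig (k + A))) sums (\<Lambda> - q - (\<Sum>k<A. eig k * (1 - eig k)))"
    using sums_split_initial_segment[OF d, of A] .
  have "(1 - \<mu>) * (\<Lambda> - (\<Sum>k<A. eig k)) \<le> \<Lambda> - q - (\<Sum>k<A. eig k * (1 - eig k))"
  proof (rule sums_le[OF _ sums_mult[OF tail1] tail2])
    show "(1 - \<mu>) * eig (k + A) \<le> eig (k + A) * (1 - eig (k + A))" for k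
      using decseqD[OF dec, of A "k + A"] b(1)[of "k + A"]
      by (subst mult.commute) (auto intro!: mult_left_mono simp: \<mu>_def)
  qed
  moreover have "\<mu> * U \<le> (\<Sum>k<A. eig k * (1 - eig k))" unfolding U_def sum_distrib_left
    using decseqD[OF dec, of _ A] b(2) by (intro sum_mono mult_right_mono) (auto simp: \<mu>_def)
  moreover have "(1 - \<mu>) * (U - 1) \<le> (1 - \<mu>) * (\<Lambda> - (\<Sum>k<A. eig k))"
    using A \<mu> by (intro mult_left_mono) (auto simp: U_def sum_subtractf)
  ultimately have "\<mu> * U + (1 - \<mu>) * (U - 1) \<le> \<Lambda> - q" by linarith
  then have "U - 1 + \<mu> \<le> \<Lambda> - q" by (simp add: algebra_simps)
  then show ?thesis using \<mu> by (simp add: U_def)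
qed

section \<open>Spectral estimates for one domain\<close>

context mixed_state
begin

context
  fixes \<Omega> :: "('a \<times> 'a) set" and eig :: "nat \<Rightarrow> real" and h :: "nat \<Rightarrow> 'a l2"
  assumes \<Omega>: "compact \<Omega>"
    and spec: "spectral_decomposition (fun_op_conv (indicator \<Omega>) S) eig h"
begin

lemma \<Omega>_borel [measurable]: "\<Omega> \<in> sets borel"
  using \<Omega> by (rule borel_compact)

lemma \<Omega>_finite: "emeasure lborel \<Omega> < \<infinity>"
  using \<Omega> by (rule emeasure_compact_finite)

lemma cinner_h: "cinner (h j) (h k) = (if j = k then 1 else 0)"
  using spec by (simp add: spectral_decomposition_def)

lemma inj_h: "inj h"
proof (rule injI)
  fix j k assume "h j = h k"
  then show "j = k" using cinner_h[of j j] cinner_h[of j k] by (auto split: if_splits)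
qed

lemma orthonormal_h: "orthonormal (range h)"
  using inj_h by (auto simp: orthonormal_def cinner_h inj_eq)

lemma norm_h: "norm (h k) = 1"
  by (rule orthonormal_norm[OF orthonormal_h]) simp

lemma ennreal_eig: "ennreal (eig k) = (\<integral>\<^sup>+z\<in>\<Omega>. ennreal (husimi z (h k)) \<partial>lborel)" and eig_nonneg: "0 \<le> eig k"
proof -
  have "fun_op_conv (indicator \<Omega>) S (h k) = eig k *\<^sub>R h k"
    using spec by (simp add: spectral_decomposition_def)
  then have "Re (cinner (fun_op_conv (indicator \<Omega>) S (h k)) (h k)) = eig k"
    by (simp add: cinner_scaleR_left cinner_h)
  then show "ennreal (eig k) = (\<integral>\<^sup>+z\<in>\<Omega>. ennreal (husimi z (h k)) \<partial>lborel)" "0 \<le> eig k"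
    using fun_op_conv_indicator_self[OF \<Omega>_borel \<Omega>_finite, of "h k"] by simp_all
qed

lemma eig_le_1: "eig k \<le> 1"
proof -
  have "ennreal (eig k) \<le> (\<integral>\<^sup>+z. ennreal (husimi z (h k)) \<partial>lborel)"
    unfolding ennreal_eig by (intro nn_integral_mono) (auto split: split_indicator)
  then show ?thesis by (simp add: nn_integral_husimi norm_h)
qed

text \<open>Both sides evaluate the form of the localization operator at \<open>f\<close>, one by
  its definition as an integral, the other by the spectral decomposition.\<close>

lemma nn_integral_husimi_eig:
  "(\<integral>\<^sup>+z\<in>\<Omega>. ennreal (husimi z f) \<partial>lborel) = (\<Sum>k. ennreal (eig k) * ennreal ((cmod (cinner f (h k)))\<^sup>2))"
proof -
  have "(\<lambda>k. eig k *\<^sub>R rank_one (h k) (h k) f) sums fun_op_conv (indicator \<Omega>) S f"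
    using spec by (simp add: spectral_decomposition_def)
  then have "(\<lambda>k. cinner (eig k *\<^sub>R rank_one (h k) (h k) f) f) sums cinner (fun_op_conv (indicator \<Omega>) S f) f"
    by (rule bounded_linear.sums[OF bounded_linear_cinner_left])
  then have "(\<lambda>k. of_real (eig k * (cmod (cinner f (h k)))\<^sup>2)) sums cinner (fun_op_conv (indicator \<Omega>) S f) f"
    by (simp only: rank_one_def cinner_scaleR_left cinner_cscale_left cinner_mult_commute of_real_mult)
  then have "(\<lambda>k. eig k * (cmod (cinner f (h k)))\<^sup>2) sums Re (cinner (fun_op_conv (indicator \<Omega>) S f) f)"
    by (drule_tac sums_Re) (simp only: Re_complex_of_real)
  then have "(\<Sum>k. ennreal (eig k * (cmod (cinner f (h k)))\<^sup>2)) = ennreal (Re (cinner (fun_op_conv (indicator \<Omega>) S f) f))"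
    by (rule suminf_ennreal_sums) (simp add: eig_nonneg)
  then show ?thesis
    by (simp add: fun_op_conv_indicator_self(1)[OF \<Omega>_borel \<Omega>_finite] ennreal_mult' eig_nonneg)
qed

text \<open>The factor 1 = \<open>norm (h k)\<close> squared is expanded over an auxiliary basis.
  The order of summation is then reversed, and \<open>husimi_onb\<close> gives density one at every
  point of \<open>\<Omega>\<close>.\<close>

lemma suminf_eig: "(\<Sum>k. ennreal (eig k)) = emeasure lborel \<Omega>"
proof -
  define E where "E = (SOME E :: 'a l2 set. is_onb E)"
  have E: "is_onb E" unfolding E_def by (rule onb)
  have "countable E" by (rule countable_orthonormal[OF is_onb_orthonormal[OF E]])
  have "(\<Sum>k. ennreal (eig k)) = (\<Sum>k. ennreal (eig k) * (\<integral>\<^sup>+e. ennreal ((cmod (cinner e (h k)))\<^sup>2) \<partial>count_space E))"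
    by (simp add: Parseval_nn_integral[OF E] norm_h)
  also have "\<dots> = (\<Sum>k. \<integral>\<^sup>+e. ennreal (eig k) * ennreal ((cmod (cinner e (h k)))\<^sup>2) \<partial>count_space E)"
    by (simp add: nn_integral_cmult)
  also have "\<dots> = (\<integral>\<^sup>+e. (\<Sum>k. ennreal (eig k) * ennreal ((cmod (cinner e (h k)))\<^sup>2)) \<partial>count_space E)"
    by (rule nn_integral_suminf[symmetric]) simp
  also have "\<dots> = (\<integral>\<^sup>+e. (\<integral>\<^sup>+z\<in>\<Omega>. ennreal (husimi z e) \<partial>lborel) \<partial>count_space E)"
    by (simp only: nn_integral_husimi_eig)
  also have "\<dots> = (\<integral>\<^sup>+z. \<integral>\<^sup>+e. ennreal (husimi z e) * indicator \<Omega> z \<partial>count_space E \<partial>lborel)"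
    by (rule nn_integral_count_space_nn_integral[OF \<open>countable E\<close>, symmetric]) measurable
  also have "\<dots> = (\<integral>\<^sup>+z. indicator \<Omega> z \<partial>lborel)"
    by (simp add: nn_integral_multc husimi_onb[OF E])
  finally show ?thesis by simp
qed

text \<open>One factor \<open>eig k\<close> is replaced by its integral formula, the other is kept
  as a weight. The weighted sum over \<open>k\<close> is then the form at
  \<open>tf_shift z (\<phi> j)\<close>, which is again an integral over
  \<open>\<Omega>\<close>.\<close>

lemma suminf_eig_sq:
  "(\<Sum>k. ennreal ((eig k)\<^sup>2)) = (\<integral>\<^sup>+z\<in>\<Omega>. (\<integral>\<^sup>+w\<in>\<Omega>. corr (w - z) \<partial>lborel) \<partial>lborel)"
proof -
  have "(\<Sum>k. ennreal ((eig k)\<^sup>2)) = (\<Sum>k. ennreal (eig k) * (\<integral>\<^sup>+z\<in>\<Omega>. ennreal (husimi z (h k)) \<partial>lborel))"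
    unfolding ennreal_eig[symmetric] by (simp add: power2_eq_square ennreal_mult eig_nonneg)
  also have "\<dots> = (\<Sum>k. \<integral>\<^sup>+z. ennreal (eig k) * (ennreal (husimi z (h k)) * indicator \<Omega> z) \<partial>lborel)"
    by (simp add: nn_integral_cmult)
  also have "\<dots> = (\<integral>\<^sup>+z. (\<Sum>k. ennreal (eig k) * (ennreal (husimi z (h k)) * indicator \<Omega> z)) \<partial>lborel)"
    by (rule nn_integral_suminf[symmetric]) measurable
  also have "\<dots> = (\<integral>\<^sup>+z\<in>\<Omega>. (\<integral>\<^sup>+w\<in>\<Omega>. corr (w - z) \<partial>lborel) \<partial>lborel)"
  proof (intro nn_integral_cong)
    fix z
    have "(\<Sum>k. ennreal (eig k) * ennreal (husimi z (h k)))
        = (\<Sum>k. \<Sum>j. ennreal (eig k) * ennreal ((cmod (cinner (tf_shift z (\<phi> j)) (h k)))\<^sup>2))"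
      unfolding ennreal_husimi by (subst cmod_cinner_commute) simp
    also have "\<dots> = (\<Sum>j. \<Sum>k. ennreal (eig k) * ennreal ((cmod (cinner (tf_shift z (\<phi> j)) (h k)))\<^sup>2))"
      by (rule suminf_swap_ennreal)
    also have "\<dots> = (\<Sum>j. \<integral>\<^sup>+w. ennreal (husimi w (tf_shift z (\<phi> j))) * indicator \<Omega> w \<partial>lborel)"
      by (simp only: nn_integral_husimi_eig)
    also have "\<dots> = (\<integral>\<^sup>+w. (\<Sum>j. ennreal (husimi w (tf_shift z (\<phi> j))) * indicator \<Omega> w) \<partial>lborel)"
      by (rule nn_integral_suminf[symmetric]) measurable
    also have "\<dots> = (\<integral>\<^sup>+w\<in>\<Omega>. corr (w - z) \<partial>lborel)"
      by (simp add: suminf_husimi_tf_shift)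
    finally show "(\<Sum>k. ennreal (eig k) * (ennreal (husimi z (h k)) * indicator \<Omega> z))
        = (\<integral>\<^sup>+w\<in>\<Omega>. corr (w - z) \<partial>lborel) * indicator \<Omega> z"
      by (simp add: mult.assoc[symmetric])
  qed
  finally show ?thesis .
qed

text \<open>For each \<open>z\<close> in \<open>\<Omega>\<close> the unit mass of the shifted
  correlation function splits into a part inside \<open>\<Omega>\<close>, which accounts for the
  squares, and a part that escapes. The escaping part is integrated with the displacement
  \<open>u\<close> outermost, so that the translation estimate produces the weight
  \<open>norm u\<close> of \<open>Mop_norm_sq\<close>.\<close>

lemma measure_le_suminf_eig_sq:
  assumes per: "perimeter \<Omega> < \<infinity>"
  shows "emeasure lborel \<Omega> \<le> (\<Sum>k. ennreal ((eig k)\<^sup>2)) + Mop_norm_sq S * perimeter \<Omega>"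
proof -
  have corr1: "(\<integral>\<^sup>+w. corr (w - z) \<partial>lborel) = 1" for z
    using nn_integral_lborel_plus[of "\<lambda>w. corr (w - z)" z] nn_integral_corr by simp
  have "emeasure lborel \<Omega> = (\<integral>\<^sup>+z\<in>\<Omega>. (\<integral>\<^sup>+w. corr (w - z) \<partial>lborel) \<partial>lborel)"
    by (simp add: corr1)
  also have "\<dots> = (\<integral>\<^sup>+z. (\<integral>\<^sup>+w\<in>\<Omega>. corr (w - z) \<partial>lborel) * indicator \<Omega> z
      + (\<integral>\<^sup>+w. corr (w - z) * indicator (- \<Omega>) w \<partial>lborel) * indicator \<Omega> z \<partial>lborel)"
  proof (intro nn_integral_cong)
    fix z
    have "(\<integral>\<^sup>+w. corr (w - z) \<partial>lborel)
        = (\<integral>\<^sup>+w. corr (w - z) * indicator \<Omega> w + corr (w - z) * indicator (- \<Omega>) w \<partial>lborel)"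
      by (intro nn_integral_cong) (auto split: split_indicator)
    also have "\<dots> = (\<integral>\<^sup>+w\<in>\<Omega>. corr (w - z) \<partial>lborel) + (\<integral>\<^sup>+w. corr (w - z) * indicator (- \<Omega>) w \<partial>lborel)"
      by (rule nn_integral_add) measurable
    finally show "(\<integral>\<^sup>+w. corr (w - z) \<partial>lborel) * indicator \<Omega> z
        = (\<integral>\<^sup>+w\<in>\<Omega>. corr (w - z) \<partial>lborel) * indicator \<Omega> z
          + (\<integral>\<^sup>+w. corr (w - z) * indicator (- \<Omega>) w \<partial>lborel) * indicator \<Omega> z"
      by (simp add: distrib_right)
  qed
  also have "\<dots> = (\<Sum>k. ennreal ((eig k)\<^sup>2)) + (\<integral>\<^sup>+z. (\<integral>\<^sup>+w. corr (w - z) * indicator (- \<Omega>) w \<partial>lborel) * indicator \<Omega> z \<partial>lborel)"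
    unfolding suminf_eig_sq by (rule nn_integral_add) measurable
  finally have split: "emeasure lborel \<Omega> = (\<Sum>k. ennreal ((eig k)\<^sup>2))
      + (\<integral>\<^sup>+z. (\<integral>\<^sup>+w. corr (w - z) * indicator (- \<Omega>) w \<partial>lborel) * indicator \<Omega> z \<partial>lborel)" .
  have "(\<integral>\<^sup>+z. (\<integral>\<^sup>+w. corr (w - z) * indicator (- \<Omega>) w \<partial>lborel) * indicator \<Omega> z \<partial>lborel)
      = (\<integral>\<^sup>+z. \<integral>\<^sup>+u. corr u * (indicator (- \<Omega>) (u + z) * indicator \<Omega> z) \<partial>lborel \<partial>lborel)"
  proof (intro nn_integral_cong)
    fix z
    have "(\<integral>\<^sup>+w. corr (w - z) * indicator (- \<Omega>) w \<partial>lborel) = (\<integral>\<^sup>+u. corr u * indicator (- \<Omega>) (u + z) \<partial>lborel)"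
      using nn_integral_lborel_plus[of "\<lambda>w. corr (w - z) * indicator (- \<Omega>) w" z] by simp
    then show "(\<integral>\<^sup>+w. corr (w - z) * indicator (- \<Omega>) w \<partial>lborel) * indicator \<Omega> z
        = (\<integral>\<^sup>+u. corr u * (indicator (- \<Omega>) (u + z) * indicator \<Omega> z) \<partial>lborel)"
      unfolding mult.assoc[symmetric] by (simp only:) (rule nn_integral_multc[symmetric], measurable)
  qed
  also have "\<dots> = (\<integral>\<^sup>+u. \<integral>\<^sup>+z. corr u * (indicator (- \<Omega>) (u + z) * indicator \<Omega> z) \<partial>lborel \<partial>lborel)"
    by (rule lborel_pair.Fubini') measurable
  \<comment> \<open>Written with \<open>- u\<close> to match the form of
    \<open>translation_le_perimeter\<close>; the norm does not see the sign.\<close>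
  also have "\<dots> = (\<integral>\<^sup>+u. corr u * emeasure lborel {z \<in> \<Omega>. z - (- u) \<notin> \<Omega>} \<partial>lborel)"
  proof (intro nn_integral_cong)
    fix u
    have [measurable]: "{z \<in> \<Omega>. z + u \<notin> \<Omega>} \<in> sets borel"
    proof -
      have "Measurable.pred borel (\<lambda>z. z + u \<in> \<Omega>)" by measurable
      then show ?thesis by measurable
    qed
    have "(\<integral>\<^sup>+z. corr u * (indicator (- \<Omega>) (u + z) * indicator \<Omega> z) \<partial>lborel)
        = (\<integral>\<^sup>+z. corr u * indicator {z \<in> \<Omega>. z + u \<notin> \<Omega>} z \<partial>lborel)"
      by (intro nn_integral_cong) (auto simp: add.commute split: split_indicator)
    then show "(\<integral>\<^sup>+z. corr u * (indicator (- \<Omega>) (u + z) * indicator \<Omega> z) \<partial>lborel)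
        = corr u * emeasure lborel {z \<in> \<Omega>. z - (- u) \<notin> \<Omega>}"
      by (simp add: nn_integral_cmult)
  qed
  also have "\<dots> \<le> (\<integral>\<^sup>+u. corr u * (ennreal (norm (- u)) * perimeter \<Omega>) \<partial>lborel)"
    by (intro nn_integral_mono mult_left_mono translation_le_perimeter[OF \<Omega> per]) simp
  also have "\<dots> = Mop_norm_sq S * perimeter \<Omega>"
    unfolding Mop_norm_sq_eq norm_minus_cancel mult.assoc[symmetric] by (rule nn_integral_multc) measurable
  finally show ?thesis unfolding split by (rule add_left_mono)
qed

text \<open>As \<rho> takes values between 0 and 1, |\<rho> - \<chi>| + 2 \<rho> \<chi> = \<rho> +
  \<chi> holds pointwise, \<chi> being the indicator of \<open>\<Omega>\<close>. Hence the distance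
  equals \<open>real A + \<Lambda> - 2 * L\<close>, with \<open>L\<close> the sum of the first
  \<open>A\<close> eigenvalues.\<close>

lemma nn_integral_accumulated_le:
  assumes per: "perimeter \<Omega> < \<infinity>" and Mop: "Mop_norm_sq S < \<infinity>"
  shows "(\<integral>\<^sup>+z. ennreal (cmod (accumulated S \<Omega> h z - indicator \<Omega> z)) \<partial>lborel)
    \<le> 2 + 2 * (Mop_norm_sq S * perimeter \<Omega>)" (is "?Y \<le> _")
    and "cmod (accumulated S \<Omega> h z - indicator \<Omega> z) \<le> 1"
    and "(\<lambda>z. cmod (accumulated S \<Omega> h z - indicator \<Omega> z)) \<in> borel_measurable borel"
proof -
  define A where "A = nat \<lceil>measure lborel \<Omega>\<rceil>"
  define \<Lambda> where "\<Lambda> = measure lborel \<Omega>"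
  define \<rho> where "\<rho> z = (\<Sum>k<A. husimi z (h k))" for z
  define L where "L = (\<Sum>k<A. eig k)"
  define X where "X = enn2real (Mop_norm_sq S * perimeter \<Omega>)"
  have X: "Mop_norm_sq S * perimeter \<Omega> = ennreal X" "X \<ge> 0"
    using per Mop by (simp_all add: X_def ennreal_mult_less_top)
  have em\<Omega>: "emeasure lborel \<Omega> = ennreal \<Lambda>"
    using \<Omega>_finite by (simp add: \<Lambda>_def emeasure_eq_ennreal_measure)
  have \<Lambda>0: "\<Lambda> \<ge> 0" by (simp add: \<Lambda>_def)
  have A: "\<Lambda> \<le> real A" "real A \<le> \<Lambda> + 1"
    using \<Lambda>0 unfolding A_def \<Lambda>_def by linarith+
  have eig0: "0 \<le> eig k" and eig1: "eig k \<le> 1" for k using eig_nonneg eig_le_1 by auto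
  have s1: "eig sums \<Lambda>"
  proof -
    have eq: "(\<Sum>k. ennreal (eig k)) = ennreal \<Lambda>" using suminf_eig em\<Omega> by simp
    then have "summable eig" using eig0 by (intro summable_suminf_not_top) auto
    with eq eig0 \<Lambda>0 show ?thesis by (simp add: suminf_ennreal2 sums_iff suminf_nonneg)
  qed
  have "summable (\<lambda>k. (eig k)\<^sup>2)"
  proof (rule summable_comparison_test'[where g = eig and N = 0])
    show "norm ((eig k)\<^sup>2) \<le> eig k" for k
      using eig0[of k] eig1[of k] by (simp add: power2_eq_square mult_left_le_one_le)
  qed (use s1 in \<open>simp add: sums_iff\<close>)
  then have s2: "(\<lambda>k. (eig k)\<^sup>2) sums (\<Sum>k. (eig k)\<^sup>2)" by (rule summable_sums)
  define q where "q = (\<Sum>k. (eig k)\<^sup>2)"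
  have q0: "q \<ge> 0" unfolding q_def using s2 by (intro suminf_nonneg) (auto simp: sums_iff)
  have "(\<Sum>k. ennreal ((eig k)\<^sup>2)) = ennreal q"
    unfolding q_def by (rule suminf_ennreal_sums[OF s2]) simp
  with measure_le_suminf_eig_sq[OF per] have "ennreal \<Lambda> \<le> ennreal q + ennreal X"
    by (simp only: em\<Omega> X(1))
  then have "ennreal \<Lambda> \<le> ennreal (q + X)" by (simp only: ennreal_plus[OF q0 X(2)])
  then have "\<Lambda> - q \<le> X" using q0 X(2) by (subst (asm) ennreal_le_iff) auto
  moreover have "decseq eig" using spec by (simp add: spectral_decomposition_def)
  ultimately have "(\<Sum>k<A. 1 - eig k) \<le> 1 + X"
    using sum_one_minus_eigenvalues_le[OF _ eig0 eig1 s1 s2[folded q_def] A(2)] by simp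
  then have U: "real A - L \<le> 1 + X" by (simp add: L_def sum_subtractf)
  have acc: "accumulated S \<Omega> h z = of_real (\<rho> z)" for z
    by (simp add: accumulated_def Cohen_eq_husimi \<rho>_def A_def)
  have \<rho>0: "0 \<le> \<rho> z" for z by (simp add: \<rho>_def husimi_nonneg sum_nonneg)
  have \<rho>1: "\<rho> z \<le> 1" for z
  proof -
    have "\<rho> z = (\<Sum>e\<in>h ` {..<A}. husimi z e)"
      unfolding \<rho>_def using inj_h by (subst sum.reindex) (auto intro: inj_on_subset)
    also have "\<dots> \<le> 1" by (rule husimi_sum_le_1[OF orthonormal_h]) auto
    finally show ?thesis .
  qed
  have [measurable]: "\<rho> \<in> borel_measurable borel" unfolding \<rho>_def[abs_def] by measurable
  have diff: "cmod (accumulated S \<Omega> h z - indicator \<Omega> z) = \<bar>\<rho> z - indicat_real \<Omega> z\<bar>" for z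
  proof -
    have "accumulated S \<Omega> h z - indicator \<Omega> z = of_real (\<rho> z - indicat_real \<Omega> z)"
      by (simp add: acc split: split_indicator)
    then show ?thesis by (simp only: norm_of_real)
  qed
  show "cmod (accumulated S \<Omega> h z - indicator \<Omega> z) \<le> 1"
    unfolding diff using \<rho>0[of z] \<rho>1[of z] by (auto split: split_indicator)
  show "(\<lambda>z. cmod (accumulated S \<Omega> h z - indicator \<Omega> z)) \<in> borel_measurable borel"
    unfolding diff by measurable
  have int_\<rho>: "(\<integral>\<^sup>+z. ennreal (\<rho> z) \<partial>lborel) = ennreal (real A)"
  proof -
    have "(\<integral>\<^sup>+z. ennreal (\<rho> z) \<partial>lborel) = (\<integral>\<^sup>+z. (\<Sum>k<A. ennreal (husimi z (h k))) \<partial>lborel)"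
      by (simp add: \<rho>_def sum_ennreal husimi_nonneg)
    also have "\<dots> = (\<Sum>k<A. \<integral>\<^sup>+z. ennreal (husimi z (h k)) \<partial>lborel)"
      by (rule nn_integral_sum) measurable
    also have "\<dots> = ennreal (real A)"
      by (simp add: nn_integral_husimi norm_h ennreal_of_nat_eq_real_of_nat)
    finally show ?thesis .
  qed
  have int_\<rho>\<Omega>: "(\<integral>\<^sup>+z\<in>\<Omega>. ennreal (\<rho> z) \<partial>lborel) = ennreal L"
  proof -
    have "(\<integral>\<^sup>+z\<in>\<Omega>. ennreal (\<rho> z) \<partial>lborel) = (\<integral>\<^sup>+z. (\<Sum>k<A. ennreal (husimi z (h k)) * indicator \<Omega> z) \<partial>lborel)"
      by (simp add: \<rho>_def sum_distrib_right[symmetric] sum_ennreal husimi_nonneg)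
    also have "\<dots> = (\<Sum>k<A. \<integral>\<^sup>+z. ennreal (husimi z (h k)) * indicator \<Omega> z \<partial>lborel)"
      by (rule nn_integral_sum) measurable
    also have "\<dots> = (\<Sum>k<A. ennreal (eig k))" by (simp only: ennreal_eig)
    also have "\<dots> = ennreal L" by (simp add: L_def sum_ennreal eig0)
    finally show ?thesis .
  qed
  \<comment> \<open>\<open>2 * L\<close> is added on both sides, since subtraction of extended reals
    is truncated; finiteness of \<open>?Y\<close> then follows from the resulting equation.\<close>
  have "?Y + ennreal (2 * L) = ?Y + 2 * (\<integral>\<^sup>+z\<in>\<Omega>. ennreal (\<rho> z) \<partial>lborel)"
    unfolding int_\<rho>\<Omega> using eig0 by (simp add: ennreal_mult L_def sum_nonneg)
  also have "\<dots> = (\<integral>\<^sup>+z. ennreal \<bar>\<rho> z - indicat_real \<Omega> z\<bar> + 2 * (ennreal (\<rho> z) * indicator \<Omega> z) \<partial>lborel)"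
    unfolding diff by (simp add: nn_integral_add nn_integral_cmult)
  also have "\<dots> = (\<integral>\<^sup>+z. ennreal (\<rho> z) + indicator \<Omega> z \<partial>lborel)"
  proof (intro nn_integral_cong)
    fix z
    have "1 - \<rho> z + 2 * \<rho> z = \<rho> z + 1" by simp
    then have "ennreal (1 - \<rho> z) + 2 * ennreal (\<rho> z) = ennreal (\<rho> z) + 1"
      using \<rho>0[of z] \<rho>1[of z] by (simp flip: ennreal_plus ennreal_mult ennreal_numeral ennreal_1)
    then show "ennreal \<bar>\<rho> z - indicat_real \<Omega> z\<bar> + 2 * (ennreal (\<rho> z) * indicator \<Omega> z) = ennreal (\<rho> z) + indicator \<Omega> z"
      using \<rho>0[of z] \<rho>1[of z] by (auto split: split_indicator)
  qed
  also have "\<dots> = ennreal (real A) + ennreal \<Lambda>"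
    by (simp add: nn_integral_add int_\<rho> em\<Omega>)
  also have "\<dots> = ennreal (real A + \<Lambda>)" using \<Lambda>0 by simp
  finally have Y: "?Y + ennreal (2 * L) = ennreal (real A + \<Lambda>)" .
  then have "?Y < \<infinity>" by (metis ennreal_add_eq_top ennreal_less_top infinity_ennreal_def less_top)
  then obtain y where y: "?Y = ennreal y" "y \<ge> 0" by (cases ?Y) auto
  have L0: "L \<ge> 0" by (simp add: L_def eig0 sum_nonneg)
  have "ennreal (y + 2 * L) = ennreal (real A + \<Lambda>)" using Y y L0 by simp
  then have "y + 2 * L = real A + \<Lambda>" using y L0 \<Lambda>0 by (simp only: ennreal_inj)
  \<comment> \<open>\<open>y\<close> is \<open>2 * (real A - L)\<close> minus the nonnegative number
    \<open>real A - \<Lambda>\<close>.\<close>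
  then have "y \<le> 2 + 2 * X" using U A(1) by linarith
  then have "ennreal y \<le> 2 + 2 * ennreal X"
    using X(2) by (simp flip: ennreal_plus ennreal_mult ennreal_numeral)
  then show "?Y \<le> 2 + 2 * (Mop_norm_sq S * perimeter \<Omega>)" using y(1) X(1) by simp
qed

text \<open>The constant 4 comes from 2 + 2 X \<le> 4 X for X \<ge> 1, with X the product of squared
  norm and perimeter. Markov's inequality supplies 1/\<delta>, which is at most 1/\<delta>^2 in the
  only range where the set can be nonempty.\<close>

lemma emeasure_accumulated_le:
  assumes per: "perimeter \<Omega> < \<infinity>" and Mop: "Mop_norm_sq S < \<infinity>"
    and ge: "Mop_norm_sq S * perimeter \<Omega> \<ge> 1" and \<delta>: "\<delta> > 0"
  shows "emeasure lborel {z. cmod (accumulated S \<Omega> h z - indicator \<Omega> z) > \<delta>}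
    \<le> ennreal (4 / \<delta>\<^sup>2) * Mop_norm_sq S * perimeter \<Omega>"
proof (cases "\<delta> \<ge> 1")
  case True
  then have "{z. cmod (accumulated S \<Omega> h z - indicator \<Omega> z) > \<delta>} = {}"
    using order_trans[OF nn_integral_accumulated_le(2)[OF per Mop] True] by (auto simp: not_less)
  then show ?thesis by (simp only: emeasure_empty zero_le)
next
  case False
  note [measurable] = nn_integral_accumulated_le(3)[OF per Mop]
  let ?f = "\<lambda>z. cmod (accumulated S \<Omega> h z - indicator \<Omega> z)"
  have "emeasure lborel {z. ?f z > \<delta>} \<le> emeasure lborel {z \<in> UNIV. 1 \<le> ennreal (1 / \<delta>) * ennreal (?f z)}"
  proof (rule emeasure_mono)
    show "{z. ?f z > \<delta>} \<subseteq> {z \<in> UNIV. 1 \<le> ennreal (1 / \<delta>) * ennreal (?f z)}"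
    proof clarsimp
      fix z assume "\<delta> < ?f z"
      then have "1 \<le> 1 / \<delta> * ?f z" using \<delta> by (simp add: field_simps)
      then have "ennreal 1 \<le> ennreal (1 / \<delta> * ?f z)" by (rule ennreal_leI)
      also have "\<dots> = ennreal (1 / \<delta>) * ennreal (?f z)" using \<delta> by (intro ennreal_mult) auto
      finally show "1 \<le> ennreal (1 / \<delta>) * ennreal (?f z)" by (simp only: ennreal_1)
    qed
    show "{z \<in> UNIV. 1 \<le> ennreal (1 / \<delta>) * ennreal (?f z)} \<in> sets lborel" by measurable
  qed
  also have "\<dots> \<le> ennreal (1 / \<delta>) * (\<integral>\<^sup>+z. ennreal (?f z) * indicator UNIV z \<partial>lborel)"
    by (rule nn_integral_Markov_inequality) auto
  also have "\<dots> \<le> ennreal (1 / \<delta>) * (2 + 2 * (Mop_norm_sq S * perimeter \<Omega>))"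
    using nn_integral_accumulated_le(1)[OF per Mop] by (intro mult_left_mono) auto
  also have "\<dots> \<le> ennreal (1 / \<delta>\<^sup>2) * (4 * (Mop_norm_sq S * perimeter \<Omega>))"
  proof (intro mult_mono ennreal_leI)
    show "1 / \<delta> \<le> 1 / \<delta>\<^sup>2"
      using \<delta> False by (intro divide_left_mono) (auto simp: power2_eq_square mult_left_le)
    have "2 + 2 * (Mop_norm_sq S * perimeter \<Omega>) \<le> 2 * (Mop_norm_sq S * perimeter \<Omega>) + 2 * (Mop_norm_sq S * perimeter \<Omega>)"
      using mult_left_mono[OF ge, of 2] by (intro add_mono) auto
    then show "2 + 2 * (Mop_norm_sq S * perimeter \<Omega>) \<le> 4 * (Mop_norm_sq S * perimeter \<Omega>)"
      by (simp flip: distrib_right)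
  qed auto
  also have "\<dots> = ennreal (4 / \<delta>\<^sup>2) * Mop_norm_sq S * perimeter \<Omega>"
  proof -
    have "ennreal (4 / \<delta>\<^sup>2) = ennreal (1 / \<delta>\<^sup>2 * 4)" by simp
    also have "\<dots> = ennreal (1 / \<delta>\<^sup>2) * 4" by (subst ennreal_mult) auto
    finally show ?thesis by (simp only: mult.assoc)
  qed
  finally show ?thesis .
qed

end

end

theorem theorem1p2:
  shows "\<exists>C::real. C > 0 \<and>
    (\<forall>(S :: (real ^ 'd) l2op) (\<Omega> :: ((real ^ 'd) \<times> (real ^ 'd)) set)
       (eig :: nat \<Rightarrow> real) (h :: nat \<Rightarrow> (real ^ 'd) l2) (\<delta> :: real).
       S \<in> Mop \<longrightarrow>
       compact \<Omega> \<longrightarrow> bounded_variation (indicat_real \<Omega>) \<longrightarrow>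
       Mop_norm_sq S * perimeter \<Omega> \<ge> 1 \<longrightarrow>
       spectral_decomposition (fun_op_conv (indicator \<Omega>) S) eig h \<longrightarrow>
       \<delta> > 0 \<longrightarrow>
       emeasure lborel {z. cmod (accumulated S \<Omega> h z - indicator \<Omega> z) > \<delta>}
         \<le> ennreal (C / \<delta>\<^sup>2) * Mop_norm_sq S * perimeter \<Omega>)"
proof (intro exI[of _ 4] conjI allI impI)
  fix S :: "(real ^ 'd) l2op" and \<Omega> :: "((real ^ 'd) \<times> (real ^ 'd)) set"
    and eig :: "nat \<Rightarrow> real" and h :: "nat \<Rightarrow> (real ^ 'd) l2" and \<delta> :: real
  assume S: "S \<in> Mop" and \<Omega>: "compact \<Omega>" and BV: "bounded_variation (indicat_real \<Omega>)"
    and ge: "Mop_norm_sq S * perimeter \<Omega> \<ge> 1"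
    and spec: "spectral_decomposition (fun_op_conv (indicator \<Omega>) S) eig h" and \<delta>: "\<delta> > 0"
  have "density_operator S" and Mop: "Mop_norm_sq S < \<infinity>" using S by (auto simp: Mop_def)
  then obtain \<phi> where "mixed_state S \<phi>" by (metis density_operator_mixed_state)
  then interpret mixed_state S \<phi> .
  have "perimeter \<Omega> < \<infinity>" using BV by (simp add: bounded_variation_def perimeter_def)
  then show "emeasure lborel {z. cmod (accumulated S \<Omega> h z - indicator \<Omega> z) > \<delta>}
         \<le> ennreal (4 / \<delta>\<^sup>2) * Mop_norm_sq S * perimeter \<Omega>"
    by (rule emeasure_accumulated_le[OF \<Omega> spec _ Mop ge \<delta>])
qed simp

end
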